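(* Let $D$ be the disk of area $1$ centered at the origin. Let $\beta$ be a spiral, i.e. a curve described in polar coordinates by $|r|=f(\phi)$, $0\le\phi\le\pi\ell$, where $\ell>0$ and $f$ is a strictly increasing real function with $f(\pi\ell)=\pi^{-1/2}$ (so $\beta$ is inscribed in $D$). Then $\beta$ satisfies all of the following conditions: (cong) $\beta$ splits $D$ into two congruent parts; (conc) $\beta$ crosses each circle concentric with $D$ exactly twice; (rad$'$) $\beta$ crosses each radius of $D$ exactly twice, besides at the center of $D$; (perf) $\beta$ splits $D$ into two perfect sets; (smooth) $\beta$ has an infinitely differentiable parameterization $[0,1]\to D$ with nowhere vanishing derivative; (alg) $\beta$ is algebraic in polar coordinates; if and only if $\beta$ is congruent to Fermat's spiral $2\pi^2r^2=\phi$, $0\le\phi\le2\pi$.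
   Context: $\mu$ is Lebesgue measure. A set $X\subseteq D$ is symmetric if $s(X)=X$ for some non-identity isometry $s$ of the plane mapping $D$ onto itself. A measurable set $A\subseteq D$ is perfect if $\mu(A)=1/2$ and every symmetric subset of $A$ has measure at most $1/4$. Polar coordinates: the map $\Pi$ from the $(\phi,r)$-plane onto the $(x,y)$-plane, $x=r\cos\phi$, $y=r\sin\phi$, with $\phi,r$ any reals. A curve in the $(\phi,r)$-plane is algebraic if its points satisfy $P(\phi,r)=0$ for a nonzero real polynomial $P$; a curve in the $(x,y)$-plane is algebraic in polar coordinates if it is the image under $\Pi$ of an algebraic curve in the $(\phi,r)$-plane. *)

theory Defs
  imports "HOL-Analysis.Analysis" "HOL-Computational_Algebra.Polynomial"
begin

text \<open>The Euclidean plane is the type \<^typ>\<open>complex\<close>.\<close>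

definition plane_isometry :: "(complex \<Rightarrow> complex) \<Rightarrow> bool" where
  "plane_isometry s \<longleftrightarrow> (\<forall>x y. dist (s x) (s y) = dist x y)"

definition congruent_sets :: "complex set \<Rightarrow> complex set \<Rightarrow> bool" where
  "congruent_sets A B \<longleftrightarrow> (\<exists>s. plane_isometry s \<and> s ` A = B)"

definition disk :: "complex set" where
  "disk = cball 0 (1 / sqrt pi)"

lemma measure_disk: "measure lebesgue disk = 1"
  by (simp add: disk_def content_cball unit_ball_vol_2 power_divide)

definition symmetric_set :: "complex set \<Rightarrow> bool" where
  "symmetric_set X \<longleftrightarrow> X \<subseteq> disk \<and>
     (\<exists>s. plane_isometry s \<and> s \<noteq> id \<and> s ` disk = disk \<and> s ` X = X)"

definition perfect_set :: "complex set \<Rightarrow> bool" where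
  "perfect_set A \<longleftrightarrow> A \<subseteq> disk \<and> A \<in> sets lebesgue \<and> measure lebesgue A = 1 / 2 \<and>
     (\<forall>X. X \<subseteq> A \<and> X \<in> sets lebesgue \<and> symmetric_set X \<longrightarrow> measure lebesgue X \<le> 1 / 4)"

definition polar :: "real \<times> real \<Rightarrow> complex" where
  "polar = (\<lambda>(\<phi>, r). Complex (r * cos \<phi>) (r * sin \<phi>))"

definition curve :: "'a::topological_space set \<Rightarrow> bool" where
  "curve C \<longleftrightarrow> (\<exists>(I::real set) \<gamma>. is_interval I \<and> continuous_on I \<gamma> \<and> C = \<gamma> ` I)"

text \<open>A real polynomial in \<open>\<phi>\<close> and \<open>r\<close> is a polynomial in \<open>r\<close> with coefficients in \<open>\<real>[\<phi>]\<close>.\<close>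

definition algebraic_curve :: "(real \<times> real) set \<Rightarrow> bool" where
  "algebraic_curve C \<longleftrightarrow> curve C \<and>
     (\<exists>P :: real poly poly. P \<noteq> 0 \<and> (\<forall>(\<phi>, r) \<in> C. poly (poly P [:r:]) \<phi> = 0))"

definition algebraic_in_polar :: "complex set \<Rightarrow> bool" where
  "algebraic_in_polar \<beta> \<longleftrightarrow> (\<exists>C. algebraic_curve C \<and> \<beta> = polar ` C)"

definition spiral :: "real \<Rightarrow> (real \<Rightarrow> real) \<Rightarrow> complex set" where
  "spiral l f = polar ` {(\<phi>, r). 0 \<le> \<phi> \<and> \<phi> \<le> pi * l \<and> \<bar>r\<bar> = f \<phi>}"

definition fermat_spiral :: "complex set" where
  "fermat_spiral = polar ` {(\<phi>, r). 2 * pi\<^sup>2 * r\<^sup>2 = \<phi> \<and> 0 \<le> \<phi> \<and> \<phi> \<le> 2 * pi}"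

definition splits_disk :: "complex set \<Rightarrow> complex set \<Rightarrow> complex set \<Rightarrow> bool" where
  "splits_disk \<beta> A B \<longleftrightarrow> A \<noteq> B \<and> components (disk - \<beta>) = {A, B}"

definition cond_cong :: "complex set \<Rightarrow> bool" where
  "cond_cong \<beta> \<longleftrightarrow> (\<exists>A B. splits_disk \<beta> A B \<and> congruent_sets A B)"

text \<open>Crossing a circle or a radius \<open>n\<close> times means having exactly \<open>n\<close> points in common with it.
  End points count: each end point of Fermat's spiral is one of its two points on a radius.\<close>

definition cond_conc :: "complex set \<Rightarrow> bool" where
  "cond_conc \<beta> \<longleftrightarrow> (\<forall>\<rho>. 0 < \<rho> \<and> \<rho> \<le> 1 / sqrt pi \<longrightarrow> card (\<beta> \<inter> sphere 0 \<rho>) = 2)"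

definition cond_rad' :: "complex set \<Rightarrow> bool" where
  "cond_rad' \<beta> \<longleftrightarrow>
     (\<forall>p \<in> sphere 0 (1 / sqrt pi). card ((\<beta> \<inter> closed_segment 0 p) - {0}) = 2)"

definition cond_perf :: "complex set \<Rightarrow> bool" where
  "cond_perf \<beta> \<longleftrightarrow> (\<exists>A B. splits_disk \<beta> A B \<and> perfect_set A \<and> perfect_set B)"

text \<open>Derivatives of all orders on \<open>[0,1]\<close>, one-sided at the end points:
  \<open>d n\<close> is the \<open>n\<close>-th derivative.\<close>

definition infinitely_differentiable :: "(real \<Rightarrow> complex) \<Rightarrow> bool" where
  "infinitely_differentiable \<gamma> \<longleftrightarrow>
     (\<exists>d :: nat \<Rightarrow> real \<Rightarrow> complex. d 0 = \<gamma> \<and>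
        (\<forall>n. \<forall>t \<in> {0..1}. (d n has_vector_derivative d (Suc n) t) (at t within {0..1})))"

definition cond_smooth :: "complex set \<Rightarrow> bool" where
  "cond_smooth \<beta> \<longleftrightarrow>
     (\<exists>\<gamma>. infinitely_differentiable \<gamma> \<and> \<gamma> ` {0..1} \<subseteq> disk \<and> \<gamma> ` {0..1} = \<beta> \<and>
        (\<forall>t \<in> {0..1}. vector_derivative \<gamma> (at t within {0..1}) \<noteq> 0))"

end

theory Submission
  imports Defs "HOL-Computational_Algebra.Polynomial_Factorial"
    "HOL-Computational_Algebra.Field_as_Ring"
begin

text \<open>
  The conditions on circles and radii force the spiral to be \<open>\<plusminus> g x cis (a + x)\<close> for \<open>0 \<le> x \<le> 2 pi\<close>
  with \<open>g\<close> a homeomorphism onto \<open>[0, R]\<close>; put \<open>h = g^2\<close>. On every circle each part is a half circle.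
  A set inside a half circle invariant under a rotation is empty, so perfectness only concerns
  reflections. The overlaps of a part with two of its mirror images in perpendicular axes add up to
  \<open>1/2\<close>, so all these overlaps equal \<open>1/4\<close>; differentiating in the angle of the axis gives
  \<open>h x - h (x + pi/2) + h (x + pi) - h (x + 3 pi/2) = const\<close> on \<open>[0, pi/2]\<close>.

  Extend \<open>h\<close> beyond \<open>2 pi\<close> by \<open>h (x + 2 pi) = h x + 1/pi\<close>; by the equation, the extension is near \<open>2 pi\<close> a
  combination of translates of \<open>h\<close> at interior points. Smoothness of the curve gives \<open>h\<close> at every
  interior point an asymptotic expansion in an odd root of the variable, and for algebraic functions
  such expansions give unique continuation. So one prime polynomial \<open>S\<close> vanishes on the whole extended
  graph; it divides its translate by \<open>(2 pi, 1/pi)\<close>, hence vanishes on lines of slope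
  \<open>1 / (2 pi^2)\<close> through the points of the graph. As \<open>S\<close> vanishes on finitely many such lines, \<open>h\<close> is linear.
\<close>

section \<open>Bivariate polynomials\<close>

text \<open>Two obstacles decide the form of the argument. A smooth regular curve need not be a
  smooth graph over the angle: where its tangent is radial, h behaves like an odd root. And an
  algebraic relation does not by itself determine a function from its germ, since branches may be
  exchanged at a crossing, as for |x| and y^2 = x^2. Expansions settle both: if a polynomial in x
  and h vanishes on one side of a point, it is flat on the other side, and coprime polynomials
  cannot both be flat there. Neither half of the information suffices alone. The functional equation
  is unchanged when a function of period pi / 2 is added to h, and the algebraic relation leaves h
  free among algebraic functions. They meet at the angle 2 pi, where the extension is glued and no
  expansion comes from smoothness, because the angles 0 and 2 pi belong to the center and to the end
  of the curve. The step 1 / pi is the squared radius of the disk, so that the extension has no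
  jump.\<close>

definition bpoly :: "real poly poly \<Rightarrow> real \<Rightarrow> real \<Rightarrow> real" where
  "bpoly P x y = poly (poly P [:y:]) x"

lemma bpoly_simps [simp]:
  "bpoly 0 x y = 0" "bpoly 1 x y = 1"
  "bpoly (P + Q) x y = bpoly P x y + bpoly Q x y"
  "bpoly (P - Q) x y = bpoly P x y - bpoly Q x y"
  "bpoly (P * Q) x y = bpoly P x y * bpoly Q x y"
  "bpoly (smult c P) x y = poly c x * bpoly P x y"
  "bpoly (pCons c P) x y = poly c x + y * bpoly P x y"
  by (simp_all add: bpoly_def)

lemma bpoly_altdef: "bpoly P x y = poly (map_poly (\<lambda>p. poly p x) P) y"
  by (induction P) (auto simp: map_poly_pCons)

lemma continuous_on_bpoly [continuous_intros]:
  assumes "continuous_on A u" "continuous_on A v"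
  shows "continuous_on A (\<lambda>t. bpoly P (u t) (v t))"
  by (induction P) (auto intro!: continuous_intros assms)

lemma finite_bpoly_roots:
  assumes "poly (lead_coeff P) x \<noteq> 0"
  shows "finite {y. bpoly P x y = 0}"
proof -
  have "coeff (map_poly (\<lambda>p. poly p x) P) (degree P) \<noteq> 0"
    using assms by (simp add: coeff_map_poly)
  then have "map_poly (\<lambda>p. poly p x) P \<noteq> 0" by auto
  then show ?thesis unfolding bpoly_altdef by (rule poly_roots_finite)
qed

lemma bpoly_nonzero_ex:
  assumes "P \<noteq> 0"
  obtains x y where "bpoly P x y \<noteq> 0"
proof -
  have "finite {x. poly (lead_coeff P) x = 0}" using assms by (intro poly_roots_finite) auto
  then obtain x where x: "poly (lead_coeff P) x \<noteq> 0"
    using ex_new_if_finite[of "{x. poly (lead_coeff P) x = 0}"] infinite_UNIV_char_0 by auto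
  obtain y where "bpoly P x y \<noteq> 0"
    using ex_new_if_finite[OF _ finite_bpoly_roots[OF x]] infinite_UNIV_char_0 by auto
  then show ?thesis using that by blast
qed

text \<open>Translates the zero set by (-c, -m). A relation for a quasi-periodic graph can thus be
  compared with itself one period later.\<close>

definition bshift :: "real \<Rightarrow> real \<Rightarrow> real poly poly \<Rightarrow> real poly poly" where
  "bshift c m P = pcompose (map_poly (\<lambda>p. pcompose p [:c, 1:]) P) [:[:m:], 1:]"

lemma bpoly_bshift [simp]: "bpoly (bshift c m P) x y = bpoly P (x + c) (y + m)"
proof -
  have "bpoly (map_poly (\<lambda>p. pcompose p [:c, 1:]) P) x z = bpoly P (x + c) z" for z
    by (induction P) (auto simp: map_poly_pCons poly_pcompose pcompose_pCons add.commute)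
  then show ?thesis
    by (simp add: bshift_def bpoly_def poly_pcompose add.commute)
qed

lemma bshift_nonzero: "P \<noteq> 0 \<Longrightarrow> bshift c m P \<noteq> 0"
proof
  assume "P \<noteq> 0" and eq: "bshift c m P = 0"
  then obtain x y where "bpoly P x y \<noteq> 0" using bpoly_nonzero_ex by blast
  moreover have "bpoly (bshift c m P) (x - c) (y - m) = bpoly P x y" by simp
  ultimately show False using eq by simp
qed

text \<open>Over the field of rational functions in x the polynomials in y form a principal ideal
  ring, so coprime S and T generate 1; clearing denominators leaves a nonzero polynomial r in x
  alone. Fractions are avoided here: an element w of least degree in the ideal (S, T) divides scalar
  multiples of S and T by pseudo-division, and primality of S forces w to be free of y.\<close>

lemma prime_bezout:
  fixes S T :: "real poly poly"
  assumes S: "prime_elem S" "degree S > 0" and T: "\<not> S dvd T"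
  obtains a b r where "r \<noteq> 0" "a * S + b * T = [:r:]"
proof -
  define I where "I = {w. w \<noteq> 0 \<and> (\<exists>a b. w = a * S + b * T)}"
  have "S \<noteq> 0" using S by auto
  then have "S \<in> I" unfolding I_def mem_Collect_eq
    by (intro conjI exI[of _ "1 :: real poly poly"] exI[of _ "0 :: real poly poly"]) simp_all
  then obtain w where w: "w \<in> I" and min: "\<And>v. v \<in> I \<Longrightarrow> degree w \<le> degree v"
    using arg_min_natI[of "\<lambda>v. v \<in> I" S degree] arg_min_nat_le[of "\<lambda>v. v \<in> I" _ degree]
    by blast
  then obtain a b where w0: "w \<noteq> 0" and wab: "w = a * S + b * T" by (auto simp: I_def)
  \<comment> \<open>The pseudo-remainder of v by w lies in the ideal again and would have smaller
    degree than w, so it is zero.\<close>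
  have red: "\<exists>c q. c \<noteq> 0 \<and> smult c v = w * q" if v: "v = a' * S + b' * T" for v a' b'
  proof -
    from pseudo_mod[OF w0, of v] obtain c q where cq: "c \<noteq> 0" "smult c v = w * q + pseudo_mod v w"
      and deg: "pseudo_mod v w = 0 \<or> degree (pseudo_mod v w) < degree w" by blast
    have "pseudo_mod v w = smult c v - w * q" using cq by simp
    also have "\<dots> = (smult c a' - a * q) * S + (smult c b' - b * q) * T"
      by (simp add: v wab algebra_simps smult_add_right)
    finally have "pseudo_mod v w = 0" using min[of "pseudo_mod v w"] deg
      unfolding I_def mem_Collect_eq by (meson not_less)
    then show ?thesis using cq by auto
  qed
  obtain c q where c: "c \<noteq> 0" and cS: "smult c S = w * q" using red[of S 1 0] by auto
  obtain c' q' where c': "c' \<noteq> 0" and cT: "smult c' T = w * q'" using red[of T 0 1] by auto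
  have noconst: "\<not> S dvd [:d:]" if "d \<noteq> 0" for d
    using that S(2) dvd_imp_degree_le[of S "[:d:]"] by auto
  have "S dvd w * q" using cS by (metis dvd_smult dvd_refl)
  \<comment> \<open>\<open>S dvd w\<close> would make S divide a scalar multiple of T, against
    primality; \<open>S dvd q\<close> lets S cancel and exhibits w as a factor of the constant
    c.\<close>
  then consider "S dvd w" | "S dvd q" using S(1) prime_elem_dvd_mult_iff by blast
  then show thesis
  proof cases
    case 1
    then have "S dvd [:c':] * T" using cT by (simp add: dvd_mult2)
    then have False using S(1) T noconst[OF c'] by (metis prime_elem_dvd_mult_iff)
    then show ?thesis ..
  next
    case 2
    then obtain q2 where q2: "q = S * q2" by auto
    have "S * ([:c:]) = S * (w * q2)" using cS unfolding q2 by (simp add: algebra_simps)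
    then have "[:c:] = w * q2" using \<open>S \<noteq> 0\<close> by (rule mult_left_cancel[THEN iffD1, rotated])
    then have "degree w = 0"
      using c by (metis add_eq_0_iff_both_eq_0 degree_mult_eq degree_pCons_0 mult_eq_0_iff pCons_eq_0_iff)
    then obtain r where "w = [:r:]" using degree_eq_zeroE by blast
    then show ?thesis using that[of r a b] w0 wab by auto
  qed
qed

lemma poly_eq_zero_of_infinite:
  fixes p :: "real poly"
  assumes "infinite X" "\<And>x. x \<in> X \<Longrightarrow> poly p x = 0"
  shows "p = 0"
  using assms poly_roots_finite[of p] finite_subset[of X "{x. poly p x = 0}"] by blast

section \<open>Asymptotic expansions and unique continuation\<close>

text \<open>A polynomial expansion to every order on both sides of 0, as a smooth function has by
  Taylor's theorem, but without any derivatives. The filter \<open>at 0\<close> is punctured, so the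
  value \<open>k 0\<close> is free; this matters in compositions.\<close>

definition texp :: "(real \<Rightarrow> real) \<Rightarrow> bool" where
  "texp k \<longleftrightarrow> (\<forall>N. \<exists>p. (\<lambda>s. k s - poly p s) \<in> O[at 0](\<lambda>s. s ^ N))"

lemma poly_bigo_1: "poly (p::real poly) \<in> O[at 0](\<lambda>_. 1)"
  by (intro bigoI_tendsto[of _ _ "poly p 0"]) (auto intro!: tendsto_eq_intros)

lemma texp_poly: "texp (poly p)"
  unfolding texp_def by (intro allI exI[of _ p]) simp

lemma texp_bigo_1:
  assumes "texp k" shows "k \<in> O[at 0](\<lambda>_. 1)"
proof -
  obtain p where "(\<lambda>s. k s - poly p s) \<in> O[at 0](\<lambda>s. s ^ 0)" using assms unfolding texp_def by blast
  then have "(\<lambda>s. (k s - poly p s) + poly p s) \<in> O[at 0](\<lambda>_. 1)"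
    using sum_in_bigo(1)[OF _ poly_bigo_1, of "\<lambda>s. k s - poly p s" p] by simp
  then show ?thesis by simp
qed

lemma texp_add:
  assumes "texp k" "texp l" shows "texp (\<lambda>s. k s + l s)"
  unfolding texp_def
proof
  fix N
  obtain p q where "(\<lambda>s. k s - poly p s) \<in> O[at 0](\<lambda>s. s ^ N)" "(\<lambda>s. l s - poly q s) \<in> O[at 0](\<lambda>s. s ^ N)"
    using assms unfolding texp_def by blast
  from sum_in_bigo(1)[OF this] show "\<exists>p. (\<lambda>s. k s + l s - poly p s) \<in> O[at 0](\<lambda>s. s ^ N)"
    by (intro exI[of _ "p + q"]) (simp add: algebra_simps)
qed

lemma texp_mult:
  assumes "texp k" "texp l" shows "texp (\<lambda>s. k s * l s)"
  unfolding texp_def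
proof
  fix N
  obtain p q where *: "(\<lambda>s. k s - poly p s) \<in> O[at 0](\<lambda>s. s ^ N)" "(\<lambda>s. l s - poly q s) \<in> O[at 0](\<lambda>s. s ^ N)"
    using assms unfolding texp_def by blast
  have "(\<lambda>s. (k s - poly p s) * l s) \<in> O[at 0](\<lambda>s. s ^ N * 1)"
    by (intro landau_o.big.mult * texp_bigo_1 assms)
  moreover have "(\<lambda>s. (l s - poly q s) * poly p s) \<in> O[at 0](\<lambda>s. s ^ N * 1)"
    by (intro landau_o.big.mult * poly_bigo_1)
  ultimately have "(\<lambda>s. (k s - poly p s) * l s + (l s - poly q s) * poly p s) \<in> O[at 0](\<lambda>s. s ^ N)"
    using sum_in_bigo(1) by fastforce
  then show "\<exists>p. (\<lambda>s. k s * l s - poly p s) \<in> O[at 0](\<lambda>s. s ^ N)"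
    by (intro exI[of _ "p * q"]) (simp add: algebra_simps)
qed

lemma texp_const: "texp (\<lambda>s. c)"
proof -
  have "poly [:c:] = (\<lambda>s. c)" by auto
  then show ?thesis using texp_poly[of "[:c:]"] by simp
qed

lemma texp_uminus: "texp k \<Longrightarrow> texp (\<lambda>s. - k s)"
  using texp_mult[OF texp_const[of "-1"], of k] by simp

lemma texp_diff: "texp k \<Longrightarrow> texp l \<Longrightarrow> texp (\<lambda>s. k s - l s)"
  using texp_add[OF _ texp_uminus, of k l] by simp

lemma texp_bpoly:
  assumes "texp u" "texp v" shows "texp (\<lambda>s. bpoly P (u s) (v s))"
proof -
  have "texp (\<lambda>s. poly c (u s))" for c
    by (induction c) (auto intro!: texp_add texp_mult texp_const assms)
  then show ?thesis
    by (induction P) (auto intro!: texp_add texp_mult texp_const assms)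
qed

lemma filterlim_power_at_0:
  assumes "j > 0" shows "filterlim (\<lambda>s::real. s ^ j) (at 0) (at 0)"
  using assms by (intro filterlim_atI) (auto intro!: tendsto_eq_intros simp: eventually_at_filter power_0_left)

lemma texp_compose_power:
  assumes "texp k" "j > 0" shows "texp (\<lambda>s. k (s ^ j))"
  unfolding texp_def
proof
  fix N
  obtain p where "(\<lambda>s. k s - poly p s) \<in> O[at 0](\<lambda>s. s ^ N)" using assms unfolding texp_def by blast
  from landau_o.big.compose[OF this filterlim_power_at_0[OF assms(2)]]
  have "(\<lambda>s. k (s ^ j) - poly p (s ^ j)) \<in> O[at 0](\<lambda>s. (s ^ j) ^ N)" .
  also have "(\<lambda>s::real. (s ^ j) ^ N) \<in> O[at 0](\<lambda>s. s ^ N)"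
  proof -
    have "(\<lambda>s::real. s ^ N * s ^ (j * N - N)) \<in> O[at 0](\<lambda>s. s ^ N * 1)"
      using landau_o.big.mult[OF landau_o.big_refl poly_bigo_1[of "monom 1 (j * N - N)"]]
      by (simp add: poly_monom)
    moreover have "N + (j * N - N) = j * N" using assms(2) by (cases j) auto
    ultimately show ?thesis by (simp flip: power_mult power_add)
  qed
  finally show "\<exists>p. (\<lambda>s. k (s ^ j) - poly p s) \<in> O[at 0](\<lambda>s. s ^ N)"
    by (intro exI[of _ "pcompose p (monom 1 j)"]) (simp add: poly_pcompose poly_monom)
qed

text \<open>Dividing out the exact power of s leaves a factor with nonzero value at 0, which cannot
  tend to 0 along F. A general filter is allowed because the estimate is needed on one side of 0 and
  along the image of a function tending to 0.\<close>

lemma poly_bigo_power_dvd: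
  fixes p :: "real poly"
  assumes F: "F \<le> at 0" "F \<noteq> bot" and p: "poly p \<in> O[F](\<lambda>s. s ^ N)"
  shows "monom 1 N dvd p"
proof (cases "p = 0")
  case False
  then obtain q where q: "p = [:-0, 1:] ^ order 0 p * q" "\<not> [:-0, 1:] dvd q"
    using order_decomp by blast
  define n where "n = order 0 p"
  have pq: "p = monom 1 n * q" using q(1) by (simp add: n_def monom_altdef)
  have "n \<ge> N"
  proof (rule ccontr)
    assume "\<not> n \<ge> N"
    then have nN: "N = n + (N - n)" "N - n > 0" by auto
    have ev: "eventually (\<lambda>s. s ^ n \<noteq> 0) F"
      by (rule filter_leD[OF F(1)], rule eventually_mono[OF eventually_neq_at_within[of 0]]) simp
    have "poly p = (\<lambda>s. s ^ n * poly q s)" by (auto simp: pq poly_monom)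
    then have "(\<lambda>s. s ^ n * poly q s) \<in> O[F](\<lambda>s. s ^ n * s ^ (N - n))"
      using p nN(1) by (simp flip: power_add)
    then have "poly q \<in> O[F](\<lambda>s. s ^ (N - n))"
      using ev by (subst (asm) landau_o.big.mult_cancel_left) auto
    moreover have "((\<lambda>s::real. s ^ (N - n)) \<longlongrightarrow> 0) F"
      using F(1) nN(2) by (intro tendsto_mono[OF F(1)]) (auto intro!: tendsto_eq_intros)
    ultimately have "(poly q \<longlongrightarrow> 0) F"
      using landau_o.big_small_trans[OF _ smalloI_tendsto[of "\<lambda>s. s ^ (N - n)" "\<lambda>_. 1" F]]
        smalloD_tendsto[of "poly q" F "\<lambda>_. 1"] by simp
    moreover have "(poly q \<longlongrightarrow> poly q 0) F"
      by (intro tendsto_mono[OF F(1)]) (auto intro!: tendsto_eq_intros)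
    ultimately have "poly q 0 = 0" using F(2) tendsto_unique by blast
    then show False using q(2) poly_eq_0_iff_dvd[of q 0] by simp
  qed
  then show ?thesis unfolding pq
    by (metis dvd_triv_left dvd_mult2 le_iff_add mult_monom mult_1)
qed auto

lemma poly_not_flat:
  fixes p :: "real poly"
  assumes F: "F \<le> at 0" "F \<noteq> bot" and p: "\<And>N. poly p \<in> O[F](\<lambda>s. s ^ N)"
  shows "p = 0"
proof (rule ccontr)
  assume "p \<noteq> 0"
  have "monom 1 (Suc (degree p)) dvd p" by (rule poly_bigo_power_dvd[OF F p])
  then show False using \<open>p \<noteq> 0\<close> dvd_imp_degree_le[of "monom 1 (Suc (degree p))" p]
    by (simp add: degree_monom_eq)
qed

text \<open>This carries information across 0. Vanishing on one side makes the approximating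
  polynomial divisible by s^N, and such a polynomial is small on the other side as well.\<close>

lemma texp_flat:
  assumes k: "texp k" and F: "F \<le> at 0" "F \<noteq> bot" and zero: "eventually (\<lambda>s. k s = 0) F"
  shows "k \<in> O[at 0](\<lambda>s. s ^ N)"
proof -
  obtain p where p: "(\<lambda>s. k s - poly p s) \<in> O[at 0](\<lambda>s. s ^ N)" using k unfolding texp_def by blast
  then have "(\<lambda>s. k s - poly p s) \<in> O[F](\<lambda>s. s ^ N)" by (rule landau_o.big.filter_mono[OF F(1)])
  moreover have "eventually (\<lambda>s. - poly p s = k s - poly p s) F"
    using zero by eventually_elim simp
  ultimately have "(\<lambda>s. - poly p s) \<in> O[F](\<lambda>s. s ^ N)"
    using landau_o.big.in_cong[of "\<lambda>s. - poly p s" "\<lambda>s. k s - poly p s" F "\<lambda>s. s ^ N"] by simp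
  then have "monom 1 N dvd p" using F poly_bigo_power_dvd by simp
  then obtain q where q: "p = monom 1 N * q" by auto
  have "(\<lambda>s. s ^ N * poly q s) \<in> O[at 0](\<lambda>s. s ^ N * 1)"
    by (intro landau_o.big.mult poly_bigo_1) simp
  moreover have "poly p = (\<lambda>s. s ^ N * poly q s)" by (auto simp: q poly_monom)
  ultimately have "poly p \<in> O[at 0](\<lambda>s. s ^ N)" by simp
  from sum_in_bigo(1)[OF p this] show ?thesis by simp
qed

text \<open>The exponent is odd so that the expansion is two-sided and passes through branch points where the
  curve is smooth but has a radial tangent, as for a cube root.\<close>

definition pexp :: "(real \<Rightarrow> real) \<Rightarrow> real \<Rightarrow> bool" where
  "pexp h x \<longleftrightarrow> (\<exists>M. odd M \<and> texp (\<lambda>s. h (x + s ^ M)))"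

lemma filterlim_odd_power_at_right:
  assumes "odd M" shows "filterlim (\<lambda>s::real. x + s ^ M) (at_right x) (at_right 0)"
  unfolding filterlim_at
proof
  show "((\<lambda>s. x + s ^ M) \<longlongrightarrow> x) (at_right 0)"
    using odd_pos[OF assms] by (auto intro!: tendsto_eq_intros simp: power_0_left)
  show "eventually (\<lambda>s. x + s ^ M \<in> {x<..} \<and> x + s ^ M \<noteq> x) (at_right 0)"
    by (simp add: eventually_at_filter)
qed

lemma filterlim_odd_power_at_left:
  assumes "odd M" shows "filterlim (\<lambda>s::real. x + s ^ M) (at_left x) (at_left 0)"
  unfolding filterlim_at
proof
  show "((\<lambda>s. x + s ^ M) \<longlongrightarrow> x) (at_left 0)"
    using odd_pos[OF assms] by (auto intro!: tendsto_eq_intros simp: power_0_left)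
  show "eventually (\<lambda>s. x + s ^ M \<in> {..<x} \<and> x + s ^ M \<noteq> x) (at_left 0)"
    using assms by (simp add: eventually_at_filter power_less_zero_eq)
qed

text \<open>Forbids a change of branch at x. By \<open>texp_flat\<close>, S along the graph is flat
  also on the side where T vanishes; there r equals a S along the graph, so r is flat, which is
  impossible for a nonzero polynomial.\<close>

lemma bezout_flat_contradiction:
  assumes pexp: "pexp h x" and ab: "a * S + b * T = [:r:]" "r \<noteq> 0"
    and S: "eventually (\<lambda>y. bpoly S y (h y) = 0) F"
    and T: "eventually (\<lambda>y. bpoly T y (h y) = 0) G"
    and FG: "(F = at_left x \<and> G = at_right x) \<or> (F = at_right x \<and> G = at_left x)"
  shows False
proof -
  obtain M where M: "odd M" and h: "texp (\<lambda>s. h (x + s ^ M))" using pexp unfolding pexp_def by blast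
  have "at_left (0::real) \<le> at 0" "at_right (0::real) \<le> at 0" by (auto simp: at_le)
  with FG obtain F' G' where F': "F' \<le> at 0" "F' \<noteq> bot" and G': "G' \<le> at 0" "G' \<noteq> bot"
    and limF: "filterlim (\<lambda>s. x + s ^ M) F F'" and limG: "filterlim (\<lambda>s. x + s ^ M) G G'"
    using filterlim_odd_power_at_left[OF M, of x] filterlim_odd_power_at_right[OF M, of x]
      trivial_limit_at_left_real[of "0::real"] trivial_limit_at_right_real[of "0::real"]
    by metis
  have "poly [:x, 1:] \<circ> (\<lambda>s. s ^ M) = poly (pcompose [:x, 1:] (monom 1 M))"
    by (auto simp: poly_pcompose poly_monom)
  then have x: "texp (\<lambda>s. x + s ^ M)"
    using texp_poly[of "pcompose [:x, 1:] (monom 1 M)"] by (simp add: o_def)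
  define kS where "kS = (\<lambda>s. bpoly S (x + s ^ M) (h (x + s ^ M)))"
  have tS: "texp kS" unfolding kS_def by (intro texp_bpoly x h)
  have tb: "texp (\<lambda>s. bpoly a (x + s ^ M) (h (x + s ^ M)))" by (intro texp_bpoly x h)
  have flat: "kS \<in> O[at 0](\<lambda>s. s ^ N)" for N
    by (rule texp_flat[OF tS F']) (use eventually_compose_filterlim[OF S limF] in \<open>simp add: kS_def\<close>)
  define r' where "r' = pcompose r (pcompose [:x, 1:] (monom 1 M))"
  have r': "poly r' s = poly r (x + s ^ M)" for s by (simp add: r'_def poly_pcompose poly_monom)
  have "poly r' \<in> O[G'](\<lambda>s. s ^ N)" for N
  proof -
    have "(\<lambda>s. bpoly a (x + s ^ M) (h (x + s ^ M)) * kS s) \<in> O[at 0](\<lambda>s. 1 * s ^ N)"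
      by (intro landau_o.big.mult flat texp_bigo_1 tb)
    then have "(\<lambda>s. bpoly a (x + s ^ M) (h (x + s ^ M)) * kS s) \<in> O[G'](\<lambda>s. s ^ N)"
      using landau_o.big.filter_mono[OF G'(1)] by simp
    moreover have "eventually (\<lambda>s. poly r' s = bpoly a (x + s ^ M) (h (x + s ^ M)) * kS s) G'"
      using eventually_compose_filterlim[OF T limG]
    proof eventually_elim
      case (elim s)
      have "bpoly (a * S + b * T) (x + s ^ M) (h (x + s ^ M)) = poly r (x + s ^ M)" by (simp only: ab) simp
      then show ?case using elim by (simp add: kS_def r')
    qed
    ultimately show ?thesis
      using landau_o.big.in_cong[of "poly r'" "\<lambda>s. bpoly a (x + s ^ M) (h (x + s ^ M)) * kS s" G' "\<lambda>s. s ^ N"]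
      by simp
  qed
  then have "r' = 0" by (rule poly_not_flat[OF G'])
  \<comment> \<open>As M is odd, x + s^M runs through all reals, so \<open>r' = 0\<close> gives r =
    0.\<close>
  then have "poly r y = 0" for y
    using r'[of "root M (y - x)"] M by (simp add: odd_real_root_pow)
  then show False using ab(2) by (metis poly_all_0_iff_0)
qed

text \<open>A punctured neighbourhood of x that witnesses Q also serves a nearby y once x is removed
  from it; this needs points to be closed.\<close>

lemma open_eventually_at:
  fixes Q :: "'a::t1_space \<Rightarrow> bool"
  shows "open {x. eventually Q (at x)}"
proof (subst open_subopen, safe)
  fix x :: 'a assume "eventually Q (at x)"
  then obtain S where S: "open S" "x \<in> S" "\<And>y. y \<in> S \<Longrightarrow> y \<noteq> x \<Longrightarrow> Q y"
    unfolding eventually_at_topological by blast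
  have "eventually Q (at y)" if "y \<in> S" for y
  proof (cases "y = x")
    case False
    then show ?thesis unfolding eventually_at_topological
      using S that by (intro exI[of _ "S - {x}"]) (auto intro: open_Diff)
  qed (use \<open>eventually Q (at x)\<close> in simp)
  then show "\<exists>T. open T \<and> x \<in> T \<and> T \<subseteq> {x. eventually Q (at x)}" using S by blast
qed

text \<open>Along the graph, S and T vanish together only over roots of r. Between the roots
  connectedness picks one of the two; at a root the choice cannot change. So the points near which S
  vanishes and those near which T vanishes form an open partition of the interval.\<close>

lemma killing_dichotomy:
  fixes h :: "real \<Rightarrow> real"
  assumes cont: "continuous_on {c<..<d} h" and cd: "c < d"
    and pexp: "\<And>x. x \<in> {c<..<d} \<Longrightarrow> pexp h x"
    and ab: "a * S + b * T = [:r:]" "r \<noteq> 0"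
    and kill: "\<And>x. x \<in> {c<..<d} \<Longrightarrow> bpoly S x (h x) = 0 \<or> bpoly T x (h x) = 0"
  shows "(\<forall>x\<in>{c<..<d}. bpoly S x (h x) = 0) \<or> (\<forall>x\<in>{c<..<d}. bpoly T x (h x) = 0)"
proof -
  let ?J = "{c<..<d}"
  let ?S = "\<lambda>x. bpoly S x (h x)" and ?T = "\<lambda>x. bpoly T x (h x)"
  have contS: "continuous_on ?J ?S" and contT: "continuous_on ?J ?T"
    by (intro continuous_intros cont)+
  have fin: "finite {x. poly r x = 0}" using ab(2) by (rule poly_roots_finite)
  have rel: "bpoly a x (h x) * ?S x + bpoly b x (h x) * ?T x = poly r x" for x
  proof -
    have "bpoly (a * S + b * T) x (h x) = poly r x" by (simp only: ab) simp
    then show ?thesis by simp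
  qed
  have side: "(\<forall>x\<in>{u<..<v}. ?S x = 0) \<or> (\<forall>x\<in>{u<..<v}. ?T x = 0)"
    if uv: "{u<..<v} \<subseteq> ?J" "\<And>x. x \<in> {u<..<v} \<Longrightarrow> poly r x \<noteq> 0" for u v
  proof -
    have "connected {u<..<v}" by simp
    moreover have "closedin (top_of_set {u<..<v}) {x\<in>{u<..<v}. ?S x = 0}"
      "closedin (top_of_set {u<..<v}) {x\<in>{u<..<v}. ?T x = 0}"
      by (intro continuous_closedin_preimage_constant continuous_on_subset[OF contS uv(1)]
          continuous_on_subset[OF contT uv(1)])+
    moreover have "{u<..<v} \<subseteq> {x\<in>{u<..<v}. ?S x = 0} \<union> {x\<in>{u<..<v}. ?T x = 0}"
      using kill uv(1) by blast
    moreover have "{x\<in>{u<..<v}. ?S x = 0} \<inter> {x\<in>{u<..<v}. ?T x = 0} = {}"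
    proof -
      have False if "x \<in> {u<..<v}" "?S x = 0" "?T x = 0" for x
        using rel[of x] uv(2)[OF that(1)] that by simp
      then show ?thesis by blast
    qed
    ultimately have "{x\<in>{u<..<v}. ?S x = 0} = {} \<or> {x\<in>{u<..<v}. ?T x = 0} = {}"
      unfolding connected_closedin by blast
    then show ?thesis using kill uv(1) by blast
  qed
  define US where "US = {x\<in>?J. eventually (\<lambda>y. ?S y = 0) (at x)}"
  define UT where "UT = {x\<in>?J. eventually (\<lambda>y. ?T y = 0) (at x)}"
  have cover: "x \<in> US \<union> UT" if x: "x \<in> ?J" for x
  proof -
    have "open ?J" by simp
    then obtain e1 where e1: "e1 > 0" "ball x e1 \<subseteq> ?J" using x open_contains_ball by blast
    obtain e2 where e2: "e2 > 0" "\<forall>y\<in>{x. poly r x = 0}. y \<noteq> x \<longrightarrow> e2 \<le> dist x y"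
      using finite_set_avoid[OF fin, of x] by blast
    define e where "e = min e1 e2"
    have e: "e > 0" and eJ: "{x-e<..<x+e} \<subseteq> ?J" and er: "\<And>y. y \<in> {x-e<..<x+e} \<Longrightarrow> y \<noteq> x \<Longrightarrow> poly r y \<noteq> 0"
    proof -
      show "e > 0" using e1 e2 by (simp add: e_def)
      show "{x-e<..<x+e} \<subseteq> ?J" using e1(2) by (rule subset_trans[rotated]) (auto simp: e_def dist_real_def)
      show "poly r y \<noteq> 0" if "y \<in> {x-e<..<x+e}" "y \<noteq> x" for y
        using e2(2) that by (force simp: e_def dist_real_def)
    qed
    have R: "(\<forall>x\<in>{x<..<x+e}. ?S x = 0) \<or> (\<forall>x\<in>{x<..<x+e}. ?T x = 0)"
      by (rule side) (use e eJ er in auto)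
    have L: "(\<forall>x\<in>{x-e<..<x}. ?S x = 0) \<or> (\<forall>x\<in>{x-e<..<x}. ?T x = 0)"
      by (rule side) (use e eJ er in auto)
    have evR: "eventually (\<lambda>y. y \<in> {x<..<x+e}) (at_right x)"
      using e by (intro eventually_at_right_real) simp
    have evL: "eventually (\<lambda>y. y \<in> {x-e<..<x}) (at_left x)"
      using e by (intro eventually_at_left_real) simp
    have R': "eventually (\<lambda>y. ?S y = 0) (at_right x) \<or> eventually (\<lambda>y. ?T y = 0) (at_right x)"
      using R evR eventually_mono by (smt (verit, best))
    have L': "eventually (\<lambda>y. ?S y = 0) (at_left x) \<or> eventually (\<lambda>y. ?T y = 0) (at_left x)"
      using L evL eventually_mono by (smt (verit, best))
    have "\<not> (eventually (\<lambda>y. ?S y = 0) (at_left x) \<and> eventually (\<lambda>y. ?T y = 0) (at_right x))"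
      "\<not> (eventually (\<lambda>y. ?S y = 0) (at_right x) \<and> eventually (\<lambda>y. ?T y = 0) (at_left x))"
      using bezout_flat_contradiction[OF pexp[OF x] ab] by blast+
    then show ?thesis using R' L' x unfolding US_def UT_def eventually_at_split by blast
  qed
  have openU: "open US" "open UT"
    unfolding US_def UT_def Collect_conj_eq Collect_mem_eq
    by (intro open_Int open_eventually_at open_greaterThanLessThan)+
  \<comment> \<open>If both vanished near x, so would r, which has finitely many roots.\<close>
  have disj: "US \<inter> UT = {}"
  proof -
    have False if "eventually (\<lambda>y. ?S y = 0) (at x)" "eventually (\<lambda>y. ?T y = 0) (at x)" for x
    proof -
      have "eventually (\<lambda>y. poly r y = 0) (at x)" using that
        by eventually_elim (simp flip: rel)
      moreover have "eventually (\<lambda>y. y \<notin> {x. poly r x = 0}) (at x)"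
        using fin islimpt_finite islimpt_iff_eventually by blast
      ultimately have "eventually (\<lambda>y. False) (at x)" by eventually_elim simp
      then show False by simp
    qed
    then show ?thesis unfolding US_def UT_def by blast
  qed
  have "US \<inter> ?J = {} \<or> UT \<inter> ?J = {}"
    using connected_Ioo[of c d] openU disj cover unfolding connected_def by blast
  then have all: "?J \<subseteq> UT \<or> ?J \<subseteq> US" using cover by blast
  \<comment> \<open>A punctured neighbourhood says nothing about x itself; continuity supplies that
    point.\<close>
  have lim: "q x = 0" if "continuous_on ?J q" "eventually (\<lambda>y. q y = 0) (at x)" "x \<in> ?J"
    for q :: "real \<Rightarrow> real" and x
  proof -
    have "(q \<longlongrightarrow> q x) (at x)"
      using that(1,3) by (simp add: continuous_on_eq_continuous_at isCont_def)
    moreover have "(q \<longlongrightarrow> 0) (at x)" using that(2) by (simp add: tendsto_eventually)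
    ultimately show ?thesis by (rule tendsto_unique[OF at_neq_bot])
  qed
  show ?thesis
    using all lim[OF contS] lim[OF contT] unfolding US_def UT_def by blast
qed

lemma killing_prime:
  fixes h :: "real \<Rightarrow> real"
  assumes cont: "continuous_on {c<..<d} h" and cd: "c < d"
    and pexp: "\<And>x. x \<in> {c<..<d} \<Longrightarrow> pexp h x"
    and P: "P \<noteq> 0" "\<And>x. x \<in> {c<..<d} \<Longrightarrow> bpoly P x (h x) = 0"
  obtains S where "prime_elem S" "\<And>x. x \<in> {c<..<d} \<Longrightarrow> bpoly S x (h x) = 0"
proof -
  let ?J = "{c<..<d}"
  have "\<exists>S. prime_elem S \<and> (\<forall>x\<in>?J. bpoly S x (h x) = 0)"
    using P
  proof (induction P rule: prime_divisors_induct)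
    case zero
    then show ?case by simp
  next
    case (unit P)
    then obtain Q where "P * Q = 1" by (metis dvd_def)
    then have "bpoly P x y * bpoly Q x y = 1" for x y by (metis bpoly_simps(2,5))
    moreover have "(c + d) / 2 \<in> ?J" using cd by simp
    ultimately show ?case using unit by (metis mult_zero_left zero_neq_one)
  next
    case (factor p T)
    have T0: "T \<noteq> 0" using factor.prems by auto
    have p: "prime_elem p" using factor.hyps by auto
    have either: "bpoly p x (h x) = 0 \<or> bpoly T x (h x) = 0" if "x \<in> ?J" for x
      using factor.prems(2)[OF that] by simp
    consider "degree p = 0" | "degree p > 0" "p dvd T" | "degree p > 0" "\<not> p dvd T" by blast
    then show ?case
    proof cases
      \<comment> \<open>A factor in x alone vanishes over finitely many x only, and continuity fills
        these gaps in the vanishing of T.\<close>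
      case 1
      then obtain k where k: "p = [:k:]" using degree_eq_zeroE by blast
      then have "k \<noteq> 0" using p by auto
      then have fin: "finite {x. poly k x = 0}" by (rule poly_roots_finite)
      have "bpoly T x (h x) = 0" if x: "x \<in> ?J" for x
      proof -
        have "eventually (\<lambda>y. y \<notin> {x. poly k x = 0}) (at x)"
          using fin islimpt_finite islimpt_iff_eventually by blast
        moreover have "eventually (\<lambda>y. y \<in> ?J) (at x)"
          using x by (intro eventually_at_in_open') auto
        ultimately have "eventually (\<lambda>y. bpoly T y (h y) = 0) (at x)"
          by eventually_elim (use either in \<open>auto simp: k\<close>)
        then have "((\<lambda>y. bpoly T y (h y)) \<longlongrightarrow> 0) (at x)" by (simp add: tendsto_eventually)
        moreover have "continuous_on ?J (\<lambda>y. bpoly T y (h y))" by (intro continuous_intros cont)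
        then have "((\<lambda>y. bpoly T y (h y)) \<longlongrightarrow> bpoly T x (h x)) (at x)"
          using x by (simp add: continuous_on_eq_continuous_at isCont_def)
        ultimately show ?thesis by (metis tendsto_unique at_neq_bot)
      qed
      then show ?thesis by (rule factor.IH[OF T0])
    next
      \<comment> \<open>Where p vanishes, its multiple T vanishes too, so T alone suffices.\<close>
      case 2
      then obtain U where "T = p * U" by auto
      then have "bpoly T x (h x) = 0" if "x \<in> ?J" for x using either[OF that] by auto
      then show ?thesis by (rule factor.IH[OF T0])
    next
      case 3
      obtain a b r where "r \<noteq> 0" "a * p + b * T = [:r:]" by (rule prime_bezout[OF p 3])
      from killing_dichotomy[OF cont cd pexp this(2,1) either]
      consider "\<forall>x\<in>?J. bpoly p x (h x) = 0" | "\<And>x. x \<in> ?J \<Longrightarrow> bpoly T x (h x) = 0" by blast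
      then show ?thesis
      proof cases
        case 1
        then show ?thesis using p by blast
      next
        case 2
        then show ?thesis by (rule factor.IH[OF T0])
      qed
    qed
  qed
  then show ?thesis using that by blast
qed

text \<open>A prime polynomial that kills both h and its translate must be invariant under the translation,
  hence vanishes on the whole line through (x, h x) with slope m / c.\<close>

lemma algebraic_quasiperiodic_linear:
  fixes h :: "real \<Rightarrow> real"
  assumes cont: "continuous_on {0<..<2 * c} h" and c: "c > 0"
    and pexp: "\<And>x. x \<in> {0<..<2 * c} \<Longrightarrow> pexp h x"
    and P: "P \<noteq> 0" "\<And>x. x \<in> {0<..<2 * c} \<Longrightarrow> bpoly P x (h x) = 0"
    and period: "\<And>x. x \<in> {0<..<c} \<Longrightarrow> h (x + c) = h x + m"
  obtains e where "\<And>x. x \<in> {0<..<c} \<Longrightarrow> h x = m * x / c + e"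
proof -
  obtain S where S: "prime_elem S" and kill: "\<And>x. x \<in> {0<..<2 * c} \<Longrightarrow> bpoly S x (h x) = 0"
    using killing_prime[OF cont _ pexp P] c by auto
  have S0: "S \<noteq> 0" using S by auto
  have inf: "infinite {0<..<c}" using c by (simp add: infinite_Ioo)
  define S' where "S' = bshift c m S"
  have kill': "bpoly S' x (h x) = 0" if "x \<in> {0<..<c}" for x
    using kill[of "x + c"] period[OF that] that c by (simp add: S'_def)
  have degS: "degree S > 0"
  proof (rule ccontr)
    assume "\<not> degree S > 0"
    then obtain k where k: "S = [:k:]" using degree_eq_zeroE by blast
    have "poly k x = 0" if "x \<in> {0<..<c}" for x using kill[of x] that c by (simp add: k)
    then show False using poly_eq_zero_of_infinite[OF inf] k S0 by auto
  qed
  \<comment> \<open>Otherwise a nonzero polynomial in x alone would be a combination of S and S',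
    both of which vanish on the graph over (0, c).\<close>
  have "S dvd S'"
  proof (rule ccontr)
    assume "\<not> S dvd S'"
    then obtain a b r where r: "r \<noteq> 0" "a * S + b * S' = [:r:]" by (rule prime_bezout[OF S degS])
    have "poly r x = 0" if "x \<in> {0<..<c}" for x
    proof -
      have "bpoly (a * S + b * S') x (h x) = poly r x" by (simp only: r) simp
      then show ?thesis using kill[of x] kill'[of x] that c by simp
    qed
    then show False using poly_eq_zero_of_infinite[OF inf] r(1) by blast
  qed
  then obtain A where A: "S' = S * A" by auto
  \<comment> \<open>A zero of S is a zero of its multiple S', which means that its translate by (c,
    m) is again a zero of S.\<close>
  have step: "bpoly S (x + c) (y + m) = 0" if "bpoly S x y = 0" for x y
  proof -
    have "bpoly S' x y = 0" using that by (simp add: A)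
    then show ?thesis by (simp add: S'_def)
  qed
  have line: "bpoly S (x + c * t) (h x + m * t) = 0" if x: "x \<in> {0<..<c}" for x t
  proof -
    define L where "L = poly (map_poly (\<lambda>p. pcompose p [:x, c:]) S) [:h x, m:]"
    have "bpoly P (x + c * t) (h x + m * t) = poly (poly (map_poly (\<lambda>p. pcompose p [:x, c:]) P) [:h x, m:]) t"
      for P t by (induction P) (auto simp: map_poly_pCons poly_pcompose algebra_simps)
    then have L: "poly L t = bpoly S (x + c * t) (h x + m * t)" for t by (simp add: L_def)
    \<comment> \<open>The restriction of S to the line is a polynomial in t, and repeated
      translation makes every natural number a root of it.\<close>
    have "poly L (real k) = 0" for k
    proof (induction k)
      case 0
      then show ?case using kill[of x] x c by (simp add: L)
    next
      case (Suc k)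
      then have "bpoly S (x + c * real k + c) (h x + m * real k + m) = 0" by (intro step) (simp add: L)
      then show ?case by (simp add: L algebra_simps)
    qed
    then have "L = 0"
      by (intro poly_eq_zero_of_infinite[of "range real"]) (auto simp: range_inj_infinite inj_of_nat)
    then show ?thesis using L[of t] by simp
  qed
  \<comment> \<open>Over an abscissa where the leading coefficient in y survives, S has finitely
    many roots, and each of the lines passes through one of them. So only finitely many intercepts e
    occur, and a continuous function with finite range on an interval is constant.\<close>
  obtain \<psi> where \<psi>: "poly (lead_coeff S) \<psi> \<noteq> 0"
    using S0 ex_new_if_finite[OF infinite_UNIV_char_0 poly_roots_finite[of "lead_coeff S"]] by auto
  define e where "e x = h x - m * x / c" for x
  have "e ` {0<..<c} \<subseteq> (\<lambda>y. y - m * \<psi> / c) ` {y. bpoly S \<psi> y = 0}"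
  proof
    fix z assume "z \<in> e ` {0<..<c}"
    then obtain x where x: "x \<in> {0<..<c}" "z = e x" by blast
    have "bpoly S \<psi> (h x + m * ((\<psi> - x) / c)) = 0"
      using line[OF x(1), of "(\<psi> - x) / c"] c by simp
    moreover have "z = (h x + m * ((\<psi> - x) / c)) - m * \<psi> / c"
      using c by (simp add: x(2) e_def field_simps)
    ultimately show "z \<in> (\<lambda>y. y - m * \<psi> / c) ` {y. bpoly S \<psi> y = 0}" by blast
  qed
  then have "finite (e ` {0<..<c})" using finite_bpoly_roots[OF \<psi>] finite_surj by blast
  moreover have "continuous_on {0<..<c} e"
    unfolding e_def using c by (intro continuous_intros continuous_on_subset[OF cont]) auto
  ultimately have "e constant_on {0<..<c}"
    using continuous_finite_range_constant[of "{0<..<c}" e] by (simp add: constant_on_def)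
  then obtain k where "\<And>x. x \<in> {0<..<c} \<Longrightarrow> e x = k" unfolding constant_on_def by blast
  then show ?thesis using that[of k] by (simp add: e_def algebra_simps)
qed

section \<open>Series, roots and inverse functions for expansions\<close>

lemma texp_approx:
  assumes "\<And>N. \<exists>k'. texp k' \<and> (\<lambda>s. k s - k' s) \<in> O[at 0](\<lambda>s. s ^ N)"
  shows "texp k"
  unfolding texp_def
proof
  fix N
  obtain k' where k': "texp k'" "(\<lambda>s. k s - k' s) \<in> O[at 0](\<lambda>s. s ^ N)" using assms by blast
  obtain p where p: "(\<lambda>s. k' s - poly p s) \<in> O[at 0](\<lambda>s. s ^ N)" using k' unfolding texp_def by blast
  from sum_in_bigo(1)[OF k'(2) p] show "\<exists>p. (\<lambda>s. k s - poly p s) \<in> O[at 0](\<lambda>s. s ^ N)"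
    by (intro exI[of _ p]) simp
qed

lemma texp_cong:
  assumes "texp k" "eventually (\<lambda>s. k s = l s) (at 0)" shows "texp l"
proof (rule texp_approx)
  fix N
  have "eventually (\<lambda>s. l s - k s = 0) (at 0)" using assms(2) by eventually_elim simp
  then have "(\<lambda>s. l s - k s) \<in> O[at 0](\<lambda>s. s ^ N)"
    using landau_o.big.in_cong[of "\<lambda>s. l s - k s" "\<lambda>s. 0" "at 0" "\<lambda>s. s ^ N"] by simp
  then show "\<exists>k'. texp k' \<and> (\<lambda>s. l s - k' s) \<in> O[at 0](\<lambda>s. s ^ N)" using assms(1) by blast
qed

lemma texp_id: "texp (\<lambda>s. s)"
proof -
  have "poly [:0, 1:] = (\<lambda>s::real. s)" by auto
  then show ?thesis using texp_poly[of "[:0, 1:]"] by simp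
qed

lemma texp_sum: "finite A \<Longrightarrow> (\<And>i. i \<in> A \<Longrightarrow> texp (k i)) \<Longrightarrow> texp (\<lambda>s. \<Sum>i\<in>A. k i s)"
  by (induction A rule: finite_induct) (auto intro!: texp_add texp_const)

lemma texp_power: "texp k \<Longrightarrow> texp (\<lambda>s. k s ^ n)"
  by (induction n) (auto intro!: texp_mult texp_const)

lemma texp_poly_compose: "texp k \<Longrightarrow> texp (\<lambda>s. poly p (k s))"
  by (induction p) (auto intro!: texp_add texp_mult texp_const)

lemma monom_dvd_imp_bigo:
  assumes "monom 1 N dvd (p :: real poly)" shows "poly p \<in> O[at 0](\<lambda>s. s ^ N)"
proof -
  obtain q where q: "p = monom 1 N * q" using assms by auto
  have "(\<lambda>s. s ^ N * poly q s) \<in> O[at 0](\<lambda>s. s ^ N * 1)"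
    by (intro landau_o.big.mult poly_bigo_1) simp
  moreover have "poly p = (\<lambda>s. s ^ N * poly q s)" by (auto simp: q poly_monom)
  ultimately show ?thesis by simp
qed

lemma power_bigo_mono:
  assumes "m \<le> n" shows "(\<lambda>s::real. s ^ n) \<in> O[at 0](\<lambda>s. s ^ m)"
proof -
  have "monom 1 n = monom 1 m * (monom 1 (n - m) :: real poly)" using assms by (simp add: mult_monom)
  then have "poly (monom 1 n) \<in> O[at 0](\<lambda>s::real. s ^ m)" by (intro monom_dvd_imp_bigo) simp
  moreover have "poly (monom 1 n) = (\<lambda>s::real. s ^ n)" by (auto simp: poly_monom)
  ultimately show ?thesis by simp
qed

lemma texp_bigo_id:
  assumes "texp k" "(k \<longlongrightarrow> 0) (at 0)" shows "k \<in> O[at 0](\<lambda>s. s)"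
proof -
  obtain p where p: "(\<lambda>s. k s - poly p s) \<in> O[at 0](\<lambda>s. s ^ 1)" using assms unfolding texp_def by blast
  have "((\<lambda>s. k s - poly p s) \<longlongrightarrow> 0) (at 0)"
    using landau_o.big_small_trans[OF p smalloI_tendsto[of "\<lambda>s. s ^ 1" "\<lambda>_. 1" "at 0"]]
      smalloD_tendsto[of "\<lambda>s. k s - poly p s" "at 0" "\<lambda>_. 1"] by simp
  then have "((\<lambda>s. k s - (k s - poly p s)) \<longlongrightarrow> 0 - 0) (at 0)" by (intro tendsto_diff assms)
  then have "(poly p \<longlongrightarrow> 0) (at 0)" by simp
  moreover have "(poly p \<longlongrightarrow> poly p 0) (at 0)" by (auto intro!: tendsto_eq_intros)
  ultimately have "poly p 0 = 0" using tendsto_unique[OF at_neq_bot] by blast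
  then have "monom 1 1 dvd p" using poly_eq_0_iff_dvd[of p 0] by (simp add: monom_altdef)
  then have "poly p \<in> O[at 0](\<lambda>s. s ^ 1)" by (rule monom_dvd_imp_bigo)
  from sum_in_bigo(1)[OF p this] show ?thesis by simp
qed

text \<open>The tail of the series from N on is at most C |w|^N for |w| <= \<rho> / 2, and k = O(s),
  so F (k s) is a polynomial in k s up to O(s^N). The bound includes w = 0, so k may vanish
  anywhere.\<close>

lemma texp_powser:
  fixes c :: "nat \<Rightarrow> real"
  assumes F: "\<And>w. \<bar>w\<bar> < \<rho> \<Longrightarrow> (\<lambda>n. c n * w ^ n) sums F w" and \<rho>: "\<rho> > 0"
    and k: "texp k" "(k \<longlongrightarrow> 0) (at 0)"
  shows "texp (\<lambda>s. F (k s))"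
proof (rule texp_approx)
  fix N
  define C where "C = (\<Sum>n. \<bar>c (n + N)\<bar> * (\<rho> / 2) ^ n)"
  have sm: "summable (\<lambda>n. \<bar>c (n + N)\<bar> * (\<rho> / 2) ^ n)"
  proof -
    \<comment> \<open>Convergence at 3 \<rho> / 4 makes the series absolutely convergent at the
      smaller radius \<rho> / 2.\<close>
    have "summable (\<lambda>n. c n * (3 * \<rho> / 4) ^ n)" using F[of "3 * \<rho> / 4"] \<rho> by (auto simp: sums_iff)
    then have "summable (\<lambda>n. norm (c n * (\<rho> / 2) ^ n))" by (rule powser_insidea) (use \<rho> in auto)
    then have "summable (\<lambda>n. norm (c (n + N) * (\<rho> / 2) ^ (n + N)))" by (subst summable_iff_shift)
    then have "summable (\<lambda>n. (\<bar>c (n + N)\<bar> * (\<rho> / 2) ^ n) * (\<rho> / 2) ^ N)"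
      using \<rho> by (simp add: abs_mult power_add mult_ac)
    from summable_mult2[OF this, of "inverse ((\<rho> / 2) ^ N)"] show ?thesis using \<rho> by (simp add: mult.assoc)
  qed
  have bound: "\<bar>F w - (\<Sum>n<N. c n * w ^ n)\<bar> \<le> C * \<bar>w\<bar> ^ N" if w: "\<bar>w\<bar> \<le> \<rho> / 2" for w
  proof -
    have s: "(\<lambda>n. c n * w ^ n) sums F w" using F w \<rho> by simp
    have "(\<lambda>n. c (n + N) * w ^ (n + N)) sums (F w - (\<Sum>n<N. c n * w ^ n))"
      using s by (subst sums_iff_shift) simp
    then have eq: "F w - (\<Sum>n<N. c n * w ^ n) = (\<Sum>n. c (n + N) * w ^ (n + N))"
      and sm2: "summable (\<lambda>n. c (n + N) * w ^ (n + N))" by (auto simp: sums_iff)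
    have le: "norm (c (n + N) * w ^ (n + N)) \<le> (\<bar>c (n + N)\<bar> * (\<rho> / 2) ^ n) * \<bar>w\<bar> ^ N" for n
      using power_mono[OF w, of n] by (simp add: abs_mult power_add power_abs mult_left_mono mult_right_mono mult.assoc)
    have "norm (\<Sum>n. c (n + N) * w ^ (n + N)) \<le> (\<Sum>n. (\<bar>c (n + N)\<bar> * (\<rho> / 2) ^ n) * \<bar>w\<bar> ^ N)"
      by (rule norm_suminf_le) (use le summable_mult2[OF sm] in auto)
    then show ?thesis unfolding eq C_def using suminf_mult2[OF sm, of "\<bar>w\<bar> ^ N"] by simp
  qed
  have ev: "eventually (\<lambda>s. \<bar>k s\<bar> \<le> \<rho> / 2) (at 0)"
    using order_tendstoD[OF tendsto_rabs_zero[OF k(2)], of "\<rho> / 2"] \<rho>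
    by (auto elim: eventually_mono)
  have "(\<lambda>s. F (k s) - (\<Sum>n<N. c n * k s ^ n)) \<in> O[at 0](\<lambda>s. k s ^ N)"
    by (rule bigoI[of _ C], use ev in eventually_elim) (use bound in \<open>auto simp: power_abs\<close>)
  also have "(\<lambda>s. k s ^ N) \<in> O[at 0](\<lambda>s. s ^ N)"
    by (intro landau_o.big_power texp_bigo_id k)
  finally show "\<exists>k'. texp k' \<and> (\<lambda>s. F (k s) - k' s) \<in> O[at 0](\<lambda>s. s ^ N)"
    by (intro exI[of _ "\<lambda>s. \<Sum>n<N. c n * k s ^ n"] conjI texp_sum texp_mult texp_const texp_power k) auto
qed

text \<open>Geometric series in 1 - k / b, which tends to 0.\<close>

lemma texp_inverse:
  assumes k: "texp k" "(k \<longlongrightarrow> b) (at 0)" and b: "b \<noteq> 0"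
  shows "texp (\<lambda>s. inverse (k s))"
proof -
  have "texp (\<lambda>s. 1 - k s / b)" using k by (auto intro!: texp_diff texp_mult texp_const simp: divide_inverse)
  moreover have "((\<lambda>s. 1 - k s / b) \<longlongrightarrow> 0) (at 0)" using k b by (auto intro!: tendsto_eq_intros)
  moreover have "(\<lambda>n. 1 * w ^ n) sums (1 / (1 - w))" if "\<bar>w\<bar> < 1" for w :: real
    using geometric_sums[of w] that by simp
  ultimately have "texp (\<lambda>s. 1 / (1 - (1 - k s / b)))"
    by (intro texp_powser[where F = "\<lambda>w. 1 / (1 - w)" and \<rho> = 1 and c = "\<lambda>_. 1"]) auto
  then have "texp (\<lambda>s. inverse b * (1 / (1 - (1 - k s / b))))" by (intro texp_mult texp_const)
  then show ?thesis using b by (simp add: field_simps)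
qed

text \<open>Binomial series for the root of k / b, which tends to 1. The root of b is split off, and
  an odd m allows b to be negative.\<close>

lemma texp_root:
  assumes k: "texp k" "(k \<longlongrightarrow> b) (at 0)" and b: "b \<noteq> 0" and m: "odd m"
  shows "texp (\<lambda>s. root m (k s))"
proof -
  have m0: "m > 0" using m by (rule odd_pos)
  have t: "texp (\<lambda>s. k s / b - 1)" using k by (auto intro!: texp_diff texp_mult texp_const simp: divide_inverse)
  have lim: "((\<lambda>s. k s / b - 1) \<longlongrightarrow> 0) (at 0)" using k b by (auto intro!: tendsto_eq_intros)
  have "(\<lambda>n. ((1 / real m) gchoose n) * w ^ n) sums ((1 + w) powr (1 / real m))" if "\<bar>w\<bar> < 1" for w :: real
    using gen_binomial_real[OF that] .
  then have "texp (\<lambda>s. (1 + (k s / b - 1)) powr (1 / real m))"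
    by (rule texp_powser[where F = "\<lambda>w. (1 + w) powr (1 / real m)" and \<rho> = 1]) (use t lim in auto)
  then have "texp (\<lambda>s. root m b * (1 + (k s / b - 1)) powr (1 / real m))" by (intro texp_mult texp_const)
  moreover have "eventually (\<lambda>s. root m b * (1 + (k s / b - 1)) powr (1 / real m) = root m (k s)) (at 0)"
    using order_tendstoD(1)[OF lim, of "-1", simplified]
  proof eventually_elim
    case (elim s)
    then have pos: "k s / b > 0" by simp
    have "root m b * (1 + (k s / b - 1)) powr (1 / real m) = root m b * root m (k s / b)"
      using pos m0 by (simp add: root_powr_inverse)
    also have "\<dots> = root m (k s)" using b by (simp flip: real_root_mult)
    finally show ?case .
  qed
  ultimately show ?thesis by (rule texp_cong)
qed

lemma texp_divide_power:
  assumes k: "texp k" "k \<in> O[at 0](\<lambda>s. s ^ m)"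
  shows "texp (\<lambda>s. k s / s ^ m)"
  unfolding texp_def
proof
  fix N
  obtain p where p: "(\<lambda>s. k s - poly p s) \<in> O[at 0](\<lambda>s. s ^ (m + N))" using k unfolding texp_def by blast
  have le: "(\<lambda>s::real. s ^ (m + N)) \<in> O[at 0](\<lambda>s. s ^ m)"
    by (rule power_bigo_mono) simp
  have "(\<lambda>s. k s - (k s - poly p s)) \<in> O[at 0](\<lambda>s. s ^ m)"
    by (rule sum_in_bigo(2)[OF k(2) landau_o.big_trans[OF p le]])
  then have "poly p \<in> O[at 0](\<lambda>s. s ^ m)" by simp
  then have "monom 1 m dvd p" by (intro poly_bigo_power_dvd[of "at 0"]) auto
  then obtain q where q: "p = monom 1 m * q" by auto
  have "(\<lambda>s. (k s - poly p s) / s ^ m) \<in> O[at 0](\<lambda>s. s ^ (m + N) / s ^ m)"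
    using p by (rule landau_o.big.divide_right[rotated], intro eventually_mono[OF eventually_neq_at_within[of 0]]) simp
  moreover have e1: "eventually (\<lambda>s::real. (k s - poly p s) / s ^ m = k s / s ^ m - poly q s) (at 0)"
    and e2: "eventually (\<lambda>s::real. s ^ (m + N) / s ^ m = s ^ N) (at 0)"
    by (auto simp: eventually_at_filter q poly_monom power_add field_simps)
  ultimately have "(\<lambda>s. k s / s ^ m - poly q s) \<in> O[at 0](\<lambda>s. s ^ N)"
    unfolding landau_o.big.in_cong[OF e1] landau_o.big.cong[OF e2] by simp
  then show "\<exists>p. (\<lambda>s. k s / s ^ m - poly p s) \<in> O[at 0](\<lambda>s. s ^ N)" by blast
qed

text \<open>A bootstrap that requires neither derivatives of q near 0 nor continuity of X. If p
  agrees with X to order N, expand x - p (q x): its value at X s is X s - p s, so its expansion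
  starts with a term e x^N, and since X s is s / b to first order, adding (e / b^N) s^N to p gains
  one order.\<close>

lemma texp_local_inverse:
  assumes q: "texp q" "(\<lambda>x. q x - b * x) \<in> O[at 0](\<lambda>x. x ^ 2)" and b: "b \<noteq> 0"
    and X: "filterlim X (at 0) (at 0)" "X \<in> O[at 0](\<lambda>s. s)"
    and qX: "eventually (\<lambda>s. q (X s) = s) (at 0)"
  shows "texp X"
proof -
  \<comment> \<open>X may miss values near 0, so estimates in the variable x = X s are only
    available along the image filter.\<close>
  let ?F = "filtermap X (at 0)"
  have F: "?F \<le> at 0" "?F \<noteq> bot" using X(1) by (auto simp: filterlim_def filtermap_bot_iff)
  have XN: "(\<lambda>s. X s ^ N) \<in> O[at 0](\<lambda>s. s ^ N)" for N using X(2) by (rule landau_o.big_power)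
  have X1: "(\<lambda>s. X s - s / b) \<in> O[at 0](\<lambda>s. s ^ 2)"
  proof -
    have "(\<lambda>s. q (X s) - b * X s) \<in> O[at 0](\<lambda>s. X s ^ 2)" by (rule landau_o.big.compose[OF q(2) X(1)])
    also note XN[of 2]
    finally have "(\<lambda>s. (- 1 / b) * (q (X s) - b * X s)) \<in> O[at 0](\<lambda>s. s ^ 2)"
      using b by (subst landau_o.big.cmult_in_iff) auto
    moreover have "eventually (\<lambda>s. (- 1 / b) * (q (X s) - b * X s) = X s - s / b) (at 0)"
      using qX by eventually_elim (use b in \<open>simp add: field_simps\<close>)
    ultimately show ?thesis
      using landau_o.big.in_cong[of "\<lambda>s. (- 1 / b) * (q (X s) - b * X s)" "\<lambda>s. X s - s / b" "at 0" "\<lambda>s. s ^ 2"]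
      by simp
  qed
  have XNb: "(\<lambda>s. X s ^ N - (s / b) ^ N) \<in> O[at 0](\<lambda>s. s ^ Suc N)" for N
  proof (induction N)
    case (Suc N)
    have "(\<lambda>s. X s * (X s ^ N - (s / b) ^ N)) \<in> O[at 0](\<lambda>s. s * s ^ Suc N)"
      by (rule landau_o.big.mult[OF X(2) Suc])
    moreover have "(\<lambda>s. (X s - s / b) * (s / b) ^ N) \<in> O[at 0](\<lambda>s. s ^ 2 * s ^ N)"
    proof (rule landau_o.big.mult[OF X1])
      show "(\<lambda>s. (s / b) ^ N) \<in> O[at 0](\<lambda>s. s ^ N)"
        by (rule landau_o.big_power) (auto simp: divide_inverse mult.commute)
    qed
    ultimately have "(\<lambda>s. X s * (X s ^ N - (s / b) ^ N) + (X s - s / b) * (s / b) ^ N) \<in> O[at 0](\<lambda>s. s ^ Suc (Suc N))"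
      using sum_in_bigo(1) by (simp add: power2_eq_square mult.assoc)
    then show ?case by (simp add: algebra_simps)
  qed simp
  have "\<exists>p. (\<lambda>s. X s - poly p s) \<in> O[at 0](\<lambda>s. s ^ N)" for N
  proof (induction N)
    case 0
    have "(\<lambda>s. X s - poly 0 s) \<in> O[at 0](\<lambda>s. s ^ 0)"
    proof -
      have "(\<lambda>s::real. s) \<in> O[at 0](\<lambda>s. 1)" by (intro bigoI_tendsto[of _ _ 0]) auto
      then show ?thesis using landau_o.big_trans[OF X(2)] by simp
    qed
    then show ?case by blast
  next
    case (Suc N)
    then obtain p where p: "(\<lambda>s. X s - poly p s) \<in> O[at 0](\<lambda>s. s ^ N)" by blast
    define k where "k x = x - poly p (q x)" for x
    have "texp k" unfolding k_def by (intro texp_diff texp_poly_compose q texp_id)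
    then obtain w where w: "(\<lambda>x. k x - poly w x) \<in> O[at 0](\<lambda>x. x ^ Suc N)" unfolding texp_def by blast
    have kX: "eventually (\<lambda>s. k (X s) = X s - poly p s) (at 0)"
      using qX by eventually_elim (simp add: k_def)
    have wX: "(\<lambda>s. k (X s) - poly w (X s)) \<in> O[at 0](\<lambda>s. X s ^ Suc N)"
      by (rule landau_o.big.compose[OF w X(1)])
    \<comment> \<open>The reverse bound, which turns O(s^N) into O(X^N), an estimate in the variable
      of w.\<close>
    have sX: "(\<lambda>s. s) \<in> O[at 0](X)"
    proof -
      have "q \<in> O[at 0](\<lambda>x. x)"
      proof -
        have "(\<lambda>x::real. x ^ 2) \<in> O[at 0](\<lambda>x. x)"
          using power_bigo_mono[of 1 2] by simp
        then have "(\<lambda>x. (q x - b * x) + b * x) \<in> O[at 0](\<lambda>x. x)"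
          by (intro sum_in_bigo(1)[OF landau_o.big_trans[OF q(2)]]) auto
        then show ?thesis by simp
      qed
      then have "(\<lambda>s. q (X s)) \<in> O[at 0](\<lambda>s. X s)" by (rule landau_o.big.compose[OF _ X(1)])
      then show ?thesis
        using landau_o.big.in_cong[of "\<lambda>s. q (X s)" "\<lambda>s. s" "at 0" X] qX by simp
    qed
    have "poly w \<in> O[?F](\<lambda>x. x ^ N)"
    proof -
      have "(\<lambda>s. X s - poly p s) \<in> O[at 0](\<lambda>s. X s ^ N)"
        using p landau_o.big_power[OF sX] by (rule landau_o.big_trans)
      then have "(\<lambda>s. k (X s)) \<in> O[at 0](\<lambda>s. X s ^ N)"
        using landau_o.big.in_cong[OF kX, of "\<lambda>s. X s ^ N"] by simp
      moreover have "(\<lambda>s. k (X s) - poly w (X s)) \<in> O[at 0](\<lambda>s. X s ^ N)"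
      proof (rule landau_o.big_trans[OF wX])
        have "(\<lambda>x::real. x ^ Suc N) \<in> O[at 0](\<lambda>x. x ^ N)"
          by (rule power_bigo_mono) simp
        then show "(\<lambda>s. X s ^ Suc N) \<in> O[at 0](\<lambda>s. X s ^ N)" by (rule landau_o.big.compose[OF _ X(1)])
      qed
      ultimately have "(\<lambda>s. k (X s) - (k (X s) - poly w (X s))) \<in> O[at 0](\<lambda>s. X s ^ N)"
        by (rule sum_in_bigo(2))
      then show ?thesis by (simp add: landau_o.big.in_filtermap_iff)
    qed
    then have "monom 1 N dvd w" by (rule poly_bigo_power_dvd[OF F])
    then obtain v where v: "w = monom 1 N * v" by auto
    obtain v' where v': "v = [:poly v 0:] + monom 1 1 * v'"
    proof -
      have "[:-0, 1:] dvd v - [:poly v 0:]" by (subst poly_eq_0_iff_dvd[symmetric]) simp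
      then obtain v' where "v - [:poly v 0:] = [:0, 1:] * v'" by auto
      then have "v = [:poly v 0:] + [:0, 1:] * v'" by (simp add: algebra_simps)
      then show ?thesis using that by (simp add: monom_altdef)
    qed
    define e where "e = poly v 0"
    have "(\<lambda>x. poly w x - e * x ^ N) \<in> O[at 0](\<lambda>x. x ^ Suc N)"
    proof -
      have "poly (monom 1 (Suc N) * v') \<in> O[at 0](\<lambda>x. x ^ Suc N)" by (rule monom_dvd_imp_bigo) simp
      moreover have "poly (monom 1 (Suc N) * v') x = poly w x - e * x ^ N" for x
      proof -
        have "poly w x = x ^ N * poly v x" by (simp add: v poly_monom)
        also have "poly v x = e + x * poly v' x" unfolding e_def by (subst v') (simp add: poly_monom)
        finally show ?thesis by (simp add: poly_monom algebra_simps)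
      qed
      then have "poly (monom 1 (Suc N) * v') = (\<lambda>x. poly w x - e * x ^ N)" by (rule ext)
      ultimately show ?thesis by simp
    qed
    from sum_in_bigo(1)[OF w this] have "(\<lambda>x. k x - e * x ^ N) \<in> O[at 0](\<lambda>x. x ^ Suc N)" by simp
    then have "(\<lambda>s. k (X s) - e * X s ^ N) \<in> O[at 0](\<lambda>s. X s ^ Suc N)" by (rule landau_o.big.compose[OF _ X(1)])
    then have "(\<lambda>s. k (X s) - e * X s ^ N) \<in> O[at 0](\<lambda>s. s ^ Suc N)"
      using XN landau_o.big_trans by blast
    moreover have "(\<lambda>s. e * (X s ^ N - (s / b) ^ N)) \<in> O[at 0](\<lambda>s. s ^ Suc N)"
      using XNb by (cases "e = 0") auto
    ultimately have "(\<lambda>s. (k (X s) - e * X s ^ N) + e * (X s ^ N - (s / b) ^ N)) \<in> O[at 0](\<lambda>s. s ^ Suc N)"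
      by (rule sum_in_bigo(1))
    moreover have ev: "eventually (\<lambda>s. (k (X s) - e * X s ^ N) + e * (X s ^ N - (s / b) ^ N)
        = X s - poly (p + monom (e / b ^ N) N) s) (at 0)"
      using kX by eventually_elim (simp add: poly_monom algebra_simps power_divide)
    ultimately have "(\<lambda>s. X s - poly (p + monom (e / b ^ N) N) s) \<in> O[at 0](\<lambda>s. s ^ Suc N)"
      unfolding landau_o.big.in_cong[OF ev] by simp
    then show ?case by blast
  qed
  then show ?thesis unfolding texp_def by blast
qed

section \<open>Orders of vanishing and composition\<close>

lemma bigo_power_tendsto_0:
  fixes k :: "real \<Rightarrow> real"
  assumes "k \<in> O[at 0](\<lambda>s. s ^ N)" "N > 0" shows "(k \<longlongrightarrow> 0) (at 0)"
proof -
  have "((\<lambda>s::real. s ^ N) \<longlongrightarrow> 0) (at 0)" using assms(2) by (auto intro!: tendsto_eq_intros)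
  then have "k \<in> o[at 0](\<lambda>_. 1)"
    by (intro landau_o.big_small_trans[OF assms(1)] smalloI_tendsto) auto
  from smalloD_tendsto[OF this] show ?thesis by simp
qed

lemma texp_limit:
  assumes "texp k" obtains b where "(k \<longlongrightarrow> b) (at 0)"
proof -
  obtain p where p: "(\<lambda>s. k s - poly p s) \<in> O[at 0](\<lambda>s. s ^ 1)" using assms unfolding texp_def by blast
  have "((\<lambda>s. k s - poly p s) \<longlongrightarrow> 0) (at 0)" by (rule bigo_power_tendsto_0[OF p]) simp
  then have "((\<lambda>s. (k s - poly p s) + poly p s) \<longlongrightarrow> 0 + poly p 0) (at 0)"
    by (intro tendsto_add tendsto_intros)
  then show ?thesis using that by simp
qed

lemma bigo_power_Suc:
  fixes k :: "real \<Rightarrow> real"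
  assumes "(\<lambda>s. k s / s ^ m) \<in> O[at 0](\<lambda>s. s ^ n)"
  shows "k \<in> O[at 0](\<lambda>s. s ^ (m + n))"
proof -
  have "(\<lambda>s. s ^ m * (k s / s ^ m)) \<in> O[at 0](\<lambda>s. s ^ m * s ^ n)"
    by (rule landau_o.big.mult[OF landau_o.big_refl assms])
  moreover have ev: "eventually (\<lambda>s. s ^ m * (k s / s ^ m) = k s) (at 0)"
    by (intro eventually_mono[OF eventually_neq_at_within[of 0]]) simp
  ultimately show ?thesis unfolding landau_o.big.in_cong[OF ev] by (simp add: power_add)
qed

lemma texp_linear_part:
  assumes k: "texp k" "(k \<longlongrightarrow> 0) (at 0)" and b: "((\<lambda>s. k s / s) \<longlongrightarrow> b) (at 0)"
  shows "(\<lambda>s. k s - b * s) \<in> O[at 0](\<lambda>s. s ^ 2)"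
proof -
  have t: "texp (\<lambda>s. k s / s ^ 1)" using texp_divide_power[OF k(1), of 1] texp_bigo_id[OF k] by simp
  have "(\<lambda>s. k s / s ^ 1 - b) \<in> O[at 0](\<lambda>s. s)"
    by (rule texp_bigo_id[OF texp_diff[OF t texp_const]]) (use tendsto_diff[OF b tendsto_const[of b]] in simp)
  moreover have ev: "eventually (\<lambda>s. k s / s ^ 1 - b = (k s - b * s) / s ^ 1) (at 0)"
    by (intro eventually_mono[OF eventually_neq_at_within[of 0]]) (simp add: field_simps)
  ultimately have "(\<lambda>s. (k s - b * s) / s ^ 1) \<in> O[at 0](\<lambda>s. s ^ 1)"
    unfolding landau_o.big.in_cong[OF ev] by simp
  from bigo_power_Suc[OF this] show ?thesis by (simp add: power2_eq_square)
qed

lemma sgn_of_quotient: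
  fixes x y c :: real
  assumes "sgn (x / y) = sgn c" "y \<noteq> 0" shows "sgn x = sgn c * sgn y"
  using assms sgn_mult[of "x / y" y] by simp

text \<open>m is one less than the least N for which k is not O(s^N); a limit b = 0 would gain one
  more power and contradict this choice.\<close>

lemma texp_order:
  assumes k: "texp k" and nf: "k \<notin> O[at 0](\<lambda>s. s ^ N)"
  obtains m b where "b \<noteq> 0" "texp (\<lambda>s. k s / s ^ m)" "((\<lambda>s. k s / s ^ m) \<longlongrightarrow> b) (at 0)"
    "k \<in> O[at 0](\<lambda>s. s ^ m)"
proof -
  define L where "L = (LEAST N. k \<notin> O[at 0](\<lambda>s. s ^ N))"
  have L: "k \<notin> O[at 0](\<lambda>s. s ^ L)" unfolding L_def using nf by (rule LeastI)
  have "L \<noteq> 0" using L texp_bigo_1[OF k] by (cases L) auto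
  then obtain m where m: "L = Suc m" by (cases L) auto
  then have O: "k \<in> O[at 0](\<lambda>s. s ^ m)" using not_less_Least[of m "\<lambda>N. k \<notin> O[at 0](\<lambda>s. s ^ N)"]
    unfolding L_def by auto
  have t: "texp (\<lambda>s. k s / s ^ m)" by (rule texp_divide_power[OF k O])
  obtain b where b: "((\<lambda>s. k s / s ^ m) \<longlongrightarrow> b) (at 0)" using texp_limit[OF t] .
  have "b \<noteq> 0"
  proof
    assume "b = 0"
    then have "(\<lambda>s. k s / s ^ m) \<in> O[at 0](\<lambda>s. s ^ 1)" using texp_bigo_id[OF t] b by simp
    from bigo_power_Suc[OF this] L m show False by simp
  qed
  then show ?thesis using that t b O by blast
qed

lemma texp_compose:
  assumes F: "texp F" and X: "texp X" "filterlim X (at 0) (at 0)"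
  shows "texp (\<lambda>s. F (X s))"
proof (rule texp_approx)
  fix N
  obtain p where p: "(\<lambda>s. F s - poly p s) \<in> O[at 0](\<lambda>s. s ^ N)" using F unfolding texp_def by blast
  have "(\<lambda>s. F (X s) - poly p (X s)) \<in> O[at 0](\<lambda>s. X s ^ N)" by (rule landau_o.big.compose[OF p X(2)])
  also have "(\<lambda>s. X s ^ N) \<in> O[at 0](\<lambda>s. s ^ N)"
    using X by (intro landau_o.big_power texp_bigo_id) (auto simp: filterlim_at)
  finally show "\<exists>k'. texp k' \<and> (\<lambda>s. F (X s) - k' s) \<in> O[at 0](\<lambda>s. s ^ N)"
    using texp_poly_compose[OF X(1)] by blast
qed

text \<open>Unlike in \<open>texp_compose\<close>, the inner function may hit 0 arbitrarily close to
  0, so the value of F at 0 counts; continuity ties it to the expansion.\<close>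

lemma texp_compose_isCont:
  assumes F: "texp F" "isCont F 0" and k: "texp k" "(k \<longlongrightarrow> 0) (at 0)"
  shows "texp (\<lambda>s. F (k s))"
proof (rule texp_approx)
  fix N
  \<comment> \<open>One order more than needed: an estimate of order 0 would not determine the
    constant term of p.\<close>
  obtain p where p: "(\<lambda>s. F s - poly p s) \<in> O[at 0](\<lambda>s. s ^ Suc N)" using F unfolding texp_def by blast
  have "((\<lambda>s. F s - poly p s) \<longlongrightarrow> 0) (at 0)" by (rule bigo_power_tendsto_0[OF p]) simp
  moreover have "((\<lambda>s. F s - poly p s) \<longlongrightarrow> F 0 - poly p 0) (at 0)"
    using F(2) by (auto intro!: tendsto_intros simp: isCont_def)
  ultimately have p0: "F 0 - poly p 0 = 0" using tendsto_unique[OF at_neq_bot] by blast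
  obtain C where C: "eventually (\<lambda>w. norm (F w - poly p w) \<le> C * norm (w ^ Suc N)) (at 0)"
    using landau_o.bigE[OF p] by blast
  then have "eventually (\<lambda>w. norm (F w - poly p w) \<le> C * norm (w ^ Suc N)) (nhds 0)"
    unfolding eventually_at_filter by (rule eventually_mono) (use p0 in auto)
  then have "eventually (\<lambda>s. norm (F (k s) - poly p (k s)) \<le> C * norm (k s ^ Suc N)) (at 0)"
    using k(2) by (rule eventually_compose_filterlim)
  then have "(\<lambda>s. F (k s) - poly p (k s)) \<in> O[at 0](\<lambda>s. k s ^ Suc N)" by (rule bigoI)
  also have "(\<lambda>s. k s ^ Suc N) \<in> O[at 0](\<lambda>s. s ^ Suc N)" by (intro landau_o.big_power texp_bigo_id k)
  also have "(\<lambda>s::real. s ^ Suc N) \<in> O[at 0](\<lambda>s. s ^ N)" by (rule power_bigo_mono) simp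
  finally show "\<exists>k'. texp k' \<and> (\<lambda>s. F (k s) - k' s) \<in> O[at 0](\<lambda>s. s ^ N)"
    using texp_poly_compose[OF k(1)] by blast
qed

text \<open>Obtained as a local inverse of tan, whose expansion comes from the power series of sin
  and cos.\<close>

lemma texp_arctan: "texp arctan"
proof (rule texp_local_inverse[of tan 1])
  have "texp (\<lambda>s. sin s)"
    by (rule texp_powser[of 1 sin_coeff sin "\<lambda>s. s"]) (use sin_converges[where 'a = real] texp_id in auto)
  moreover have "texp (\<lambda>s. cos s)"
    by (rule texp_powser[of 1 cos_coeff cos "\<lambda>s. s"]) (use cos_converges[where 'a = real] texp_id in auto)
  moreover have "((\<lambda>s::real. cos s) \<longlongrightarrow> 1) (at 0)" by (auto intro!: tendsto_eq_intros)
  ultimately have "texp (\<lambda>s. sin s * inverse (cos s))" by (intro texp_mult texp_inverse[of _ 1]) auto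
  then show tan: "texp tan" by (simp add: tan_def divide_inverse)
  have "(tan has_real_derivative 1) (at 0)" by (rule derivative_eq_intros refl | simp)+
  then have lin: "((\<lambda>s. tan s / s) \<longlongrightarrow> 1) (at (0::real))" by (simp add: has_field_derivative_iff)
  have "(tan \<longlongrightarrow> 0) (at (0::real))" by (auto intro!: tendsto_eq_intros)
  from texp_linear_part[OF tan this lin] show "(\<lambda>x::real. tan x - 1 * x) \<in> O[at 0](\<lambda>x. x ^ 2)" .
  have lim: "(arctan \<longlongrightarrow> 0) (at 0)" by (auto intro!: tendsto_eq_intros)
  show "filterlim arctan (at 0) (at 0)"
    by (intro filterlim_atI lim) (intro eventually_mono[OF eventually_neq_at_within[of 0]], simp)
  have "(arctan has_real_derivative 1) (at 0)" by (rule derivative_eq_intros refl | simp)+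
  then have "((\<lambda>s. arctan s / s) \<longlongrightarrow> 1) (at (0::real))" by (simp add: has_field_derivative_iff)
  then show "arctan \<in> O[at 0](\<lambda>s. s)"
    by (rule bigoI_tendsto) (rule eventually_neq_at_within)
qed (simp_all add: tan_arctan)

text \<open>The remainder in Lagrange's form is bounded because the N-th derivative is continuous on
  a compact neighbourhood.\<close>

lemma texp_Taylor:
  fixes d :: "nat \<Rightarrow> real \<Rightarrow> real"
  assumes \<delta>: "\<delta> > 0" and d: "\<And>n t. \<bar>t - t0\<bar> < \<delta> \<Longrightarrow> (d n has_real_derivative d (Suc n) t) (at t)"
  shows "texp (\<lambda>x. d 0 (t0 + x))"
  unfolding texp_def
proof
  fix N
  define p where "p = (\<Sum>m<N. monom (d m t0 / fact m) m)"
  have "continuous_on {t0 - \<delta> / 2..t0 + \<delta> / 2} (d N)"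
  proof (intro continuous_at_imp_continuous_on ballI)
    fix t assume "t \<in> {t0 - \<delta> / 2..t0 + \<delta> / 2}"
    then have "\<bar>t - t0\<bar> < \<delta>" using \<delta> by (simp add: abs_less_iff)
    from DERIV_isCont[OF d[OF this]] show "isCont (d N) t" .
  qed
  then have "bounded (d N ` {t0 - \<delta> / 2..t0 + \<delta> / 2})"
    by (intro compact_imp_bounded compact_continuous_image) auto
  then obtain C where C: "\<And>t. t \<in> {t0 - \<delta> / 2..t0 + \<delta> / 2} \<Longrightarrow> \<bar>d N t\<bar> \<le> C"
    unfolding bounded_iff by (metis imageI real_norm_def)
  have "\<bar>d 0 (t0 + x) - poly p x\<bar> \<le> (C / fact N) * \<bar>x ^ N\<bar>" if x: "\<bar>x\<bar> \<le> \<delta> / 2" for x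
  proof -
    have der: "\<forall>m t. m < N \<and> \<bar>t\<bar> \<le> \<bar>x\<bar> \<longrightarrow> DERIV (\<lambda>y. d m (t0 + y)) t :> d (Suc m) (t0 + t)"
    proof (intro allI impI)
      fix m t assume "m < N \<and> \<bar>t\<bar> \<le> \<bar>x\<bar>"
      then have "(d m has_real_derivative d (Suc m) (t0 + t)) (at (t0 + t))" using x \<delta> by (intro d) auto
      then show "DERIV (\<lambda>y. d m (t0 + y)) t :> d (Suc m) (t0 + t)"
        using DERIV_shift[of "d m" _ t t0] by (simp add: add.commute)
    qed
    from Maclaurin_bi_le[OF _ der, of "\<lambda>y. d 0 (t0 + y)"] obtain t where
      t: "\<bar>t\<bar> \<le> \<bar>x\<bar>" "d 0 (t0 + x) = (\<Sum>m<N. d m (t0 + 0) / fact m * x ^ m) + d N (t0 + t) / fact N * x ^ N" by auto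
    have "d 0 (t0 + x) - poly p x = d N (t0 + t) / fact N * x ^ N"
      using t(2) by (simp add: p_def poly_sum poly_monom)
    then have "\<bar>d 0 (t0 + x) - poly p x\<bar> = \<bar>d N (t0 + t)\<bar> / fact N * \<bar>x ^ N\<bar>" by (simp add: abs_mult)
    also have "\<bar>d N (t0 + t)\<bar> \<le> C" using t(1) x by (intro C) (auto simp: abs_le_iff)
    then have "\<bar>d N (t0 + t)\<bar> / fact N * \<bar>x ^ N\<bar> \<le> (C / fact N) * \<bar>x ^ N\<bar>"
      by (intro mult_right_mono divide_right_mono) auto
    finally show ?thesis .
  qed
  moreover have "eventually (\<lambda>x. \<bar>x\<bar> \<le> \<delta> / 2) (at 0)"
    using \<delta> by (auto simp: eventually_at dist_real_def intro!: exI[of _ "\<delta> / 2"])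
  ultimately have "eventually (\<lambda>x. norm (d 0 (t0 + x) - poly p x) \<le> (C / fact N) * norm (x ^ N)) (at 0)"
    by (auto elim: eventually_mono)
  then have "(\<lambda>x. d 0 (t0 + x) - poly p x) \<in> O[at 0](\<lambda>x. x ^ N)" by (rule bigoI)
  then show "\<exists>p. (\<lambda>x. d 0 (t0 + x) - poly p x) \<in> O[at 0](\<lambda>s. s ^ N)" by blast
qed

text \<open>The orders of vanishing of the angle and of the height have the same parity because h is increasing,
  and one of them is 1 because the curve is immersed; so both are odd.\<close>

lemma pexp_of_parametrization:
  fixes h om u :: "real \<Rightarrow> real"
  assumes \<delta>: "\<delta> > 0" and om: "texp om" "om 0 = 0" "continuous_on {-\<delta>..\<delta>} om"
    and u: "texp u" "(u \<longlongrightarrow> h x0) (at 0)" "\<And>x. x \<in> {-\<delta>..\<delta>} \<Longrightarrow> u x = h (x0 + om x)"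
    and h: "strict_mono_on J h" "x0 \<in> J" "\<And>x. x \<in> {-\<delta>..\<delta>} \<Longrightarrow> x0 + om x \<in> J"
    and nonflat: "om \<notin> O[at 0](\<lambda>x. x ^ N)"
    and imm: "om \<notin> O[at 0](\<lambda>x. x ^ 2) \<or> (\<lambda>x. u x - h x0) \<notin> O[at 0](\<lambda>x. x ^ 2)"
  shows "pexp h x0"
proof -
  obtain m b where b: "b \<noteq> 0" and tv: "texp (\<lambda>x. om x / x ^ m)" and lv: "((\<lambda>x. om x / x ^ m) \<longlongrightarrow> b) (at 0)"
    and Om: "om \<in> O[at 0](\<lambda>x. x ^ m)" using texp_order[OF om(1) nonflat] .
  have "isCont om 0" using om(3) \<delta> by (intro continuous_on_interior[OF om(3)]) (auto simp: interior_atLeastAtMost_real)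
  then have lom: "(om \<longlongrightarrow> 0) (at 0)" using om(2) by (simp add: isCont_def)
  define w where "w x = u x - h x0" for x
  have tw: "texp w" and lw: "(w \<longlongrightarrow> 0) (at 0)"
    unfolding w_def using u by (auto intro!: texp_diff texp_const tendsto_eq_intros)
  \<comment> \<open>As h is increasing, height and angle move in the same direction.\<close>
  have sgn_w: "sgn (w x) = sgn (om x)" if "x \<in> {-\<delta>..\<delta>}" for x
    using strict_mono_onD[OF h(1) h(2) h(3)[OF that]] strict_mono_onD[OF h(1) h(3)[OF that] h(2)] u(3)[OF that]
    unfolding w_def by (cases "om x" "0::real" rule: linorder_cases) (auto simp: sgn_if)
  have inD: "eventually (\<lambda>x. x \<in> {-\<delta>..\<delta>}) (at 0)"
    using \<delta> by (auto simp: eventually_at dist_real_def intro!: exI[of _ \<delta>])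
  have sgn_lim: "eventually (\<lambda>x. sgn (g x) = sgn l) (at 0)" if "(g \<longlongrightarrow> l) (at 0)" "l \<noteq> 0" for g :: "real \<Rightarrow> real" and l
  proof (cases "l > 0")
    case True
    then show ?thesis using order_tendstoD(1)[OF that(1), of 0] by (auto elim: eventually_mono)
  next
    case False
    then show ?thesis using order_tendstoD(2)[OF that(1), of 0] that(2) by (auto elim!: eventually_mono)
  qed
  have m: "odd m"
  proof (rule ccontr)
    assume even: "\<not> odd m"
    have "m \<noteq> 0"
    proof
      assume "m = 0"
      then have "(om \<longlongrightarrow> b) (at 0)" using lv by simp
      from tendsto_unique[OF at_neq_bot this lom] show False using b by simp
    qed
    \<comment> \<open>With m at least 2, the immersion hypothesis leaves w of exact order 1. Then w
      changes sign at 0 whereas om, of even order, does not.\<close>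
    then have "m \<ge> 2" using even by presburger
    then have "om \<in> O[at 0](\<lambda>x. x ^ 2)" by (rule landau_o.big_trans[OF Om power_bigo_mono])
    then have nw: "w \<notin> O[at 0](\<lambda>x. x ^ 2)" using imm by (simp add: w_def[abs_def])
    obtain c where c: "((\<lambda>x. w x / x) \<longlongrightarrow> c) (at 0)"
    proof -
      have "w \<in> O[at 0](\<lambda>x. x ^ 1)" using texp_bigo_id[OF tw lw] by simp
      from texp_limit[OF texp_divide_power[OF tw this]] that show ?thesis by auto
    qed
    have c0: "c \<noteq> 0"
    proof
      assume "c = 0"
      with texp_linear_part[OF tw lw c] nw show False by simp
    qed
    have "eventually (\<lambda>x. sgn (w x / x) = sgn c \<and> sgn (om x / x ^ m) = sgn b \<and> x \<in> {-\<delta>..\<delta>}) (at 0)"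
      using sgn_lim[OF c c0] sgn_lim[OF lv b] inD by eventually_elim auto
    then obtain d where d: "d > 0"
      "\<And>x. x \<noteq> 0 \<Longrightarrow> \<bar>x\<bar> < d \<Longrightarrow> sgn (w x / x) = sgn c \<and> sgn (om x / x ^ m) = sgn b \<and> x \<in> {-\<delta>..\<delta>}"
      unfolding eventually_at dist_real_def by auto
    have main: "sgn c * sgn x = sgn b" if "x \<noteq> 0" "\<bar>x\<bar> < d" for x
    proof -
      have "sgn (w x) = sgn c * sgn x" using d(2)[OF that] that(1) by (intro sgn_of_quotient) auto
      moreover have "sgn (om x) = sgn b * sgn (x ^ m)" using d(2)[OF that] that(1) by (intro sgn_of_quotient) auto
      moreover have "sgn (x ^ m) = 1" using even that(1) by (auto simp: sgn_if zero_less_power_eq)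
      ultimately show ?thesis using sgn_w d(2)[OF that] by auto
    qed
    have "sgn c * 1 = sgn b" "sgn c * (-1) = sgn b" using main[of "d / 2"] main[of "- d / 2"] d(1) by (auto simp: sgn_if)
    then show False using c0 by (simp add: sgn_if split: if_splits)
  qed
  have m0: "m > 0" using m by (rule odd_pos)
  \<comment> \<open>The m-th root of om, taken after splitting off x^m so that the radicand has a
    nonzero limit. Thus q^m = om, and q is invertible to first order.\<close>
  define q where "q x = x * root m (om x / x ^ m)" for x
  have tr: "texp (\<lambda>x. root m (om x / x ^ m))" by (rule texp_root[OF tv lv b m])
  then have tq: "texp q" unfolding q_def by (intro texp_mult texp_id)
  have lr: "((\<lambda>x. root m (om x / x ^ m)) \<longlongrightarrow> root m b) (at 0)" by (intro tendsto_intros lv)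
  have qlin: "(\<lambda>x. q x - root m b * x) \<in> O[at 0](\<lambda>x. x ^ 2)"
  proof (rule texp_linear_part[OF tq])
    have "((\<lambda>x. x * root m (om x / x ^ m)) \<longlongrightarrow> 0 * root m b) (at 0)" by (intro tendsto_mult lr) auto
    then show "(q \<longlongrightarrow> 0) (at 0)" by (simp add: q_def[abs_def])
    have "eventually (\<lambda>x. root m (om x / x ^ m) = q x / x) (at 0)"
      by (intro eventually_mono[OF eventually_neq_at_within[of 0]]) (simp add: q_def)
    from Lim_transform_eventually[OF lr this] show "((\<lambda>x. q x / x) \<longlongrightarrow> root m b) (at 0)" .
  qed
  have qpow: "q x ^ m = om x" if "x \<noteq> 0" for x
    using that m by (simp add: q_def power_mult_distrib odd_real_root_pow)
  have "eventually (\<lambda>x. sgn (om x / x ^ m) = sgn b \<and> \<bar>om x / x ^ m\<bar> > \<bar>b\<bar> / 2 \<and> x \<in> {-\<delta>..\<delta>}) (at 0)"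
  proof -
    have "eventually (\<lambda>x. \<bar>om x / x ^ m\<bar> > \<bar>b\<bar> / 2) (at 0)"
      using b by (intro order_tendstoD(1)[OF tendsto_rabs[OF lv]]) simp
    then show ?thesis using sgn_lim[OF lv b] inD by eventually_elim blast
  qed
  then obtain d where d: "d > 0" "\<And>x. x \<noteq> 0 \<Longrightarrow> \<bar>x\<bar> < d \<Longrightarrow>
      sgn (om x / x ^ m) = sgn b \<and> \<bar>om x / x ^ m\<bar> > \<bar>b\<bar> / 2 \<and> x \<in> {-\<delta>..\<delta>}"
    unfolding eventually_at dist_real_def by auto
  define e where "e = d / 2"
  have e: "e > 0" "e < d" using d(1) by (auto simp: e_def)
  have sgn_om: "sgn (om x) = sgn b * sgn x" if "x \<noteq> 0" "\<bar>x\<bar> < d" for x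
  proof -
    have "sgn (om x) = sgn b * sgn (x ^ m)" using d(2)[OF that] that(1) by (intro sgn_of_quotient) auto
    moreover have "sgn (x ^ m) = sgn x" using that(1) m m0
      by (auto simp: sgn_if zero_less_power_eq)
    ultimately show ?thesis by simp
  qed
  \<comment> \<open>Solves |b| / 2 * |x|^m < |om x| for |x|; this will give X = O(s).\<close>
  have big: "\<bar>x\<bar> \<le> root m (2 / \<bar>b\<bar>) * \<bar>s\<bar>" if "\<bar>x\<bar> < d" "om x = s ^ m" for x s
  proof (cases "x = 0")
    case False
    then have "\<bar>b\<bar> / 2 * \<bar>x\<bar> ^ m < \<bar>s\<bar> ^ m"
      using d(2)[OF False that(1)] that(2) by (simp add: abs_divide power_abs field_simps)
    then have "\<bar>x\<bar> ^ m \<le> 2 / \<bar>b\<bar> * \<bar>s\<bar> ^ m" using b by (simp add: field_simps)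
    then have "root m (\<bar>x\<bar> ^ m) \<le> root m (2 / \<bar>b\<bar> * \<bar>s\<bar> ^ m)" using m0 by simp
    moreover have "root m (2 / \<bar>b\<bar> * \<bar>s\<bar> ^ m) = root m (2 / \<bar>b\<bar>) * \<bar>s\<bar>"
      using m0 by (subst real_root_mult) (simp add: real_root_power_cancel)
    ultimately show ?thesis using m0 by (simp add: real_root_power_cancel)
  qed (use m0 in auto)
  define \<eta> where "\<eta> = min \<bar>om e\<bar> \<bar>om (-e)\<bar>"
  have se: "sgn (om e) = sgn b" "sgn (om (-e)) = - sgn b"
    using sgn_om[of e] sgn_om[of "-e"] e by (auto simp: sgn_if)
  have \<eta>: "\<eta> > 0" using se b by (auto simp: \<eta>_def sgn_if split: if_splits)
  have ex: "\<exists>x. x \<in> {-e..e} \<and> om x = s" if "\<bar>s\<bar> < \<eta>" for s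
  proof -
    have "{-e..e} \<subseteq> {-\<delta>..\<delta>}" using d(2)[of e] d(2)[of "-e"] e by auto
    then have "continuous_on {-e..e} om" by (rule continuous_on_subset[OF om(3)])
    then have conn: "connected (om ` {-e..e})" by (rule connected_continuous_image) auto
    have "om e \<in> om ` {-e..e}" "om (-e) \<in> om ` {-e..e}" using e by auto
    moreover have "(om (-e) \<le> s \<and> s \<le> om e) \<or> (om e \<le> s \<and> s \<le> om (-e))"
      using that se b unfolding \<eta>_def by (auto simp: sgn_if split: if_splits)
    ultimately have "s \<in> om ` {-e..e}" using connectedD_interval[OF conn] by blast
    then show ?thesis by auto
  qed
  \<comment> \<open>A right inverse: om takes both signs on [-e, e], so om x = s^m is solvable for
    small s by the intermediate value theorem. Then q (X s) = s, because real m-th roots are unique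
    for odd m.\<close>
  define X where "X s = (SOME x. x \<in> {-e..e} \<and> om x = s ^ m)" for s
  have "((\<lambda>s::real. \<bar>s ^ m\<bar>) \<longlongrightarrow> 0) (at 0)" using m0 by (auto intro!: tendsto_eq_intros)
  then have small: "eventually (\<lambda>s. \<bar>s ^ m\<bar> < \<eta>) (at 0)" using \<eta> order_tendstoD(2) by blast
  have X: "eventually (\<lambda>s. X s \<in> {-e..e} \<and> om (X s) = s ^ m \<and> X s \<noteq> 0) (at 0)"
    using small eventually_neq_at_within[of 0]
  proof eventually_elim
    case (elim s)
    have "X s \<in> {-e..e} \<and> om (X s) = s ^ m" unfolding X_def by (rule someI_ex[OF ex[OF elim(1)]])
    moreover have "X s \<noteq> 0" using elim(2) calculation om(2) by (metis power_eq_0_iff)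
    ultimately show ?case by blast
  qed
  have XO: "X \<in> O[at 0](\<lambda>s. s)"
  proof (rule bigoI)
    show "eventually (\<lambda>s. norm (X s) \<le> root m (2 / \<bar>b\<bar>) * norm s) (at 0)"
      using X by eventually_elim (use big e in auto)
  qed
  have X0: "(X \<longlongrightarrow> 0) (at 0)" using bigo_power_tendsto_0[of X 1] XO by simp
  have Xlim: "filterlim X (at 0) (at 0)"
    by (intro filterlim_atI X0) (use X in \<open>auto elim: eventually_mono\<close>)
  have "texp X"
  proof (rule texp_local_inverse[OF tq qlin _ Xlim XO])
    show "root m b \<noteq> 0" using b m0 by simp
    show "eventually (\<lambda>s. q (X s) = s) (at 0)"
      using X
    proof eventually_elim
      case (elim s)
      then have "q (X s) ^ m = s ^ m" using qpow by simp
      then have "root m (q (X s) ^ m) = root m (s ^ m)" by simp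
      then show ?case by (simp only: odd_real_root_power_cancel[OF m])
    qed
  qed
  then have "texp (\<lambda>s. u (X s))" by (rule texp_compose[OF u(1) _ Xlim])
  moreover have "eventually (\<lambda>s. u (X s) = h (x0 + s ^ m)) (at 0)"
    using X
  proof eventually_elim
    case (elim s)
    then have "\<bar>X s\<bar> < d" using e by (simp add: abs_less_iff)
    then have "X s \<in> {-\<delta>..\<delta>}" using d(2)[of "X s"] elim by blast
    then show ?case using u(3) elim by simp
  qed
  ultimately have "texp (\<lambda>s. h (x0 + s ^ m))" by (rule texp_cong)
  then show ?thesis using m unfolding pexp_def by blast
qed

section \<open>Spirals as graphs over the radius\<close>

text \<open>The points whose argument is \<Psi> of their modulus up to a multiple of pi: a diameter
  of the disk, twisted by \<Psi>. The condition on the imaginary part avoids the choice of an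
  argument and admits the center.\<close>

definition twist_curve :: "(real \<Rightarrow> real) \<Rightarrow> complex set" where
  "twist_curve \<Psi> = {z \<in> disk. Im (z * cis (- \<Psi> (cmod z))) = 0}"

lemma Im_rcis_cis: "Im (complex_of_real r * cis \<theta> * cis (- b)) = r * sin (\<theta> - b)"
  by (simp only: mult.assoc cis_mult) simp

text \<open>Serves to compare a relation at the moving angle x0 + om with the one at x0: they differ
  by a multiple of om.\<close>

lemma bpoly_diff_factor:
  "\<exists>Q. \<forall>x y. bpoly P (x0 + x) y - bpoly P x0 y = x * bpoly Q x y"
proof (induction P)
  case 0
  then show ?case by (intro exI[of _ 0]) simp
next
  case (pCons c P)
  then obtain Q where Q: "\<And>x y. bpoly P (x0 + x) y - bpoly P x0 y = x * bpoly Q x y" by blast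
  have "\<exists>c'. \<forall>x. poly c (x0 + x) - poly c x0 = x * poly c' x"
  proof -
    have "[:-0, 1:] dvd pcompose c [:x0, 1:] - [:poly c x0:]"
      by (subst poly_eq_0_iff_dvd[symmetric]) (simp add: poly_pcompose)
    then obtain c' where "pcompose c [:x0, 1:] - [:poly c x0:] = [:0, 1:] * c'" by auto
    then have "poly (pcompose c [:x0, 1:] - [:poly c x0:]) x = poly ([:0, 1:] * c') x" for x by simp
    then show ?thesis by (auto simp: poly_pcompose)
  qed
  then obtain c' where c': "\<And>x. poly c (x0 + x) - poly c x0 = x * poly c' x" by blast
  have "bpoly (pCons c P) (x0 + x) y - bpoly (pCons c P) x0 y = x * bpoly (pCons c' Q) x y" for x y
  proof -
    have "bpoly (pCons c P) (x0 + x) y - bpoly (pCons c P) x0 y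
        = (poly c (x0 + x) - poly c x0) + y * (bpoly P (x0 + x) y - bpoly P x0 y)"
      by (simp add: algebra_simps)
    also have "\<dots> = x * bpoly (pCons c' Q) x y" by (simp only: c' Q) (simp add: algebra_simps)
    finally show ?thesis .
  qed
  then show ?case by blast
qed

text \<open>Dividing by the content removes vertical lines from the zero set, so that no
  specialization at an abscissa vanishes identically. The content has finitely many roots, and
  continuity covers these.\<close>

lemma bpoly_primitive:
  assumes "P \<noteq> 0" "continuous_on {c<..<d} h" "\<And>x. x \<in> {c<..<d} \<Longrightarrow> bpoly P x (h x) = 0"
  obtains P' where "\<And>x. map_poly (\<lambda>p. poly p x) P' \<noteq> 0" "P' \<noteq> 0"
    "\<And>x. x \<in> {c<..<d} \<Longrightarrow> bpoly P' x (h x) = 0"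
proof
  let ?P' = "primitive_part P"
  show "?P' \<noteq> 0" using assms(1) by simp
  show "map_poly (\<lambda>p. poly p x) ?P' \<noteq> 0" for x
  proof
    assume "map_poly (\<lambda>p. poly p x) ?P' = 0"
    then have "coeff (map_poly (\<lambda>p. poly p x) ?P') i = 0" for i by simp
    then have "[:-x, 1:] dvd coeff ?P' i" for i by (simp add: coeff_map_poly poly_eq_0_iff_dvd)
    then have "[:-x, 1:] dvd content ?P'" by (simp add: const_poly_dvd_iff flip: const_poly_dvd_iff_dvd_content)
    then have "is_unit [:-x, 1:]" using assms(1) by simp
    then show False by (simp add: is_unit_poly_iff)
  qed
  have fin: "finite {x. poly (content P) x = 0}" using assms(1) by (intro poly_roots_finite) simp
  show "bpoly ?P' x (h x) = 0" if x: "x \<in> {c<..<d}" for x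
  proof -
    have "eventually (\<lambda>y. y \<notin> {x. poly (content P) x = 0}) (at x)"
      using fin islimpt_finite islimpt_iff_eventually by blast
    moreover have "eventually (\<lambda>y. y \<in> {c<..<d}) (at x)" using x by (intro eventually_at_in_open') auto
    ultimately have "eventually (\<lambda>y. bpoly ?P' y (h y) = 0) (at x)"
    proof eventually_elim
      case (elim y)
      have "poly (content P) y * bpoly ?P' y (h y) = bpoly (smult (content P) ?P') y (h y)"
        by (simp only: bpoly_simps)
      also have "\<dots> = 0" using assms(3)[OF elim(2)] by (simp only: content_times_primitive_part)
      finally show ?case using elim(1) by simp
    qed
    then have "((\<lambda>y. bpoly ?P' y (h y)) \<longlongrightarrow> 0) (at x)" by (simp add: tendsto_eventually)
    moreover have "continuous_on {c<..<d} (\<lambda>y. bpoly ?P' y (h y))" by (intro continuous_intros assms)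
    then have "((\<lambda>y. bpoly ?P' y (h y)) \<longlongrightarrow> bpoly ?P' x (h x)) (at x)"
      using x by (simp add: continuous_on_eq_continuous_at isCont_def)
    ultimately show ?thesis by (metis tendsto_unique at_neq_bot)
  qed
qed

text \<open>Writing P = E(y^2) + y O(y^2), take the norm E^2 - u O^2 with u = y^2.\<close>

lemma bpoly_square_relation:
  assumes "P \<noteq> 0"
  obtains S where "S \<noteq> 0" "\<And>x y. bpoly P x y = 0 \<Longrightarrow> bpoly S x (y\<^sup>2) = 0"
proof -
  have "\<exists>E Od. (\<forall>x y. bpoly P x y = bpoly E x (y\<^sup>2) + y * bpoly Od x (y\<^sup>2)) \<and> (E = 0 \<and> Od = 0 \<longrightarrow> P = 0)" for P
  proof (induction P)
    case 0
    then show ?case by (intro exI[of _ 0]) simp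
  next
    case (pCons c P)
    then obtain E Od where EO: "\<And>x y. bpoly P x y = bpoly E x (y\<^sup>2) + y * bpoly Od x (y\<^sup>2)"
      and z: "E = 0 \<and> Od = 0 \<longrightarrow> P = 0" by blast
    have "bpoly (pCons c P) x y = bpoly (pCons c Od) x (y\<^sup>2) + y * bpoly E x (y\<^sup>2)" for x y
      by (simp add: EO algebra_simps power2_eq_square)
    moreover have "pCons c Od = 0 \<and> E = 0 \<longrightarrow> pCons c P = 0" using z by auto
    ultimately show ?case by (intro exI[of _ "pCons c Od"] exI[of _ E]) blast
  qed
  then obtain E Od where EO: "\<And>x y. bpoly P x y = bpoly E x (y\<^sup>2) + y * bpoly Od x (y\<^sup>2)"
    and z: "\<not> (E = 0 \<and> Od = 0)" using assms by blast
  define S where "S = E * E - [:0, 1:] * (Od * Od)"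
  \<comment> \<open>In the outer variable u, the degree of E^2 is even and that of u Od^2 is
    odd.\<close>
  have "S \<noteq> 0"
  proof
    assume "S = 0"
    then have eq: "E * E = [:0, 1:] * (Od * Od)" by (simp add: S_def)
    show False
    proof (cases "Od = 0")
      case True
      then show ?thesis using eq z by simp
    next
      case False
      then have "E \<noteq> 0" using eq by auto
      have "degree (E * E) = degree E + degree E" using \<open>E \<noteq> 0\<close> by (simp add: degree_mult_eq)
      moreover have "degree ([:0, 1:] * (Od * Od)) = Suc (degree Od + degree Od)"
        using False by (subst degree_mult_eq) (auto simp: degree_mult_eq)
      ultimately have "degree E + degree E = Suc (degree Od + degree Od)" using eq by simp
      then show ?thesis by presburger
    qed
  qed
  moreover have "bpoly S x (y\<^sup>2) = 0" if "bpoly P x y = 0" for x y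
  proof -
    have "bpoly E x (y\<^sup>2) = - y * bpoly Od x (y\<^sup>2)" using that EO[of x y] by simp
    then show ?thesis by (simp add: S_def power2_eq_square algebra_simps)
  qed
  ultimately show ?thesis using that by blast
qed

lemma derivative_0_of_bigo_square:
  fixes k :: "real \<Rightarrow> real"
  assumes "(k has_real_derivative D) (at 0)" "(\<lambda>x. k x - k 0) \<in> O[at 0](\<lambda>x. x ^ 2)"
  shows "D = 0"
proof -
  have "((\<lambda>x. (k x - k 0) / x) \<longlongrightarrow> D) (at 0)" using assms(1) by (simp add: has_field_derivative_iff)
  moreover have "((\<lambda>x. (k x - k 0) / x) \<longlongrightarrow> 0) (at 0)"
  proof (rule bigo_power_tendsto_0[of _ 1])
    have "(\<lambda>x. (k x - k 0) / x) \<in> O[at 0](\<lambda>x. x ^ 2 / x)"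
      by (rule landau_o.big.divide_right[OF eventually_neq_at_within assms(2)])
    moreover have ev: "eventually (\<lambda>x::real. x ^ 2 / x = x ^ 1) (at 0)"
      by (intro eventually_mono[OF eventually_neq_at_within[of 0]]) (simp add: power2_eq_square)
    ultimately show "(\<lambda>x. (k x - k 0) / x) \<in> O[at 0](\<lambda>x. x ^ 1)" unfolding landau_o.big.cong[OF ev] by simp
  qed simp
  ultimately show ?thesis by (rule tendsto_unique[OF at_neq_bot])
qed

text \<open>g is the distance from the center as a function of the angle beyond a, and
  \<open>\<Phi>\<close> is its inverse on [0, R], where R = \<open>1 / sqrt pi\<close> is the radius
  of the disk; elsewhere \<open>\<Phi>\<close> is arbitrary. The spiral itself is
  \<open>twist_curve (\<lambda>\<rho>. a + \<Phi> \<rho>)\<close>.\<close>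

locale polar_spiral =
  fixes a :: real and g \<Phi> :: "real \<Rightarrow> real"
  assumes g_mono: "strict_mono_on {0..2 * pi} g" and g_cont: "continuous_on {0..2 * pi} g"
    and g_0: "g 0 = 0" and g_1: "g (2 * pi) = 1 / sqrt pi"
    and \<Phi>_g: "\<And>x. x \<in> {0..2 * pi} \<Longrightarrow> \<Phi> (g x) = x"
begin

lemma g_image: "g ` {0..2 * pi} = {0..1 / sqrt pi}"
proof
  show "g ` {0..2 * pi} \<subseteq> {0..1 / sqrt pi}"
  proof
    fix y assume "y \<in> g ` {0..2 * pi}"
    then obtain x where x: "x \<in> {0..2 * pi}" "y = g x" by blast
    have "g 0 \<le> g x" "g x \<le> g (2 * pi)"
      using x strict_mono_on_imp_mono_on[OF g_mono] by (auto simp: mono_on_def)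
    then show "y \<in> {0..1 / sqrt pi}" using x g_0 g_1 by simp
  qed
  show "{0..1 / sqrt pi} \<subseteq> g ` {0..2 * pi}"
    using IVT'[of g 0 _ "2 * pi"] g_cont g_0 g_1 by fastforce
qed

lemma \<Phi>_range: "\<rho> \<in> {0..1 / sqrt pi} \<Longrightarrow> \<Phi> \<rho> \<in> {0..2 * pi}" "\<rho> \<in> {0..1 / sqrt pi} \<Longrightarrow> g (\<Phi> \<rho>) = \<rho>"
  using \<Phi>_g by (auto simp flip: g_image)

lemma \<Phi>_cont: "continuous_on {0..1 / sqrt pi} \<Phi>"
  using continuous_on_inv[of "{0..2 * pi}" g \<Phi>] g_cont \<Phi>_g by (simp add: g_image)

lemma g_pos: "x \<in> {0<..2 * pi} \<Longrightarrow> g x > 0"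
  using strict_mono_onD[OF g_mono, of 0 x] g_0 by auto

lemma square_mono: "strict_mono_on {0..2 * pi} (\<lambda>x. (g x)\<^sup>2)"
proof (rule strict_mono_onI)
  fix x y assume xy: "x \<in> {0..2 * pi}" "y \<in> {0..2 * pi}" "x < y"
  have "0 \<le> g x" using xy g_image by force
  then show "(g x)\<^sup>2 < (g y)\<^sup>2" using strict_mono_onD[OF g_mono xy] by (simp add: power_strict_mono)
qed

lemma end_in_curve: "complex_of_real (1 / sqrt pi) * cis a \<in> twist_curve (\<lambda>\<rho>. a + \<Phi> \<rho>)"
proof -
  have "\<Phi> (1 / sqrt pi) = 2 * pi" using \<Phi>_g[of "2 * pi"] g_1 by simp
  moreover have "cmod (complex_of_real (1 / sqrt pi) * cis a) = 1 / sqrt pi" by (simp add: norm_mult norm_divide)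
  moreover have "complex_of_real (1 / sqrt pi) * cis a * cis (- (a + 2 * pi)) = complex_of_real (1 / sqrt pi)"
    by (simp only: mult.assoc cis_mult) (simp add: complex_eq_iff)
  ultimately have "Im (complex_of_real (1 / sqrt pi) * cis a
      * cis (- (a + \<Phi> (cmod (complex_of_real (1 / sqrt pi) * cis a))))) = 0"
    by (simp only: Im_complex_of_real)
  then show ?thesis
    unfolding twist_curve_def disk_def using \<open>cmod _ = _\<close> by (simp only: mem_Collect_eq mem_cball dist_0_norm order_refl)
qed

lemma zero_in_curve: "0 \<in> twist_curve \<Psi>"
  by (simp add: twist_curve_def disk_def)

text \<open>The algebraic curve in the (\<phi>, r)-plane is only some lift of the spiral. Take a
  path in it from above the outer end to above the center, cut at its first zero of r: along it
  \<open>\<theta> - a - \<Phi> \<bar>r\<bar>\<close> stays among the multiples of pi and is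
  therefore constant. So this piece is the graph of g up to a shift of the angle and the sign of r,
  and squaring r removes the sign.\<close>

lemma algebraic_relation:
  assumes "algebraic_in_polar (twist_curve (\<lambda>\<rho>. a + \<Phi> \<rho>))"
  obtains P where "P \<noteq> 0" "\<And>x. x \<in> {0<..<2 * pi} \<Longrightarrow> bpoly P x ((g x)\<^sup>2) = 0"
proof -
  let ?\<beta> = "twist_curve (\<lambda>\<rho>. a + \<Phi> \<rho>)" and ?R = "1 / sqrt pi"
  obtain C Q where \<beta>: "?\<beta> = polar ` C" and C: "curve C" and Q: "Q \<noteq> 0" "\<And>\<phi> r. (\<phi>, r) \<in> C \<Longrightarrow> bpoly Q \<phi> r = 0"
    using assms unfolding algebraic_in_polar_def algebraic_curve_def bpoly_def by fast
  obtain I :: "real set" and \<gamma> where I: "is_interval I" "continuous_on I \<gamma>" "C = \<gamma> ` I" using C unfolding curve_def by blast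
  obtain S where S: "S \<noteq> 0" "\<And>x y. bpoly Q x y = 0 \<Longrightarrow> bpoly S x (y\<^sup>2) = 0" using bpoly_square_relation[OF Q(1)] by metis
  have polar_eq: "polar (\<phi>, r) = complex_of_real r * cis \<phi>" for \<phi> r
    by (simp add: polar_def complex_eq_iff)
  obtain t1 where t1: "t1 \<in> I" "polar (\<gamma> t1) = complex_of_real ?R * cis a" using end_in_curve unfolding \<beta> I(3) by (auto simp: image_iff)
  obtain t3 where t3: "t3 \<in> I" "polar (\<gamma> t3) = 0" using zero_in_curve[of "\<lambda>\<rho>. a + \<Phi> \<rho>"] unfolding \<beta> I(3) by (auto simp: image_iff)
  define \<theta> where "\<theta> s = fst (\<gamma> (t1 + s * (t3 - t1)))" for s
  define r where "r s = snd (\<gamma> (t1 + s * (t3 - t1)))" for s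
  have inI: "t1 + s * (t3 - t1) \<in> I" if "s \<in> {0..1}" for s
  proof -
    have "t1 + s * (t3 - t1) = (1 - s) *\<^sub>R t1 + s *\<^sub>R t3" by (simp add: algebra_simps)
    then show ?thesis using convexD_alt[of I t1 t3 s] is_interval_convex[OF I(1)] t1 t3 that by auto
  qed
  have "continuous_on {0..1} (\<lambda>s. \<gamma> (t1 + s * (t3 - t1)))"
    by (rule continuous_on_compose2[OF I(2)]) (auto intro!: continuous_intros inI)
  then have c\<theta>: "continuous_on {0..1} \<theta>" and cr: "continuous_on {0..1} r"
    unfolding \<theta>_def r_def by (auto intro: continuous_on_fst continuous_on_snd)
  have mem: "complex_of_real (r s) * cis (\<theta> s) \<in> ?\<beta>" and kill: "bpoly Q (\<theta> s) (r s) = 0" if "s \<in> {0..1}" for s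
  proof -
    have "(\<theta> s, r s) \<in> C" unfolding I(3) \<theta>_def r_def using inI[OF that] by simp
    then show "bpoly Q (\<theta> s) (r s) = 0" "complex_of_real (r s) * cis (\<theta> s) \<in> ?\<beta>"
      using Q(2) \<beta> polar_eq by (auto intro!: image_eqI[of _ _ "(\<theta> s, r s)"])
  qed
  have norm_r: "cmod (polar (\<gamma> t)) = \<bar>snd (\<gamma> t)\<bar>" for t
    using polar_eq[of "fst (\<gamma> t)" "snd (\<gamma> t)"] by (simp add: norm_mult)
  have r0: "\<bar>r 0\<bar> = ?R" using norm_r[of t1] t1(2) by (simp add: r_def norm_mult norm_divide)
  have r1: "r 1 = 0" using norm_r[of t3] t3(2) by (simp add: r_def)
  have r_le: "\<bar>r s\<bar> \<in> {0..?R}" if "s \<in> {0..1}" for s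
    using mem[OF that] by (simp add: twist_curve_def disk_def norm_mult)
  \<comment> \<open>The path is cut at its first passage through the center, since at r = 0 the
    angle of the lift is unconstrained and may drift.\<close>
  define Z where "Z = {s \<in> {0..1}. r s = 0}"
  have "compact Z"
  proof -
    have "closedin (top_of_set {0..1}) Z" unfolding Z_def by (rule continuous_closedin_preimage_constant[OF cr])
    then show ?thesis by (rule closedin_compact[rotated]) simp
  qed
  moreover have "Z \<noteq> {}" using r1 by (auto simp: Z_def)
  ultimately obtain s4 where s4: "s4 \<in> Z" "\<And>s. s \<in> Z \<Longrightarrow> s4 \<le> s" using compact_attains_inf by metis
  have s4': "s4 \<in> {0..1}" "r s4 = 0" using s4(1) by (auto simp: Z_def)
  have "s4 \<noteq> 0" using r0 s4'(2) by auto
  then have s4pos: "0 < s4" using s4' by simp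
  have rne: "r s \<noteq> 0" if "s \<in> {0..<s4}" for s using s4(2)[of s] that s4' by (auto simp: Z_def)
  define k where "k s = (\<theta> s - a - \<Phi> \<bar>r s\<bar>) / pi" for s
  have kint: "k s \<in> \<int>" if s: "s \<in> {0..<s4}" for s
  proof -
    have "s \<in> {0..1}" using s s4' by auto
    from mem[OF this] have "Im (complex_of_real (r s) * cis (\<theta> s) * cis (- (a + \<Phi> \<bar>r s\<bar>))) = 0"
      by (simp add: twist_curve_def norm_mult)
    then have "sin (\<theta> s - a - \<Phi> \<bar>r s\<bar>) = 0" using rne[OF s] unfolding Im_rcis_cis by (simp add: algebra_simps)
    then obtain n :: int where "\<theta> s - a - \<Phi> \<bar>r s\<bar> = of_int n * pi" using sin_zero_iff_int2 by blast
    then show ?thesis by (simp add: k_def)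
  qed
  have "k constant_on {0..<s4}"
  proof (rule continuous_discrete_range_constant)
    show "connected {0..<s4}" by simp
    have "continuous_on {0..<s4} (\<lambda>s. \<Phi> \<bar>r s\<bar>)"
      by (rule continuous_on_compose2[OF \<Phi>_cont]) (use s4' r_le in \<open>auto intro!: continuous_intros continuous_on_subset[OF cr]\<close>)
    then show "continuous_on {0..<s4} k"
      unfolding k_def using s4' by (auto intro!: continuous_intros continuous_on_subset[OF c\<theta>])
    show "\<exists>e>0. \<forall>y. y \<in> {0..<s4} \<and> k y \<noteq> k x \<longrightarrow> e \<le> norm (k y - k x)" if "x \<in> {0..<s4}" for x
    proof (intro exI[of _ 1] conjI allI impI)
      fix y assume y: "y \<in> {0..<s4} \<and> k y \<noteq> k x"
      then have "k y - k x \<in> \<int>" "k y - k x \<noteq> 0" using kint that by auto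
      then show "1 \<le> norm (k y - k x)" using Ints_nonzero_abs_ge1[of "k y - k x"] by simp
    qed simp
  qed
  then obtain K where K: "\<And>s. s \<in> {0..<s4} \<Longrightarrow> k s = K" unfolding constant_on_def by blast
  show ?thesis
  proof
    show "bshift (a + K * pi) 0 S \<noteq> 0" using S(1) by (rule bshift_nonzero)
    fix x assume x: "x \<in> {0<..<2 * pi}"
    have gx: "0 < g x" "g x \<le> ?R" using g_pos[of x] x g_image by force+
    have "continuous_on {0..s4} (\<lambda>s. \<bar>r s\<bar>)" using s4' by (intro continuous_intros continuous_on_subset[OF cr]) auto
    then obtain s where s: "s \<in> {0..s4}" "\<bar>r s\<bar> = g x"
      using IVT2'[of "\<lambda>s. \<bar>r s\<bar>" s4 "g x" 0] r0 s4' gx s4pos by auto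
    then have "s \<noteq> s4" using gx s4' by auto
    then have s': "s \<in> {0..<s4}" using s by auto
    have "\<theta> s = x + (a + K * pi)" using K[OF s'] s(2) \<Phi>_g[of x] x by (simp add: k_def field_simps)
    moreover have "(r s)\<^sup>2 = (g x)\<^sup>2" using s(2) by (metis power2_abs)
    moreover have "bpoly S (\<theta> s) ((r s)\<^sup>2) = 0" by (intro S(2) kill) (use s s4' in auto)
    ultimately show "bpoly (bshift (a + K * pi) 0 S) x ((g x)\<^sup>2) = 0" by simp
  qed
qed

text \<open>Near the parameter t0 of a point of modulus g x0, the angle increment om is the
  arctangent of Im w / Re w with w = \<gamma> / z0, so it has an expansion, as has u = |\<gamma>|^2.
  If v is the derivative of w, then om and u have as derivatives Im v and a positive multiple of Re
  v, and v is nonzero because the curve is immersed.\<close>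

lemma smooth_expansion:
  assumes smooth: "infinitely_differentiable \<gamma>" and \<gamma>: "\<gamma> ` {0..1} = twist_curve (\<lambda>\<rho>. a + \<Phi> \<rho>)"
    and der: "\<And>t. t \<in> {0..1} \<Longrightarrow> vector_derivative \<gamma> (at t within {0..1}) \<noteq> 0"
    and alg: "P \<noteq> 0" "\<And>x. x \<in> {0<..<2 * pi} \<Longrightarrow> bpoly P x ((g x)\<^sup>2) = 0"
    and x0: "x0 \<in> {0<..<2 * pi}"
  shows "pexp (\<lambda>x. (g x)\<^sup>2) x0"
proof -
  let ?\<beta> = "twist_curve (\<lambda>\<rho>. a + \<Phi> \<rho>)" and ?R = "1 / sqrt pi"
  define h where "h x = (g x)\<^sup>2" for x
  obtain D where D0: "D 0 = \<gamma>" and D: "\<And>n t. t \<in> {0..1} \<Longrightarrow> (D n has_vector_derivative D (Suc n) t) (at t within {0..1})"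
    using smooth unfolding infinitely_differentiable_def by blast
  have \<gamma>c: "continuous_on {0..1} \<gamma>"
    using D[of _ 0] unfolding D0 by (intro continuous_on_vector_derivative) auto
  have Din: "(D n has_vector_derivative D (Suc n) t) (at t)" if "t \<in> {0<..<1}" for n t
    using D[of t n] that at_within_Icc_at[of 0 t 1] by simp
  have gx0: "0 < g x0" "g x0 < ?R"
    using g_pos[of x0] strict_mono_onD[OF g_mono, of x0 "2 * pi"] g_1 x0 by auto
  obtain t0 where t0: "t0 \<in> {0<..<1}" "cmod (\<gamma> t0) = g x0"
  proof -
    obtain t1 where t1: "t1 \<in> {0..1}" "\<gamma> t1 = complex_of_real ?R * cis a" using end_in_curve \<gamma> by (metis (no_types, lifting) imageE)
    obtain t3 where t3: "t3 \<in> {0..1}" "\<gamma> t3 = 0" using zero_in_curve \<gamma> by (metis (no_types, lifting) imageE)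
    have n1: "cmod (\<gamma> t1) = ?R" unfolding t1(2) by (simp add: norm_mult norm_divide)
    have "closed_segment t1 t3 \<subseteq> {0..1}" using t1 t3 by (auto simp: closed_segment_eq_real_ivl split: if_splits)
    then have "continuous_on (closed_segment t1 t3) (\<lambda>t. cmod (\<gamma> t))"
      by (intro continuous_intros continuous_on_subset[OF \<gamma>c])
    then have conn: "connected ((\<lambda>t. cmod (\<gamma> t)) ` closed_segment t1 t3)" by (rule connected_continuous_image) simp
    have "?R \<in> (\<lambda>t. cmod (\<gamma> t)) ` closed_segment t1 t3" "0 \<in> (\<lambda>t. cmod (\<gamma> t)) ` closed_segment t1 t3"
      using n1 t3 image_eqI[of ?R "\<lambda>t. cmod (\<gamma> t)" t1] image_eqI[of 0 "\<lambda>t. cmod (\<gamma> t)" t3] by simp_all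
    then have "g x0 \<in> (\<lambda>t. cmod (\<gamma> t)) ` closed_segment t1 t3" using connectedD_interval[OF conn, of 0 ?R] gx0 by auto
    then obtain t where t: "t \<in> closed_segment t1 t3" "cmod (\<gamma> t) = g x0" by auto
    \<comment> \<open>The bounds 0 < g x0 < R keep t strictly between t1 and t3, hence away from 0
      and 1, where derivatives are one-sided.\<close>
    have "t \<noteq> t1" "t \<noteq> t3" using t(2) n1 t3 gx0 by auto
    then have "t \<in> {0<..<1}" using t(1) t1 t3 by (auto simp: closed_segment_eq_real_ivl split: if_splits)
    then show ?thesis using that t(2) by blast
  qed
  define z0 where "z0 = \<gamma> t0"
  have z0: "z0 \<noteq> 0" "cmod z0 = g x0" using t0 gx0 by (auto simp: z0_def)
  define \<delta>0 where "\<delta>0 = min t0 (1 - t0)"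
  have \<delta>0: "\<delta>0 > 0" "\<And>x. \<bar>x\<bar> < \<delta>0 \<Longrightarrow> t0 + x \<in> {0<..<1}" using t0(1) by (auto simp: \<delta>0_def)
  define w where "w x = \<gamma> (t0 + x) / z0" for x
  define om where "om x = \<Phi> (cmod (\<gamma> (t0 + x))) - x0" for x
  define u where "u x = (cmod (\<gamma> (t0 + x)))\<^sup>2" for x
  have in\<beta>: "\<gamma> t \<in> ?\<beta>" if "t \<in> {0..1}" for t using \<gamma> that by blast
  have nrm: "cmod (\<gamma> t) \<in> {0..?R}" if "t \<in> {0..1}" for t
    using in\<beta>[OF that] by (simp add: twist_curve_def disk_def)
  have \<Phi>x0: "\<Phi> (g x0) = x0" using \<Phi>_g[of x0] x0 by simp
  have om0: "om 0 = 0" by (simp add: om_def t0(2) \<Phi>x0)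
  have w0: "w 0 = 1" using z0 by (simp add: w_def z0_def)
  have shift_cont: "continuous_on {-\<delta>0<..<\<delta>0} (\<lambda>x. \<gamma> (t0 + x))"
    by (rule continuous_on_compose2[OF \<gamma>c]) (use \<delta>0(2) in \<open>auto intro!: continuous_intros simp: abs_less_iff less_imp_le\<close>)
  have omc: "continuous_on {-\<delta>0<..<\<delta>0} om"
    unfolding om_def
    by (intro continuous_intros continuous_on_compose2[OF \<Phi>_cont] shift_cont)
      (use \<delta>0(2) nrm in \<open>force simp: abs_less_iff\<close>)+
  have wc: "continuous_on {-\<delta>0<..<\<delta>0} w" unfolding w_def using z0 by (intro continuous_intros shift_cont) auto
  have "isCont om 0" "isCont w 0"
    using omc wc \<delta>0(1) by (auto simp: continuous_on_eq_continuous_at)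
  then have om_lim: "(om \<longlongrightarrow> 0) (at 0)" and w_lim: "(w \<longlongrightarrow> 1) (at 0)" using om0 w0 by (auto simp: isCont_def)
  \<comment> \<open>Within pi / 2 the arctangent recovers the angle; the other bound keeps x0 + om
    inside (0, 2 pi), where the polynomial relation holds.\<close>
  define e where "e = min (pi / 2) (min x0 (2 * pi - x0))"
  have e: "e > 0" using x0 by (simp add: e_def)
  have "((\<lambda>x. Re (w x)) \<longlongrightarrow> Re 1) (at 0)" by (intro tendsto_Re w_lim)
  then have "eventually (\<lambda>x. Re (w x) > 0) (at 0)" by (intro order_tendstoD(1)[of _ "Re 1"]) auto
  moreover have "eventually (\<lambda>x. \<bar>om x\<bar> < e) (at 0)" using order_tendstoD(2)[OF tendsto_rabs_zero[OF om_lim] e] .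
  ultimately have "eventually (\<lambda>x. Re (w x) > 0 \<and> \<bar>om x\<bar> < e) (at 0)" by eventually_elim blast
  then obtain \<delta>1 where \<delta>1: "\<delta>1 > 0" "\<And>x. x \<noteq> 0 \<Longrightarrow> \<bar>x\<bar> < \<delta>1 \<Longrightarrow> Re (w x) > 0 \<and> \<bar>om x\<bar> < e"
    unfolding eventually_at dist_real_def by auto
  have \<delta>1': "Re (w x) > 0 \<and> \<bar>om x\<bar> < e" if "\<bar>x\<bar> < \<delta>1" for x
    using \<delta>1(2)[of x] that w0 om0 e by (cases "x = 0") auto
  define \<delta> where "\<delta> = min \<delta>0 \<delta>1 / 2"
  have \<delta>: "\<delta> > 0" "\<delta> < \<delta>0" "\<delta> < \<delta>1" using \<delta>0 \<delta>1 by (auto simp: \<delta>_def)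
  have rng: "\<bar>x\<bar> < \<delta>0 \<and> \<bar>x\<bar> < \<delta>1" if "x \<in> {-\<delta>..\<delta>}" for x using that \<delta> by auto
  have u_h: "u x = h (x0 + om x)" if "x \<in> {-\<delta>..\<delta>}" for x
  proof -
    have "t0 + x \<in> {0..1}" using \<delta>0(2)[of x] rng[OF that] by auto
    from \<Phi>_range(2)[OF nrm[OF this]] show ?thesis by (simp add: u_def h_def om_def)
  qed
  \<comment> \<open>Both \<open>\<gamma> (t0 + x)\<close> and z0 become real when turned back by
    their angles on the curve. So does their quotient, and this is w turned back by om.\<close>
  have om_arctan: "om x = arctan (Im (w x) / Re (w x))" if "\<bar>x\<bar> < \<delta>0" "\<bar>x\<bar> < \<delta>1" for x
  proof -
    have t: "t0 + x \<in> {0..1}" using \<delta>0(2)[OF that(1)] by auto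
    have A: "Im (\<gamma> (t0 + x) * cis (- (a + \<Phi> (cmod (\<gamma> (t0 + x)))))) = 0" using in\<beta>[OF t] by (simp add: twist_curve_def)
    have B: "Im (z0 * cis (- (a + x0))) = 0" using in\<beta>[of t0] t0 \<Phi>x0 by (simp add: twist_curve_def z0_def)
    have "w x * cis (- om x) = (\<gamma> (t0 + x) * cis (- (a + \<Phi> (cmod (\<gamma> (t0 + x)))))) / (z0 * cis (- (a + x0)))"
    proof -
      have "cis (- om x) = cis (- (a + \<Phi> (cmod (\<gamma> (t0 + x))))) / cis (- (a + x0))"
        by (simp add: cis_divide om_def algebra_simps)
      then show ?thesis by (simp add: w_def)
    qed
    moreover have "Im (p / q) = 0" if "Im p = 0" "Im q = 0" for p q using that by (simp add: Im_divide)
    ultimately have "Im (w x * cis (- om x)) = 0" using A B by simp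
    then have "Im (w x) * cos (om x) = Re (w x) * sin (om x)" by simp
    moreover have "\<bar>om x\<bar> < pi / 2" and re: "Re (w x) > 0" using \<delta>1'[OF that(2)] by (auto simp: e_def)
    then have "cos (om x) > 0" by (intro cos_gt_zero_pi) auto
    ultimately have "tan (om x) = Im (w x) / Re (w x)" using re by (simp add: tan_def field_simps)
    then show ?thesis using \<open>\<bar>om x\<bar> < pi / 2\<close> by (metis abs_less_iff arctan_tan minus_less_iff)
  qed
  have ev\<delta>: "eventually (\<lambda>x. \<bar>x\<bar> < \<delta>0 \<and> \<bar>x\<bar> < \<delta>1) (at 0)"
    using \<delta> by (auto simp: eventually_at dist_real_def intro!: exI[of _ \<delta>])
  have tRe: "texp (\<lambda>x. Re (\<gamma> (t0 + x)))" and tIm: "texp (\<lambda>x. Im (\<gamma> (t0 + x)))"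
  proof -
    have "((\<lambda>t. Re (D n t)) has_real_derivative Re (D (Suc n) t)) (at t)"
      "((\<lambda>t. Im (D n t)) has_real_derivative Im (D (Suc n) t)) (at t)" if "\<bar>t - t0\<bar> < \<delta>0" for n t
      using Din[of t n] \<delta>0(2)[of "t - t0"] that
      by (auto simp: has_real_derivative_iff_has_vector_derivative
          intro: bounded_linear.has_vector_derivative[OF bounded_linear_Re] bounded_linear.has_vector_derivative[OF bounded_linear_Im])
    from texp_Taylor[of \<delta>0 t0 "\<lambda>n t. Re (D n t)", OF \<delta>0(1) this(1)] texp_Taylor[of \<delta>0 t0 "\<lambda>n t. Im (D n t)", OF \<delta>0(1) this(2)]
    show "texp (\<lambda>x. Re (\<gamma> (t0 + x)))" "texp (\<lambda>x. Im (\<gamma> (t0 + x)))" by (simp_all add: D0)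
  qed
  have tu: "texp u"
  proof -
    have "texp (\<lambda>x. (Re (\<gamma> (t0 + x)))\<^sup>2 + (Im (\<gamma> (t0 + x)))\<^sup>2)" by (intro texp_add texp_power tRe tIm)
    then show ?thesis by (simp add: u_def[abs_def] cmod_power2)
  qed
  have tw: "texp (\<lambda>x. Re (w x))" "texp (\<lambda>x. Im (w x))"
  proof -
    have "w x = \<gamma> (t0 + x) * inverse z0" for x by (simp add: w_def divide_inverse)
    then have eqs: "(\<lambda>x. Re (w x)) = (\<lambda>x. Re (\<gamma> (t0 + x)) * Re (inverse z0) - Im (\<gamma> (t0 + x)) * Im (inverse z0))"
      "(\<lambda>x. Im (w x)) = (\<lambda>x. Re (\<gamma> (t0 + x)) * Im (inverse z0) + Im (\<gamma> (t0 + x)) * Re (inverse z0))"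
      by (auto simp: fun_eq_iff)
    show "texp (\<lambda>x. Re (w x))" unfolding eqs by (intro texp_diff texp_mult texp_const tRe tIm)
    show "texp (\<lambda>x. Im (w x))" unfolding eqs by (intro texp_add texp_mult texp_const tRe tIm)
  qed
  have tom: "texp om"
  proof -
    have "texp (\<lambda>x. Im (w x) * inverse (Re (w x)))"
      using \<open>((\<lambda>x. Re (w x)) \<longlongrightarrow> Re 1) (at 0)\<close> by (intro texp_mult texp_inverse[of _ 1] tw) auto
    moreover have "((\<lambda>x. Im (w x) * inverse (Re (w x))) \<longlongrightarrow> Im 1 * inverse (Re 1)) (at 0)"
      by (intro tendsto_intros w_lim) auto
    ultimately have "texp (\<lambda>x. arctan (Im (w x) * inverse (Re (w x))))"
      by (intro texp_compose_isCont[OF texp_arctan] isCont_arctan) auto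
    then show ?thesis
      by (rule texp_cong) (use ev\<delta> in eventually_elim, simp add: om_arctan divide_inverse)
  qed
  define v where "v = D 1 t0 / z0"
  have v0: "v \<noteq> 0"
  proof -
    have "vector_derivative \<gamma> (at t0 within {0..1}) = D 1 t0"
      using D[of t0 0] t0(1) D0 by (intro vector_derivative_within_cbox[of 0 1, simplified]) auto
    then show ?thesis using der[of t0] t0(1) z0 by (simp add: v_def)
  qed
  have w_der: "(w has_vector_derivative v) (at 0)"
  proof -
    have "(\<gamma> has_vector_derivative D 1 t0) (at (t0 + 0))" using Din[OF t0(1), of 0] D0 by simp
    moreover have "((\<lambda>x. t0 + x) has_vector_derivative 1) (at 0)" by (auto intro!: derivative_eq_intros)
    ultimately have "((\<lambda>x. \<gamma> (t0 + x)) has_vector_derivative D 1 t0) (at 0)"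
      using vector_diff_chain_at[of "\<lambda>x. t0 + x" 1 0 \<gamma> "D 1 t0"] by (simp add: o_def)
    from has_vector_derivative_mult_left[OF this, of "inverse z0"] show ?thesis
      by (simp add: w_def[abs_def] v_def divide_inverse)
  qed
  have wRe_der: "((\<lambda>x. Re (w x)) has_real_derivative Re v) (at 0)" and wIm_der: "((\<lambda>x. Im (w x)) has_real_derivative Im v) (at 0)"
    using w_der by (auto simp: has_real_derivative_iff_has_vector_derivative
        intro: bounded_linear.has_vector_derivative[OF bounded_linear_Re] bounded_linear.has_vector_derivative[OF bounded_linear_Im])
  have om_der: "(om has_real_derivative Im v) (at 0)"
  proof -
    have "((\<lambda>x. arctan (Im (w x) / Re (w x))) has_real_derivative Im v) (at 0)"
      by (rule derivative_eq_intros wRe_der wIm_der refl | simp add: w0)+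
    moreover have "eventually (\<lambda>x. om x = arctan (Im (w x) / Re (w x))) (nhds 0)"
      using \<delta> om_arctan by (auto simp: eventually_nhds_metric dist_real_def intro!: exI[of _ \<delta>])
    ultimately show ?thesis by (subst DERIV_cong_ev[OF refl _ refl]) auto
  qed
  have u_der: "(u has_real_derivative 2 * (cmod z0)\<^sup>2 * Re v) (at 0)"
  proof -
    have "u = (\<lambda>x. (cmod z0)\<^sup>2 * ((Re (w x))\<^sup>2 + (Im (w x))\<^sup>2))"
      using z0 by (auto simp: u_def w_def fun_eq_iff norm_divide power_divide simp flip: cmod_power2)
    moreover have "((\<lambda>x. (cmod z0)\<^sup>2 * ((Re (w x))\<^sup>2 + (Im (w x))\<^sup>2)) has_real_derivative 2 * (cmod z0)\<^sup>2 * Re v) (at 0)"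
      by (rule derivative_eq_intros wRe_der wIm_der refl | simp add: w0)+
    ultimately show ?thesis by simp
  qed
  have u0: "u 0 = h x0" using u_h[of 0] om0 \<delta> by simp
  have imm: "om \<notin> O[at 0](\<lambda>x. x ^ 2) \<or> (\<lambda>x. u x - h x0) \<notin> O[at 0](\<lambda>x. x ^ 2)"
  proof (rule ccontr)
    assume "\<not> ?thesis"
    then have "Im v = 0" "2 * (cmod z0)\<^sup>2 * Re v = 0"
      using derivative_0_of_bigo_square[OF om_der] derivative_0_of_bigo_square[OF u_der] om0 u0 by auto
    then show False using v0 z0 by (auto simp: complex_eq_iff)
  qed
  have u_lim: "(u \<longlongrightarrow> h x0) (at 0)" using DERIV_isCont[OF u_der] u0 by (simp add: isCont_def)
  have hc: "continuous_on {0<..<2 * pi} h" unfolding h_def by (intro continuous_intros continuous_on_subset[OF g_cont]) auto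
  \<comment> \<open>Smoothness alone does not exclude a flat om. But then P' (x0 + om, u) = 0 would
    make P' (x0, u) flat, though P' (x0, y) is a nonzero polynomial in y. This forces Re v = 0, and
    flatness gives Im v = 0, against v being nonzero.\<close>
  obtain N where nonflat: "om \<notin> O[at 0](\<lambda>x. x ^ N)"
  proof (rule ccontr)
    assume "\<not> thesis"
    then have flat: "om \<in> O[at 0](\<lambda>x. x ^ N)" for N using that by blast
    obtain P' where P': "\<And>x. map_poly (\<lambda>p. poly p x) P' \<noteq> 0" "\<And>x. x \<in> {0<..<2 * pi} \<Longrightarrow> bpoly P' x (h x) = 0"
      using bpoly_primitive[OF alg(1) hc] alg(2) unfolding h_def by metis
    obtain T where T: "\<And>x y. bpoly P' (x0 + x) y - bpoly P' x0 y = x * bpoly T x y"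
      using bpoly_diff_factor[of P' x0] by blast
    define Q where "Q = map_poly (\<lambda>p. poly p x0) P'"
    have Q: "poly Q y = bpoly P' x0 y" for y by (simp add: Q_def bpoly_altdef)
    obtain Q1 where Q1: "Q = [:- h x0, 1:] ^ order (h x0) Q * Q1" "\<not> [:- h x0, 1:] dvd Q1"
      using order_decomp[of Q "h x0"] P'(1)[of x0] by (auto simp: Q_def)
    define k where "k = order (h x0) Q"
    have Qk: "poly Q y = (y - h x0) ^ k * poly Q1 y" for y
      by (subst Q1(1)) (simp add: k_def poly_power algebra_simps)
    have Q1ne: "poly Q1 (h x0) \<noteq> 0" using Q1(2) by (simp add: poly_eq_0_iff_dvd)
    \<comment> \<open>With k the multiplicity of the root h x0, the quotient of P' (x0, u) by x^k
      tends to a nonzero multiple of the k-th power of the derivative of u, whereas flatness makes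
      it tend to 0.\<close>
    have "((\<lambda>x. (u x - h x0) / x) \<longlongrightarrow> 2 * (cmod z0)\<^sup>2 * Re v) (at 0)"
      using u_der u0 by (simp add: has_field_derivative_iff)
    then have "((\<lambda>x. ((u x - h x0) / x) ^ k * poly Q1 (u x)) \<longlongrightarrow> (2 * (cmod z0)\<^sup>2 * Re v) ^ k * poly Q1 (h x0)) (at 0)"
      by (intro tendsto_intros u_lim)
    moreover have "eventually (\<lambda>x. ((u x - h x0) / x) ^ k * poly Q1 (u x) = poly Q (u x) / x ^ k) (at 0)"
      by (auto simp: Qk power_divide)
    ultimately have lim1: "((\<lambda>x. poly Q (u x) / x ^ k) \<longlongrightarrow> (2 * (cmod z0)\<^sup>2 * Re v) ^ k * poly Q1 (h x0)) (at 0)"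
      by (rule Lim_transform_eventually)
    have "(\<lambda>x. om x * bpoly T (om x) (u x)) \<in> O[at 0](\<lambda>x. x ^ (k + 1) * 1)"
      by (intro landau_o.big.mult flat texp_bigo_1 texp_bpoly tom tu)
    moreover have ev: "eventually (\<lambda>x. om x * bpoly T (om x) (u x) = - poly Q (u x)) (at 0)"
    proof -
      have "om x * bpoly T (om x) (u x) = - poly Q (u x)" if "x \<in> {-\<delta>..\<delta>}" for x
      proof -
        have "x0 + om x \<in> {0<..<2 * pi}" using \<delta>1'[of x] rng[OF that] by (auto simp: e_def)
        then have "bpoly P' (x0 + om x) (u x) = 0" using P'(2) u_h[OF that] by simp
        then show ?thesis using T[of "om x" "u x"] by (simp add: Q)
      qed
      moreover have "eventually (\<lambda>x. x \<in> {-\<delta>..\<delta>}) (at 0)"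
        using \<delta> by (auto simp: eventually_at dist_real_def intro!: exI[of _ \<delta>])
      ultimately show ?thesis by (auto elim: eventually_mono)
    qed
    ultimately have "(\<lambda>x. - poly Q (u x)) \<in> O[at 0](\<lambda>x. x ^ (k + 1))" unfolding landau_o.big.in_cong[OF ev] by simp
    then have QO: "(\<lambda>x. poly Q (u x)) \<in> O[at 0](\<lambda>x. x ^ (k + 1))" by simp
    have "((\<lambda>x. poly Q (u x) / x ^ k) \<longlongrightarrow> 0) (at 0)"
    proof (rule bigo_power_tendsto_0[of _ 1])
      have "(\<lambda>x. poly Q (u x) / x ^ k) \<in> O[at 0](\<lambda>x. x ^ (k + 1) / x ^ k)"
        by (rule landau_o.big.divide_right[OF _ QO], rule eventually_mono[OF eventually_neq_at_within[of 0]]) simp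
      moreover have ev: "eventually (\<lambda>x::real. x ^ (k + 1) / x ^ k = x ^ 1) (at 0)"
        by (intro eventually_mono[OF eventually_neq_at_within[of 0]]) simp
      ultimately show "(\<lambda>x. poly Q (u x) / x ^ k) \<in> O[at 0](\<lambda>x. x ^ 1)" unfolding landau_o.big.cong[OF ev] by simp
    qed simp
    then have "(2 * (cmod z0)\<^sup>2 * Re v) ^ k * poly Q1 (h x0) = 0" using tendsto_unique[OF at_neq_bot lim1] by blast
    then have "Re v = 0" using Q1ne z0 by auto
    moreover have "Im v = 0" using derivative_0_of_bigo_square[OF om_der] flat[of 2] om0 by simp
    ultimately show False using v0 by (simp add: complex_eq_iff)
  qed
  have "pexp h x0"
  proof (rule pexp_of_parametrization[OF \<delta>(1) tom om0 _ tu u_lim u_h _ _ _ nonflat imm])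
    show "continuous_on {-\<delta>..\<delta>} om" by (rule continuous_on_subset[OF omc]) (use \<delta> in auto)
    show "strict_mono_on {0..2 * pi} h" unfolding h_def by (rule square_mono)
    show "x0 \<in> {0..2 * pi}" using x0 by auto
    show "x0 + om x \<in> {0..2 * pi}" if "x \<in> {-\<delta>..\<delta>}" for x
      using \<delta>1'[of x] rng[OF that] by (auto simp: e_def)
  qed
  then show ?thesis by (simp add: h_def[abs_def])
qed

end

section \<open>Isometries and components\<close>

text \<open>The images of the antipodes p and -p are at distance 2 r inside the disk of radius r, so
  by the parallelogram law they are antipodal; the image of 0, at distance r from both, is their
  midpoint.\<close>

lemma isometry_fixes_center:
  assumes s: "plane_isometry s" and p: "cmod p = r" and "cmod (s p) \<le> r" "cmod (s (- p)) \<le> r"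
  shows "s 0 = 0"
proof -
  have par: "(cmod (x + y))\<^sup>2 + (cmod (x - y))\<^sup>2 = 2 * (cmod x)\<^sup>2 + 2 * (cmod y)\<^sup>2" for x y
    unfolding cmod_power2 by (simp add: power2_eq_square algebra_simps)
  have d: "cmod (s x - s y) = cmod (x - y)" for x y using s by (simp add: plane_isometry_def dist_norm)
  have "r \<ge> 0" using p by auto
  have two: "cmod (s p - s (- p)) = 2 * r" using d[of p "- p"] p norm_mult[of 2 p] by simp
  have "(cmod (s p))\<^sup>2 \<le> r\<^sup>2" "(cmod (s (- p)))\<^sup>2 \<le> r\<^sup>2" using assms by (auto intro: power_mono)
  moreover have "(cmod (s p - s (- p)))\<^sup>2 = 4 * r\<^sup>2" by (simp add: two power_mult_distrib)
  ultimately have "(cmod (s p + s (- p)))\<^sup>2 \<le> 0" using par[of "s p" "s (- p)"] by linarith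
  then have op: "s (- p) = - s p" by (simp add: add_eq_0_iff)
  have "cmod (s p) = r" using two unfolding op using norm_mult[of 2 "s p"] by simp
  moreover have "cmod (s 0 - s p) = r" "cmod (s 0 + s p) = r" using d[of 0 p] d[of 0 "- p"] p op by auto
  ultimately have "2 * (cmod (s 0))\<^sup>2 = 0" using par[of "s 0" "s p"] by simp
  then show ?thesis by simp
qed

text \<open>After a rotation that makes 1 a fixed point, inner products with 1 and with i show that
  real parts are kept and imaginary parts are kept up to one common sign.\<close>

lemma isometry_fixing_0_cases:
  assumes s: "plane_isometry s" "s 0 = 0"
  obtains c where "\<And>z. s z = cis c * z" | c where "\<And>z. s z = cis c * cnj z"
proof -
  have d: "cmod (s x - s y) = cmod (x - y)" for x y using s by (simp add: plane_isometry_def dist_norm)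
  have n: "cmod (s x) = cmod x" for x using d[of x 0] s(2) by simp
  obtain c where c: "s 1 = cis c"
  proof
    have "cmod (s 1) = 1" using n[of 1] by simp
    then show "s 1 = cis (Arg (s 1))" by (subst cis_Arg) (auto simp: sgn_eq)
  qed
  define t where "t z = cis (- c) * s z" for z
  have st: "s z = cis c * t z" for z by (simp add: t_def cis_mult flip: mult.assoc)
  have td: "cmod (t x - t y) = cmod (x - y)" for x y
    using d[of x y] by (simp add: t_def norm_mult flip: right_diff_distrib)
  have tn: "cmod (t x) = cmod x" for x using n by (simp add: t_def norm_mult)
  have t1: "t 1 = 1" by (simp add: t_def c cis_mult)
  have sq: "(cmod (x - y))\<^sup>2 = (cmod x)\<^sup>2 + (cmod y)\<^sup>2 - 2 * (Re x * Re y + Im x * Im y)" for x y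
    unfolding cmod_power2 by (simp add: power2_eq_square algebra_simps)
  have inner: "Re (t x) * Re (t y) + Im (t x) * Im (t y) = Re x * Re y + Im x * Im y" for x y
    using sq[of "t x" "t y"] sq[of x y] by (simp add: td tn)
  have re: "Re (t z) = Re z" for z using inner[of z 1] t1 by simp
  have im2: "(Im (t \<i>))\<^sup>2 = 1" using inner[of \<i> \<i>] re[of \<i>] by (simp add: power2_eq_square)
  have im: "Im (t z) * Im (t \<i>) = Im z" for z using inner[of z \<i>] re[of \<i>] by simp
  show ?thesis
  proof (cases "Im (t \<i>) = 1")
    case True
    then have "t z = z" for z using re im[of z] by (simp add: complex_eq_iff)
    then show ?thesis using that(1)[of c] st by simp
  next
    case False
    then have "Im (t \<i>) = -1" using im2 by (auto simp: power2_eq_1_iff)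
    then have "t z = cnj z" for z using re im[of z] by (simp add: complex_eq_iff)
    then show ?thesis using that(2)[of c] st by simp
  qed
qed

section \<open>The two parts into which a twisted diameter splits the disk\<close>

lemma components_two_open:
  fixes A B :: "'a::topological_space set"
  assumes conn: "connected A" "connected B" and ne: "A \<noteq> {}" "B \<noteq> {}" and disj: "A \<inter> B = {}"
    and op: "openin (top_of_set (A \<union> B)) A" "openin (top_of_set (A \<union> B)) B"
  shows "components (A \<union> B) = {A, B}"
proof -
  have comp: "X \<in> components (X \<union> Y)"
    if "connected X" "X \<noteq> {}" "X \<inter> Y = {}" "openin (top_of_set (X \<union> Y)) X" "openin (top_of_set (X \<union> Y)) Y"
    for X Y :: "'a set"
    unfolding in_components_maximal
  proof (intro conjI allI impI that(1,2))
    fix D assume D: "D \<noteq> {} \<and> X \<subseteq> D \<and> D \<subseteq> X \<union> Y \<and> connected D"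
    have "openin (top_of_set D) (D \<inter> X)" "openin (top_of_set D) (D \<inter> Y)"
    proof -
      have "openin (top_of_set D) (D \<inter> Z)" if Z: "openin (top_of_set (X \<union> Y)) Z" for Z
      proof -
        obtain T where "open T" "Z = (X \<union> Y) \<inter> T" using Z by (auto simp: openin_open)
        then show ?thesis using D by (auto simp: openin_open intro!: exI[of _ T])
      qed
      then show "openin (top_of_set D) (D \<inter> X)" "openin (top_of_set D) (D \<inter> Y)" using that(4,5) by auto
    qed
    moreover have "D \<subseteq> (D \<inter> X) \<union> (D \<inter> Y)" "(D \<inter> X) \<inter> (D \<inter> Y) = {}" using D that(3) by auto
    ultimately have "D \<inter> X = {} \<or> D \<inter> Y = {}" using D unfolding connected_openin by blast
    then show "D = X" using D that(2) by blast
  qed simp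
  have "A \<in> components (A \<union> B)" by (rule comp) (use assms in auto)
  moreover have "B \<in> components (A \<union> B)" using comp[of B A] assms by (simp add: Un_commute Int_commute)
  moreover have "C = A \<or> C = B" if C: "C \<in> components (A \<union> B)" for C
  proof -
    obtain x where x: "x \<in> C" using in_components_nonempty[OF C] by blast
    then have "x \<in> A \<or> x \<in> B" using in_components_subset[OF C] by blast
    then show ?thesis using x C calculation components_nonoverlap[OF C] by blast
  qed
  ultimately show ?thesis by blast
qed

text \<open>On each circle around the center an open half circle, with arguments from \<Psi> to
  \<Psi> + pi. Adding pi to \<Psi> gives the antipodal half.\<close>

definition twist_half :: "(real \<Rightarrow> real) \<Rightarrow> complex set" where
  "twist_half \<Psi> = {z \<in> disk. Im (z * cis (- \<Psi> (cmod z))) > 0}"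

lemma twist_half_add_pi: "twist_half (\<lambda>\<rho>. \<Psi> \<rho> + pi) = {z \<in> disk. Im (z * cis (- \<Psi> (cmod z))) < 0}"
proof -
  have "cis (- (t + pi)) = - cis (- t)" for t by (simp add: complex_eq_iff)
  then show ?thesis by (simp add: twist_half_def)
qed

lemma uminus_twist_half: "uminus ` twist_half \<Psi> = twist_half (\<lambda>\<rho>. \<Psi> \<rho> + pi)"
  unfolding twist_half_add_pi
proof (intro equalityI subsetI)
  fix z assume "z \<in> uminus ` twist_half \<Psi>"
  then show "z \<in> {z \<in> disk. Im (z * cis (- \<Psi> (cmod z))) < 0}" by (auto simp: twist_half_def disk_def)
next
  fix z assume "z \<in> {z \<in> disk. Im (z * cis (- \<Psi> (cmod z))) < 0}"
  then have "- z \<in> twist_half \<Psi>" by (auto simp: twist_half_def disk_def)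
  then show "z \<in> uminus ` twist_half \<Psi>" by (metis image_eqI minus_minus)
qed

lemma continuous_on_Im_twist:
  assumes "continuous_on {0<..1 / sqrt pi} \<Psi>"
  shows "continuous_on (disk - {0}) (\<lambda>z. Im (z * cis (- \<Psi> (cmod z))))"
proof -
  have "continuous_on (disk - {0}) (\<lambda>z. \<Psi> (cmod z))"
    by (rule continuous_on_compose2[OF assms]) (auto simp: disk_def intro!: continuous_intros)
  then show ?thesis by (intro continuous_intros continuous_on_cis) auto
qed

text \<open>In polar coordinates with the angle measured from the curve, the half becomes a
  rectangle.\<close>

lemma connected_twist_half:
  assumes \<Psi>: "continuous_on {0<..1 / sqrt pi} \<Psi>"
  shows "connected (twist_half \<Psi>)" "twist_half \<Psi> \<noteq> {}"
proof -
  let ?Q = "{0<..1 / sqrt pi} \<times> {0<..<pi}"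
  let ?f = "\<lambda>(\<rho>, \<theta>). complex_of_real \<rho> * cis (\<theta> + \<Psi> \<rho>)"
  have img: "twist_half \<Psi> = ?f ` ?Q"
  proof (intro equalityI subsetI)
    fix z assume z: "z \<in> twist_half \<Psi>"
    define w where "w = z * cis (- \<Psi> (cmod z))"
    have "Im w > 0" using z by (simp add: twist_half_def w_def)
    then have w0: "w \<noteq> 0" and arg: "0 < Arg w" "Arg w < pi" using Arg_lt_pi[of w] by auto
    have cw: "cmod w = cmod z" by (simp add: w_def norm_mult)
    have "z = w * cis (\<Psi> (cmod z))" by (simp add: w_def mult.assoc cis_mult)
    also have "w = complex_of_real (cmod z) * cis (Arg w)"
      using Arg_eq[OF w0] by (simp add: cw cis_conv_exp)
    finally have "z = complex_of_real (cmod z) * cis (Arg w + \<Psi> (cmod z))"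
      by (simp add: mult.assoc cis_mult)
    moreover have "cmod z \<in> {0<..1 / sqrt pi}" using z cw w0 by (auto simp: twist_half_def disk_def)
    ultimately show "z \<in> ?f ` ?Q" using arg by (intro image_eqI[of _ _ "(cmod z, Arg w)"]) auto
  next
    fix z assume "z \<in> ?f ` ?Q"
    then obtain \<rho> \<theta> where z: "z = complex_of_real \<rho> * cis (\<theta> + \<Psi> \<rho>)" and r: "0 < \<rho>" "\<rho> \<le> 1 / sqrt pi" "0 < \<theta>" "\<theta> < pi"
      by auto
    have n: "cmod z = \<rho>" using r by (simp add: z norm_mult)
    have "Im (z * cis (- \<Psi> (cmod z))) = \<rho> * sin \<theta>" unfolding n unfolding z Im_rcis_cis by simp
    also have "\<dots> > 0" using r sin_gt_zero by simp
    finally show "z \<in> twist_half \<Psi>" unfolding twist_half_def disk_def using n r by (simp only: mem_Collect_eq mem_cball dist_0_norm)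
  qed
  have "continuous_on ?Q ?f"
  proof -
    have "continuous_on ?Q (\<lambda>x. \<Psi> (fst x))" by (rule continuous_on_compose2[OF \<Psi>]) (auto intro!: continuous_intros)
    then show ?thesis unfolding case_prod_beta by (intro continuous_intros continuous_on_cis)
  qed
  then show "connected (twist_half \<Psi>)" unfolding img
    by (rule connected_continuous_image) (intro connected_Times, auto)
  show "twist_half \<Psi> \<noteq> {}" unfolding img using pi_gt_zero by (auto simp: greaterThanLessThan_empty_iff not_le)
qed

lemma twist_components:
  assumes \<Psi>: "continuous_on {0<..1 / sqrt pi} \<Psi>"
  shows "splits_disk (twist_curve \<Psi>) (twist_half \<Psi>) (twist_half (\<lambda>\<rho>. \<Psi> \<rho> + pi))"
proof -
  let ?A = "twist_half \<Psi>" and ?B = "twist_half (\<lambda>\<rho>. \<Psi> \<rho> + pi)"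
  have \<Psi>': "continuous_on {0<..1 / sqrt pi} (\<lambda>\<rho>. \<Psi> \<rho> + pi)" by (intro continuous_intros \<Psi>)
  have un: "disk - twist_curve \<Psi> = ?A \<union> ?B" unfolding twist_half_add_pi by (auto simp: twist_curve_def twist_half_def)
  have disj: "?A \<inter> ?B = {}" unfolding twist_half_add_pi by (auto simp: twist_half_def)
  have sub: "?A \<union> ?B \<subseteq> disk - {0}" unfolding twist_half_add_pi by (auto simp: twist_half_def)
  have op: "openin (top_of_set (?A \<union> ?B)) (twist_half \<Xi>)"
    if "continuous_on {0<..1 / sqrt pi} \<Xi>" "twist_half \<Xi> \<subseteq> ?A \<union> ?B" for \<Xi>
  proof -
    have "openin (top_of_set (?A \<union> ?B)) ((?A \<union> ?B) \<inter> (\<lambda>z. Im (z * cis (- \<Xi> (cmod z)))) -` {0<..})"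
      by (rule continuous_openin_preimage_gen[OF continuous_on_subset[OF continuous_on_Im_twist[OF that(1)] sub]]) simp
    moreover have "(?A \<union> ?B) \<inter> (\<lambda>z. Im (z * cis (- \<Xi> (cmod z)))) -` {0<..} = twist_half \<Xi>"
      using that(2) by (auto simp: twist_half_def)
    ultimately show ?thesis by simp
  qed
  have "components (?A \<union> ?B) = {?A, ?B}"
    by (rule components_two_open) (use connected_twist_half[OF \<Psi>] connected_twist_half[OF \<Psi>'] disj op \<Psi> \<Psi>' in auto)
  moreover have "?A \<noteq> ?B" using disj connected_twist_half(2)[OF \<Psi>] by auto
  ultimately show ?thesis unfolding splits_disk_def un by simp
qed

section \<open>Measure by averaging over rotations\<close>

text \<open>Transports to the complex plane the invariance of Lebesgue measure on
  \<open>real ^ 2\<close> under orthogonal maps.\<close>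

definition vec_complex :: "real ^ 2 \<Rightarrow> complex" where
  "vec_complex v = Complex (v $ 1) (v $ 2)"

lemma continuous_vec_complex: "continuous_on A vec_complex"
  unfolding vec_complex_def Complex_eq by (intro continuous_intros)

lemma measurable_vec_complex [measurable]: "vec_complex \<in> borel_measurable borel"
  by (rule borel_measurable_continuous_onI[OF continuous_vec_complex])

lemma vimage_vec_complex_box:
  "vec_complex -` box l u = box (\<chi> i. if i = 1 then Re l else Im l) (\<chi> i. if i = 1 then Re u else Im u)"
  by (auto simp: vec_complex_def mem_box_cart box_complex_eq forall_2 in_box_complex_iff)

lemma lborel_distr_vec_complex: "distr lborel borel vec_complex = lborel"
proof (rule lborel_eqI[symmetric])
  fix l u :: complex assume le: "\<And>b. b \<in> Basis \<Longrightarrow> l \<bullet> b \<le> u \<bullet> b"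
  let ?l = "(\<chi> i. if i = 1 then Re l else Im l) :: real ^ 2" and ?u = "(\<chi> i. if i = 1 then Re u else Im u) :: real ^ 2"
  have le': "?l \<bullet> b \<le> ?u \<bullet> b" if "b \<in> Basis" for b
    using that le[of 1] le[of \<i>] by (auto simp: Basis_vec_def Basis_complex_def inner_axis)
  have "emeasure (distr lborel borel vec_complex) (box l u) = emeasure lborel (box ?l ?u)"
    by (simp add: emeasure_distr vimage_vec_complex_box)
  also have "\<dots> = ennreal (\<Prod>b\<in>Basis. (?u - ?l) \<bullet> b)" by (rule emeasure_lborel_box[OF le'])
  also have "(\<Prod>b\<in>Basis. (?u - ?l) \<bullet> b) = (\<Prod>i\<in>UNIV. (?u - ?l) $ i)"
    unfolding Basis_vec_def by (subst prod.UNION_disjoint) (auto simp: inner_axis axis_eq_axis)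
  also have "\<dots> = (\<Prod>b\<in>Basis. (u - l) \<bullet> b)" by (simp add: UNIV_2 Basis_complex_def)
  finally show "emeasure (distr lborel borel vec_complex) (box l u) = ennreal (\<Prod>b\<in>Basis. (u - l) \<bullet> b)" .
qed simp

definition vec_rot :: "real \<Rightarrow> real ^ 2 \<Rightarrow> real ^ 2" where
  "vec_rot t v = (\<chi> i. if i = 1 then cos t * v $ 1 - sin t * v $ 2 else sin t * v $ 1 + cos t * v $ 2)"

lemma vec_complex_rot: "vec_complex (vec_rot t v) = cis t * vec_complex v"
  by (simp add: vec_complex_def vec_rot_def complex_eq_iff)

lemma vec_rot_orthogonal: "orthogonal_transformation (vec_rot t)"
  unfolding orthogonal_transformation_def
proof
  show "linear (vec_rot t)"
    by (rule linearI) (simp_all add: vec_rot_def vec_eq_iff forall_2 algebra_simps)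
  have "(c * a - s * b) * (c * a' - s * b') + (s * a + c * b) * (s * a' + c * b') = (c\<^sup>2 + s\<^sup>2) * (a * a' + b * b')"
    for a b a' b' c s :: real by (simp add: algebra_simps power2_eq_square)
  then have "vec_rot t v \<bullet> vec_rot t w = ((cos t)\<^sup>2 + (sin t)\<^sup>2) * (v \<bullet> w)" for v w
    by (simp add: inner_vec_def sum_2 vec_rot_def)
  then show "\<forall>v w. vec_rot t v \<bullet> vec_rot t w = v \<bullet> w" by simp
qed

text \<open>Lebesgue measure is determined by its values on boxes, and the preimage of a box is its
  image under the inverse rotation, whose measure is computed in \<open>real ^ 2\<close>.\<close>

lemma lborel_distr_rotation: "distr lborel borel (\<lambda>z. cis t * z) = lborel"
proof (rule lborel_eqI[symmetric])
  fix l u :: complex assume le: "\<And>b. b \<in> Basis \<Longrightarrow> l \<bullet> b \<le> u \<bullet> b"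
  let ?W = "vec_complex -` box l u"
  have W: "?W \<in> lmeasurable" "?W \<in> sets lborel" by (auto simp: vimage_vec_complex_box)
  have inv: "vec_rot s (vec_rot (- s) v) = v" for s v
  proof -
    have "vec_complex (vec_rot s (vec_rot (- s) v)) = vec_complex v"
      by (simp add: vec_complex_rot cis_mult flip: mult.assoc)
    then show ?thesis by (simp add: vec_complex_def vec_eq_iff forall_2)
  qed
  have img: "vec_rot (- t) ` ?W = {v. cis t * vec_complex v \<in> box l u}"
  proof (intro equalityI subsetI)
    fix v assume "v \<in> vec_rot (- t) ` ?W"
    then obtain w where "w \<in> ?W" "v = vec_rot (- t) w" by blast
    then show "v \<in> {v. cis t * vec_complex v \<in> box l u}" using inv[of t w] by (simp flip: vec_complex_rot)
  next
    fix v assume "v \<in> {v. cis t * vec_complex v \<in> box l u}"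
    then have "vec_rot t v \<in> ?W" by (simp add: vec_complex_rot)
    moreover have "v = vec_rot (- t) (vec_rot t v)" using inv[of "- t" v] by simp
    ultimately show "v \<in> vec_rot (- t) ` ?W" by blast
  qed
  have ms: "{v. cis t * vec_complex v \<in> box l u} \<in> sets borel" by measurable
  have "emeasure (distr lborel borel (\<lambda>z. cis t * z)) (box l u) = emeasure lborel {z. cis t * z \<in> box l u}"
    by (simp add: emeasure_distr vimage_def)
  also have "\<dots> = emeasure (distr lborel borel vec_complex) {z. cis t * z \<in> box l u}"
    by (simp only: lborel_distr_vec_complex)
  also have "\<dots> = emeasure lborel {v. cis t * vec_complex v \<in> box l u}"
    by (subst emeasure_distr) (auto simp: vimage_def)
  also have "\<dots> = emeasure lebesgue (vec_rot (- t) ` ?W)" unfolding img using ms by simp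
  also have "\<dots> = ennreal (measure lebesgue (vec_rot (- t) ` ?W))"
    by (rule emeasure_eq_measure2[OF measurable_orthogonal_image[OF vec_rot_orthogonal W(1)]])
  also have "\<dots> = ennreal (measure lebesgue ?W)" by (simp only: measure_orthogonal_image[OF vec_rot_orthogonal W(1)])
  also have "\<dots> = emeasure lebesgue ?W" by (rule emeasure_eq_measure2[OF W(1), symmetric])
  also have "\<dots> = emeasure lborel ?W" using W(2) by simp
  also have "\<dots> = emeasure (distr lborel borel vec_complex) (box l u)" by (simp add: emeasure_distr)
  also have "\<dots> = ennreal (\<Prod>b\<in>Basis. (u - l) \<bullet> b)" unfolding lborel_distr_vec_complex by (rule emeasure_lborel_box[OF le])
  finally show "emeasure (distr lborel borel (\<lambda>z. cis t * z)) (box l u) = ennreal (\<Prod>b\<in>Basis. (u - l) \<bullet> b)" .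
qed simp

lemma emeasure_rotation:
  assumes "S \<in> sets borel" shows "emeasure lborel {z. cis t * z \<in> S} = emeasure lborel S"
proof -
  have "emeasure lborel S = emeasure (distr lborel borel (\<lambda>z. cis t * z)) S" by (simp only: lborel_distr_rotation)
  then show ?thesis using assms by (simp add: emeasure_distr vimage_def)
qed

text \<open>Fubini for the pairs (t, z) with \<open>cis t * z\<close> in S. For fixed t the slice is
  a rotated copy of S; for fixed z it is the set of angles at which the circle through z meets S. So
  areas are computed from angular lengths without a change of variables.\<close>

lemma rotation_average:
  assumes S: "S \<in> sets (borel :: complex measure)"
  shows "(\<integral>\<^sup>+z. emeasure lborel {t \<in> {0..<2 * pi}. cis t * z \<in> S} \<partial>lborel) = ennreal (2 * pi) * emeasure lborel S"
proof -
  have [measurable]: "(\<lambda>x::real \<times> complex. cis (fst x) * snd x) \<in> borel_measurable borel"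
    by (intro borel_measurable_continuous_onI continuous_intros)
  have [measurable]: "(\<lambda>x::real \<times> complex. cis (fst x) * snd x) \<in> borel_measurable (lborel \<Otimes>\<^sub>M lborel)"
    unfolding lborel_prod by simp
  note S [measurable]
  have set: "{x :: real \<times> complex. cis (fst x) * snd x \<in> S} \<in> sets (lborel \<Otimes>\<^sub>M lborel)"
    using measurable_sets[of "\<lambda>x::real \<times> complex. cis (fst x) * snd x" "lborel \<Otimes>\<^sub>M lborel" borel S]
    by (simp add: space_pair_measure vimage_def S)
  have m: "(\<lambda>(t::real, z). indicator {0..<2 * pi} t * indicator {x. cis (fst x) * snd x \<in> S} (t, z) :: ennreal) \<in> borel_measurable (lborel \<Otimes>\<^sub>M lborel)"
    using set by measurable
  have mz: "{t. cis t * z \<in> S} \<in> sets borel" for z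
    using measurable_sets[of "\<lambda>t. cis t * z" borel borel S] S
    by (simp add: vimage_def borel_measurable_continuous_onI continuous_intros)
  have mt: "{z. cis t * z \<in> S} \<in> sets borel" for t
    using measurable_sets[of "\<lambda>z. cis t * z" borel borel S] S
    by (simp add: vimage_def borel_measurable_continuous_onI continuous_intros)
  have "emeasure lborel {t \<in> {0..<2 * pi}. cis t * z \<in> S} = (\<integral>\<^sup>+t. indicator {0..<2 * pi} t * indicator {x. cis (fst x) * snd x \<in> S} (t, z) \<partial>lborel)" for z
  proof -
    have "{t \<in> {0..<2 * pi}. cis t * z \<in> S} \<in> sets lborel" using mz[of z] by (simp add: Collect_conj_eq sets.Int)
    then have "emeasure lborel {t \<in> {0..<2 * pi}. cis t * z \<in> S} = (\<integral>\<^sup>+t. indicator {t \<in> {0..<2 * pi}. cis t * z \<in> S} t \<partial>lborel)"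
      by (simp only: nn_integral_indicator)
    also have "\<dots> = (\<integral>\<^sup>+t. indicator {0..<2 * pi} t * indicator {x. cis (fst x) * snd x \<in> S} (t, z) \<partial>lborel)"
      by (intro nn_integral_cong) (auto split: split_indicator)
    finally show ?thesis .
  qed
  then have "(\<integral>\<^sup>+z. emeasure lborel {t \<in> {0..<2 * pi}. cis t * z \<in> S} \<partial>lborel)
      = (\<integral>\<^sup>+z. \<integral>\<^sup>+t. indicator {0..<2 * pi} t * indicator {x. cis (fst x) * snd x \<in> S} (t, z) \<partial>lborel \<partial>lborel)" by simp
  also have "\<dots> = (\<integral>\<^sup>+t. \<integral>\<^sup>+z. indicator {0..<2 * pi} t * indicator {x. cis (fst x) * snd x \<in> S} (t, z) \<partial>lborel \<partial>lborel)"
    by (rule lborel_pair.Fubini'[OF m])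
  also have "\<dots> = (\<integral>\<^sup>+t. indicator {0..<2 * pi} t * emeasure lborel S \<partial>lborel)"
  proof (intro nn_integral_cong)
    fix t :: real
    have "(\<integral>\<^sup>+z. indicator {0..<2 * pi} t * indicator {x. cis (fst x) * snd x \<in> S} (t, z) \<partial>lborel)
        = (\<integral>\<^sup>+z. indicator {0..<2 * pi} t * indicator {z. cis t * z \<in> S} z \<partial>lborel)"
      by (intro nn_integral_cong) (auto split: split_indicator)
    also have "\<dots> = indicator {0..<2 * pi} t * emeasure lborel {z. cis t * z \<in> S}"
      using mt[of t] by (simp add: nn_integral_cmult)
    finally show "(\<integral>\<^sup>+z. indicator {0..<2 * pi} t * indicator {x. cis (fst x) * snd x \<in> S} (t, z) \<partial>lborel)
        = indicator {0..<2 * pi} t * emeasure lborel S" by (simp only: emeasure_rotation[OF S])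
  qed
  also have "\<dots> = ennreal (2 * pi) * emeasure lborel S" by (simp add: nn_integral_multc)
  finally show ?thesis .
qed

lemma emeasure_periodic_shift:
  fixes E :: "real set"
  assumes E: "E \<in> sets borel" and per: "\<And>x. x + p \<in> E \<longleftrightarrow> x \<in> E" and p: "p > 0"
  shows "emeasure lborel {t \<in> {0..<p}. t + c \<in> E} = emeasure lborel (E \<inter> {0..<p})"
proof -
  have shift: "emeasure lborel {t. t + d \<in> A} = emeasure lborel A" if "A \<in> sets borel" for A and d :: real
  proof -
    have "emeasure lborel A = emeasure (distr lborel borel ((+) d)) A" by (simp only: lborel_distr_plus)
    then show ?thesis using that by (simp add: emeasure_distr vimage_def add.commute)
  qed
  have perk: "x + of_int k * p \<in> E \<longleftrightarrow> x \<in> E" for x and k :: int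
  proof (induction k rule: int_induct[where k = 0])
    case (step1 i)
    then show ?case using per[of "x + of_int i * p"] by (simp add: algebra_simps)
  next
    case (step2 i)
    then show ?case using per[of "x + of_int (i - 1) * p"] by (simp add: algebra_simps)
  qed simp
  \<comment> \<open>The shift is reduced modulo p to some d in [0, p). The window [d, p + d) is [0,
    p) with its piece [0, d) moved by one period.\<close>
  define k where "k = \<lfloor>c / p\<rfloor>"
  define d where "d = c - of_int k * p"
  have d: "0 \<le> d" "d < p"
    using floor_divide_lower[OF p, of c] floor_divide_upper[OF p, of c] by (auto simp: d_def k_def algebra_simps)
  have "{t \<in> {0..<p}. t + c \<in> E} = {t \<in> {0..<p}. t + d \<in> E}"
  proof -
    have "t + c \<in> E \<longleftrightarrow> t + d \<in> E" for t using perk[of "t + d" k] by (simp add: d_def algebra_simps)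
    then show ?thesis by simp
  qed
  also have "\<dots> = {t. t + d \<in> E \<inter> {d..<p + d}}" by auto
  also have "emeasure lborel \<dots> = emeasure lborel (E \<inter> {d..<p + d})" by (rule shift) (use E in auto)
  also have "E \<inter> {d..<p + d} = (E \<inter> {d..<p}) \<union> (E \<inter> {p..<p + d})" using d by auto
  also have "emeasure lborel \<dots> = emeasure lborel (E \<inter> {d..<p}) + emeasure lborel (E \<inter> {p..<p + d})"
    by (rule plus_emeasure[symmetric]) (use E in auto)
  also have "emeasure lborel (E \<inter> {p..<p + d}) = emeasure lborel {t. t + p \<in> E \<inter> {p..<p + d}}"
    by (rule shift[symmetric]) (use E in auto)
  also have "{t. t + p \<in> E \<inter> {p..<p + d}} = E \<inter> {0..<d}" using per by auto
  also have "emeasure lborel (E \<inter> {d..<p}) + emeasure lborel (E \<inter> {0..<d}) = emeasure lborel ((E \<inter> {d..<p}) \<union> (E \<inter> {0..<d}))"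
    by (rule plus_emeasure) (use E in auto)
  also have "(E \<inter> {d..<p}) \<union> (E \<inter> {0..<d}) = E \<inter> {0..<p}" using d by auto
  finally show ?thesis .
qed

text \<open>E z describes the angular slice through z in a coordinate shifted by the phase c z; by
  periodicity the phase does not change its length. The center is a null set.\<close>

lemma emeasure_polar:
  fixes E :: "complex \<Rightarrow> real set" and c :: "complex \<Rightarrow> real"
  assumes S: "S \<in> sets borel" "S \<subseteq> disk"
    and E: "\<And>z. E z \<in> sets borel" "\<And>z x. x + 2 * pi \<in> E z \<longleftrightarrow> x \<in> E z"
    and mem: "\<And>z t. z \<in> disk \<Longrightarrow> z \<noteq> 0 \<Longrightarrow> cis t * z \<in> S \<longleftrightarrow> t + c z \<in> E z"
  shows "ennreal (2 * pi) * emeasure lborel S = (\<integral>\<^sup>+z\<in>disk. emeasure lborel (E z \<inter> {0..<2 * pi}) \<partial>lborel)"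
proof -
  have "ennreal (2 * pi) * emeasure lborel S = (\<integral>\<^sup>+z. emeasure lborel {t \<in> {0..<2 * pi}. cis t * z \<in> S} \<partial>lborel)"
    by (rule rotation_average[OF S(1), symmetric])
  also have "\<dots> = (\<integral>\<^sup>+z\<in>disk. emeasure lborel (E z \<inter> {0..<2 * pi}) \<partial>lborel)"
  proof (rule nn_integral_cong_AE)
    show "AE z in lborel. emeasure lborel {t \<in> {0..<2 * pi}. cis t * z \<in> S}
        = emeasure lborel (E z \<inter> {0..<2 * pi}) * indicator disk z"
      using AE_lborel_singleton[of 0]
    proof eventually_elim
      case (elim z)
      show ?case
      proof (cases "z \<in> disk")
        case True
        then have "{t \<in> {0..<2 * pi}. cis t * z \<in> S} = {t \<in> {0..<2 * pi}. t + c z \<in> E z}" using mem elim by auto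
        then show ?thesis using emeasure_periodic_shift[of "E z" "2 * pi" "c z"] E True by simp
      next
        case False
        then have "cis t * z \<notin> S" for t using S(2) by (auto simp: disk_def norm_mult)
        then show ?thesis using False by simp
      qed
    qed
  qed
  finally show ?thesis .
qed

lemma continuous_on_compose_cmod:
  assumes "continuous_on UNIV \<Psi>"
  shows "continuous_on UNIV (\<lambda>z. \<Psi> (cmod z))"
  by (rule continuous_on_compose2[OF assms]) (auto intro!: continuous_intros)

lemma disk_borel [measurable]: "disk \<in> sets borel"
  by (simp add: disk_def)

lemma emeasure_disk: "emeasure lborel disk = 1"
proof -
  have "disk \<in> fmeasurable lborel" unfolding disk_def by (intro fmeasurable_compact) simp
  then have "emeasure lborel disk = ennreal (measure lborel disk)" by (rule emeasure_eq_measure2)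
  also have "measure lborel disk = measure lebesgue disk" by (simp add: disk_borel)
  finally show ?thesis by (simp add: measure_disk)
qed

lemma polar_form: "z = complex_of_real (cmod z) * cis (Arg z)"
  by (cases "z = 0") (simp_all add: Arg_eq[symmetric] cis_conv_exp)

lemma sin_pos_period: "{x. sin x > 0} \<inter> {0..<2 * pi} = {0<..<pi}"
proof (intro equalityI subsetI)
  fix x assume "x \<in> {x. sin x > 0} \<inter> {0..<2 * pi}"
  then show "x \<in> {0<..<pi}" using sin_le_zero[of x] by (cases "x = 0"; cases "x < pi") auto
qed (use sin_gt_zero in auto)

lemma measurable_open_condition:
  fixes f :: "'a::topological_space \<Rightarrow> real"
  assumes "continuous_on UNIV f" shows "{x. f x > 0} \<in> sets borel" "{x. f x = 0} \<in> sets borel"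
proof -
  show "{x. f x > 0} \<in> sets borel" using assms by (intro borel_open open_Collect_less continuous_intros)
  show "{x. f x = 0} \<in> sets borel" using assms by (intro borel_closed closed_Collect_eq continuous_intros)
qed

lemma twist_half_borel:
  assumes "continuous_on UNIV \<Psi>" shows "twist_half \<Psi> \<in> sets borel"
proof -
  have "continuous_on UNIV (\<lambda>z. Im (z * cis (- \<Psi> (cmod z))))"
    by (intro continuous_intros continuous_on_cis continuous_on_compose_cmod assms)
  from measurable_open_condition(1)[OF this] show ?thesis
    unfolding twist_half_def by (simp add: Collect_conj_eq sets.Int disk_borel)
qed

lemma rotate_in_twist_half:
  assumes "z \<in> disk" "z \<noteq> 0"
  shows "cis t * z \<in> twist_half \<Psi> \<longleftrightarrow> sin (t + (Arg z - \<Psi> (cmod z))) > 0"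
proof -
  have "cis t * z = complex_of_real (cmod z) * cis (t + Arg z)"
    by (subst polar_form[of z]) (simp add: cis_mult mult.left_commute add.commute)
  then have "Im (cis t * z * cis (- \<Psi> (cmod (cis t * z)))) = cmod z * sin (t + Arg z - \<Psi> (cmod z))"
    by (simp add: norm_mult Im_rcis_cis del: Im_complex_of_real times_complex.sel)
  moreover have "cis t * z \<in> disk" using assms by (simp add: disk_def norm_mult)
  ultimately show ?thesis using assms unfolding twist_half_def
    by (simp add: zero_less_mult_iff add_diff_eq del: times_complex.sel)
qed

lemma ennreal_2pi_cancel: "ennreal (2 * pi) * x = ennreal (2 * pi) * y \<Longrightarrow> x = y"
  by (simp add: ennreal_mult_cancel_left)

lemma measure_twist_half:
  assumes \<Psi>: "continuous_on UNIV \<Psi>" shows "emeasure lborel (twist_half \<Psi>) = ennreal (1 / 2)"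
proof -
  have "ennreal (2 * pi) * emeasure lborel (twist_half \<Psi>)
      = (\<integral>\<^sup>+z\<in>disk. emeasure lborel ({x. sin x > 0} \<inter> {0..<2 * pi}) \<partial>lborel)"
  proof (rule emeasure_polar[OF twist_half_borel[OF \<Psi>], where c = "\<lambda>z. Arg z - \<Psi> (cmod z)"])
    show "{x::real. sin x > 0} \<in> sets borel" by (intro measurable_open_condition continuous_intros)
    show "cis t * z \<in> twist_half \<Psi> \<longleftrightarrow> t + (Arg z - \<Psi> (cmod z)) \<in> {x. sin x > 0}" if "z \<in> disk" "z \<noteq> 0" for z t
      using rotate_in_twist_half[OF that] by simp
    show "twist_half \<Psi> \<subseteq> disk" by (auto simp: twist_half_def)
  qed simp
  also have "\<dots> = ennreal pi" unfolding sin_pos_period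
    by (simp add: nn_integral_cmult emeasure_disk disk_borel)
  also have "\<dots> = ennreal (2 * pi) * ennreal (1 / 2)" by (subst ennreal_mult[symmetric]) auto
  finally show ?thesis by (rule ennreal_2pi_cancel)
qed

text \<open>The largest subset of the half invariant under the reflection z |->
  \<open>cis c * cnj z\<close>. The axis has angle c / 2, so c and c + pi belong to perpendicular
  axes.\<close>

definition twist_mirror :: "(real \<Rightarrow> real) \<Rightarrow> real \<Rightarrow> complex set" where
  "twist_mirror \<Psi> c = {z \<in> twist_half \<Psi>. cis c * cnj z \<in> twist_half \<Psi>}"

text \<open>A union of circles around the center, in the case of a monotone \<Psi> a union of
  annuli. Its measure is the density whose integral over a half period is the mirror overlap, up to
  the factor 2 pi.\<close>

definition twist_arcs :: "(real \<Rightarrow> real) \<Rightarrow> real \<Rightarrow> complex set" where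
  "twist_arcs \<Psi> y = {z \<in> disk. sin (y - 2 * \<Psi> (cmod z)) > 0}"

lemma twist_arcs_borel:
  assumes "continuous_on UNIV \<Psi>" shows "twist_arcs \<Psi> y \<in> sets borel"
proof -
  have "continuous_on UNIV (\<lambda>z. sin (y - 2 * \<Psi> (cmod z)))"
    by (intro continuous_intros continuous_on_compose_cmod assms)
  from measurable_open_condition(1)[OF this] show ?thesis
    unfolding twist_arcs_def by (simp add: Collect_conj_eq sets.Int disk_borel)
qed

lemma twist_mirror_borel:
  assumes "continuous_on UNIV \<Psi>" shows "twist_mirror \<Psi> c \<in> sets borel"
proof -
  have "(\<lambda>z. cis c * cnj z) \<in> borel_measurable borel"
    by (intro borel_measurable_continuous_onI continuous_intros)
  from measurable_sets[OF this twist_half_borel[OF assms]] twist_half_borel[OF assms]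
  show ?thesis unfolding twist_mirror_def by (simp add: vimage_def Collect_conj_eq sets.Int)
qed

text \<open>In the angle x measured from the curve, the half is 0 < x < pi and the reflection acts
  as x |-> c - 2 \<Psi> - x. Exchanging the integrals over x and z turns a condition on angles into
  one on the modulus.\<close>

lemma emeasure_twist_mirror:
  assumes \<Psi>: "continuous_on UNIV \<Psi>"
  shows "ennreal (2 * pi) * emeasure lborel (twist_mirror \<Psi> c)
    = (\<integral>\<^sup>+x. indicator {0<..<pi} x * emeasure lborel (twist_arcs \<Psi> (c - x)) \<partial>lborel)"
proof -
  let ?E = "\<lambda>z. {x. sin x > 0} \<inter> {x. sin (c - 2 * \<Psi> (cmod z) - x) > 0}"
  have mem: "cis t * z \<in> twist_mirror \<Psi> c \<longleftrightarrow> t + (Arg z - \<Psi> (cmod z)) \<in> ?E z" if z: "z \<in> disk" "z \<noteq> 0" for z t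
  proof -
    have "cis c * cnj (cis t * z) = complex_of_real (cmod z) * cis (c - t - Arg z)"
    proof -
      have "cnj z = complex_of_real (cmod z) * cis (- Arg z)" by (subst polar_form[of z]) (simp add: cis_cnj)
      then show ?thesis by (simp add: cis_cnj cis_mult mult.left_commute algebra_simps)
    qed
    moreover have "complex_of_real (cmod z) * cis (c - t - Arg z) = cis (c - t - 2 * Arg z) * z"
      by (subst (3) polar_form) (simp add: cis_mult mult.left_commute)
    ultimately have "cis c * cnj (cis t * z) = cis (c - t - 2 * Arg z) * z" by simp
    then have "cis c * cnj (cis t * z) \<in> twist_half \<Psi> \<longleftrightarrow> sin (c - t - 2 * Arg z + (Arg z - \<Psi> (cmod z))) > 0"
      by (simp only: rotate_in_twist_half[OF z])
    also have "c - t - 2 * Arg z + (Arg z - \<Psi> (cmod z)) = c - 2 * \<Psi> (cmod z) - (t + (Arg z - \<Psi> (cmod z)))" by simp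
    finally have "cis c * cnj (cis t * z) \<in> twist_half \<Psi> \<longleftrightarrow> sin (c - 2 * \<Psi> (cmod z) - (t + (Arg z - \<Psi> (cmod z)))) > 0" .
    then show ?thesis using rotate_in_twist_half[OF z] by (simp add: twist_mirror_def)
  qed
  have E: "?E z \<in> sets borel" for z
    by (intro sets.Int measurable_open_condition continuous_intros)
  have per: "x + 2 * pi \<in> ?E z \<longleftrightarrow> x \<in> ?E z" for x z
  proof -
    have "sin (u - (x + 2 * pi)) = sin (u - x)" for u using sin_periodic[of "u - x - 2 * pi"] by (simp add: algebra_simps)
    then show ?thesis by simp
  qed
  have Eint: "emeasure lborel (?E z \<inter> {0..<2 * pi}) = (\<integral>\<^sup>+x. indicator {0<..<pi} x * indicator {x. sin (c - 2 * \<Psi> (cmod z) - x) > 0} x \<partial>lborel)" for z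
  proof -
    have "?E z \<inter> {0..<2 * pi} = {0<..<pi} \<inter> {x. sin (c - 2 * \<Psi> (cmod z) - x) > 0}" using sin_pos_period by blast
    moreover have "{0<..<pi} \<inter> {x. sin (c - 2 * \<Psi> (cmod z) - x) > 0} \<in> sets lborel"
      by (auto intro!: measurable_open_condition continuous_intros)
    ultimately show ?thesis by (simp flip: nn_integral_indicator indicator_inter_arith)
  qed
  have arcs: "{x :: complex \<times> real. sin (c - 2 * \<Psi> (cmod (fst x)) - snd x) > 0} \<in> sets borel"
  proof (rule measurable_open_condition)
    have "continuous_on UNIV (\<lambda>x::complex \<times> real. \<Psi> (cmod (fst x)))"
      by (rule continuous_on_compose2[OF \<Psi>]) (auto intro!: continuous_intros)
    then show "continuous_on UNIV (\<lambda>x::complex \<times> real. sin (c - 2 * \<Psi> (cmod (fst x)) - snd x))"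
      by (intro continuous_intros)
  qed
  let ?f = "\<lambda>z x. indicator disk z * (indicator {0<..<pi} x * indicator {x. sin (c - 2 * \<Psi> (cmod (fst x)) - snd x) > 0} (z, x)) :: ennreal"
  have m: "(\<lambda>(z, x::real). ?f z x) \<in> borel_measurable (lborel \<Otimes>\<^sub>M lborel)"
  proof -
    have [measurable]: "{x :: complex \<times> real. sin (c - 2 * \<Psi> (cmod (fst x)) - snd x) > 0} \<in> sets (lborel \<Otimes>\<^sub>M lborel)"
      unfolding lborel_prod using arcs by simp
    show ?thesis by measurable
  qed
  have "ennreal (2 * pi) * emeasure lborel (twist_mirror \<Psi> c) = (\<integral>\<^sup>+z\<in>disk. emeasure lborel (?E z \<inter> {0..<2 * pi}) \<partial>lborel)"
    by (rule emeasure_polar[OF twist_mirror_borel[OF \<Psi>] _ E per mem]) (auto simp: twist_mirror_def twist_half_def)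
  also have "\<dots> = (\<integral>\<^sup>+z. \<integral>\<^sup>+x. ?f z x \<partial>lborel \<partial>lborel)"
    unfolding Eint
  proof (intro nn_integral_cong)
    fix z :: complex
    have "(\<integral>\<^sup>+x. indicator {0<..<pi} x * indicator {x. sin (c - 2 * \<Psi> (cmod z) - x) > 0} x \<partial>lborel)
        = (\<integral>\<^sup>+x. indicator {0<..<pi} x * indicator {x. sin (c - 2 * \<Psi> (cmod (fst x)) - snd x) > 0} (z, x) \<partial>lborel)"
      by (intro nn_integral_cong) (auto split: split_indicator)
    then show "(\<integral>\<^sup>+x. indicator {0<..<pi} x * indicator {x. sin (c - 2 * \<Psi> (cmod z) - x) > 0} x \<partial>lborel) * indicator disk z
        = (\<integral>\<^sup>+x. ?f z x \<partial>lborel)"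
      by (cases "z \<in> disk") simp_all
  qed
  also have "\<dots> = (\<integral>\<^sup>+x. \<integral>\<^sup>+z. ?f z x \<partial>lborel \<partial>lborel)"
    by (rule lborel_pair.Fubini'[OF m, symmetric])
  also have "\<dots> = (\<integral>\<^sup>+x. indicator {0<..<pi} x * emeasure lborel (twist_arcs \<Psi> (c - x)) \<partial>lborel)"
  proof (intro nn_integral_cong)
    fix x :: real
    have "(\<integral>\<^sup>+z. ?f z x \<partial>lborel) = (\<integral>\<^sup>+z. indicator {0<..<pi} x * indicator (twist_arcs \<Psi> (c - x)) z \<partial>lborel)"
      by (intro nn_integral_cong) (auto simp: twist_arcs_def algebra_simps split: split_indicator)
    then show "(\<integral>\<^sup>+z. ?f z x \<partial>lborel) = indicator {0<..<pi} x * emeasure lborel (twist_arcs \<Psi> (c - x))"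
      using twist_arcs_borel[OF \<Psi>] by (simp add: nn_integral_cmult)
  qed
  finally show ?thesis .
qed

text \<open>Treats rotations of finite and infinite order alike. Telescoping bounds the partial sums
  of the sines unless sin (c / 2) = 0, so positive terms are summable and tend to 0. By the addition
  formula the cosines times sin c tend to 0 as well, hence sin c = 0. Finally cis c = -1 is
  excluded, as it reverses the sign of the sine.\<close>

lemma sin_orbit_positive:
  fixes b c :: real
  assumes pos: "\<And>n::nat. sin (b + real n * c) > 0" shows "cis c = 1"
proof (cases "sin (c / 2) = 0")
  case True
  then obtain n :: int where "c / 2 = of_int n * pi" using sin_zero_iff_int2 by blast
  then have "c = 2 * of_int n * pi" by simp
  then show ?thesis by (metis cis_multiple_2pi Ints_of_int mult.commute mult.left_commute)
next
  case False
  have tele: "2 * sin (c / 2) * (\<Sum>k<n. sin (b + real k * c)) = cos (b - c / 2) - cos (b + real n * c - c / 2)" for n :: nat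
  proof (induction n)
    case (Suc n)
    have "2 * sin (c / 2) * sin (b + real n * c) = cos (b + real n * c - c / 2) - cos (b + real (Suc n) * c - c / 2)"
      using cos_diff[of "b + real n * c" "c / 2"] cos_add[of "b + real n * c" "c / 2"]
      by (simp add: algebra_simps)
    then show ?case using Suc by (simp add: distrib_left)
  qed simp
  have bound: "(\<Sum>k<n. sin (b + real k * c)) \<le> 1 / \<bar>sin (c / 2)\<bar>" for n :: nat
  proof -
    have "\<bar>2 * sin (c / 2) * (\<Sum>k<n. sin (b + real k * c))\<bar> \<le> 2" unfolding tele
      using abs_cos_le_one[of "b - c / 2"] abs_cos_le_one[of "b + real n * c - c / 2"] by linarith
    then have "\<bar>sin (c / 2)\<bar> * (\<Sum>k<n. sin (b + real k * c)) \<le> 1"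
      using pos by (simp add: abs_mult sum_nonneg less_imp_le)
    then show ?thesis using False by (simp add: field_simps)
  qed
  have "summable (\<lambda>k. sin (b + real k * c))"
  proof (rule bounded_imp_summable)
    show "0 \<le> sin (b + real k * c)" for k using pos[of k] by simp
    show "(\<Sum>k\<le>n. sin (b + real k * c)) \<le> 1 / \<bar>sin (c / 2)\<bar>" for n
      using bound[of "Suc n"] by (simp only: lessThan_Suc_atMost)
  qed
  then have lim: "(\<lambda>k. sin (b + real k * c)) \<longlonglongrightarrow> 0" by (rule summable_LIMSEQ_zero)
  then have "(\<lambda>k. sin (b + real (Suc k) * c) - sin (b + real k * c) * cos c) \<longlonglongrightarrow> 0 - 0 * cos c"
    by (intro tendsto_intros LIMSEQ_Suc)
  moreover have "sin (b + real (Suc k) * c) - sin (b + real k * c) * cos c = cos (b + real k * c) * sin c" for k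
  proof -
    have "b + real (Suc k) * c = (b + real k * c) + c" by (simp add: algebra_simps)
    then show ?thesis by (simp only: sin_add)
  qed
  ultimately have "(\<lambda>k. cos (b + real k * c) * sin c) \<longlonglongrightarrow> 0" by simp
  then have "(\<lambda>k. (cos (b + real k * c) * sin c)\<^sup>2 + (sin (b + real k * c) * sin c)\<^sup>2) \<longlonglongrightarrow> 0\<^sup>2 + (0 * sin c)\<^sup>2"
    by (intro tendsto_intros lim)
  moreover have "(cos u * sin c)\<^sup>2 + (sin u * sin c)\<^sup>2 = (sin c)\<^sup>2" for u
    by (simp add: power_mult_distrib flip: distrib_right)
  ultimately have "(sin c)\<^sup>2 = 0" by (simp add: LIMSEQ_const_iff)
  then have s: "sin c = 0" by simp
  then have "(cos c)\<^sup>2 = 1" using sin_cos_squared_add[of c] by simp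
  moreover have "cos c \<noteq> -1" using pos[of 1] pos[of 0] s by (auto simp: sin_add)
  ultimately have "cos c = 1" by (auto simp: power2_eq_1_iff)
  then show ?thesis using s by (simp add: complex_eq_iff)
qed

section \<open>Perfect halves and the condition they impose on the density\<close>

lemma measure_lebesgueI:
  assumes "S \<in> sets borel" "emeasure lborel S = ennreal r" "r \<ge> 0"
  shows "measure lebesgue S = r"
proof -
  have "emeasure lebesgue S = ennreal r" using assms by simp
  then show ?thesis using assms(3) by (simp only: measure_def enn2real_ennreal)
qed

lemma twist_half_perfect:
  assumes \<Psi>: "continuous_on UNIV \<Psi>" and half: "\<And>y. emeasure lborel (twist_arcs \<Psi> y) = ennreal (1 / 2)"
  shows "perfect_set (twist_half \<Psi>)"
  unfolding perfect_set_def
proof (intro conjI allI impI)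
  show "twist_half \<Psi> \<subseteq> disk" by (auto simp: twist_half_def)
  show "twist_half \<Psi> \<in> sets lebesgue" using twist_half_borel[OF \<Psi>] by simp
  show "measure lebesgue (twist_half \<Psi>) = 1 / 2"
    by (rule measure_lebesgueI[OF twist_half_borel[OF \<Psi>] measure_twist_half[OF \<Psi>]]) simp
  fix X assume X: "X \<subseteq> twist_half \<Psi> \<and> X \<in> sets lebesgue \<and> symmetric_set X"
  then obtain s where s: "plane_isometry s" "s \<noteq> id" "s ` disk = disk" "s ` X = X" unfolding symmetric_set_def by blast
  have s0: "s 0 = 0"
  proof (rule isometry_fixes_center[OF s(1)])
    show "cmod (complex_of_real (1 / sqrt pi)) = 1 / sqrt pi" by (simp add: norm_divide)
    then have "complex_of_real (1 / sqrt pi) \<in> disk" "- complex_of_real (1 / sqrt pi) \<in> disk" by (auto simp: disk_def norm_divide)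
    then have "s (complex_of_real (1 / sqrt pi)) \<in> disk" "s (- complex_of_real (1 / sqrt pi)) \<in> disk" using s(3) by blast+
    then show "cmod (s (complex_of_real (1 / sqrt pi))) \<le> 1 / sqrt pi" "cmod (s (- complex_of_real (1 / sqrt pi))) \<le> 1 / sqrt pi"
      by (simp_all add: disk_def)
  qed
  show "measure lebesgue X \<le> 1 / 4"
  proof (rule isometry_fixing_0_cases[OF s(1) s0])
    fix c assume sc: "\<And>z. s z = cis c * z"
    \<comment> \<open>The orbit of a point under the rotation stays on one circle and inside X,
      hence inside an open half circle.\<close>
    have "X = {}"
    proof (rule ccontr)
      assume "X \<noteq> {}"
      then obtain z where z: "z \<in> X" by blast
      then have zd: "z \<in> disk" "z \<noteq> 0" using X by (auto simp: twist_half_def)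
      have orbit: "cis (real n * c) * z \<in> X" for n :: nat
      proof (induction n)
        case (Suc n)
        then have "s (cis (real n * c) * z) \<in> X" using s(4) by blast
        then show ?case by (simp add: sc cis_mult algebra_simps flip: mult.assoc)
      qed (use z in simp)
      have "sin ((Arg z - \<Psi> (cmod z)) + real n * c) > 0" for n :: nat
        using orbit[of n] X rotate_in_twist_half[OF zd, of "real n * c" \<Psi>] by (auto simp: add.commute)
      then have "cis c = 1" by (rule sin_orbit_positive)
      then show False using s(2) sc by (auto simp: fun_eq_iff)
    qed
    then show ?thesis by simp
  next
    fix c assume sc: "\<And>z. s z = cis c * cnj z"
    have "X \<subseteq> twist_mirror \<Psi> c"
    proof
      fix z assume z: "z \<in> X"
      then have "s z \<in> X" using s(4) by blast
      then show "z \<in> twist_mirror \<Psi> c" using z X unfolding twist_mirror_def sc by blast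
    qed
    moreover have fin: "emeasure lborel (twist_mirror \<Psi> c) = ennreal (1 / 4)"
    proof -
      have "ennreal (2 * pi) * emeasure lborel (twist_mirror \<Psi> c) = ennreal pi * ennreal (1 / 2)"
        unfolding emeasure_twist_mirror[OF \<Psi>] half by (simp add: nn_integral_multc)
      also have "\<dots> = ennreal (pi * (1 / 2))" by (rule ennreal_mult[symmetric]) auto
      also have "\<dots> = ennreal (2 * pi * (1 / 4))" by simp
      also have "\<dots> = ennreal (2 * pi) * ennreal (1 / 4)" by (rule ennreal_mult) auto
      finally show ?thesis by (rule ennreal_2pi_cancel)
    qed
    moreover have "twist_mirror \<Psi> c \<in> fmeasurable lebesgue"
      using fin twist_mirror_borel[OF \<Psi>] by (intro fmeasurableI) auto
    ultimately have "measure lebesgue X \<le> measure lebesgue (twist_mirror \<Psi> c)"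
      using X by (intro measure_mono_fmeasurable) auto
    also have "\<dots> = 1 / 4" by (rule measure_lebesgueI[OF twist_mirror_borel[OF \<Psi>] fin]) simp
    finally show ?thesis .
  qed
qed

lemma twist_mirror_symmetric:
  "twist_mirror \<Psi> c \<subseteq> twist_half \<Psi>" "symmetric_set (twist_mirror \<Psi> c)"
proof -
  show sub: "twist_mirror \<Psi> c \<subseteq> twist_half \<Psi>" by (auto simp: twist_mirror_def)
  let ?s = "\<lambda>z. cis c * cnj z"
  have inv: "?s (?s z) = z" for z by (simp add: cis_cnj cis_mult flip: mult.assoc)
  have "plane_isometry ?s"
    unfolding plane_isometry_def
    by (simp add: dist_norm norm_mult flip: right_diff_distrib complex_cnj_diff)
  moreover have "?s \<noteq> id"
  proof
    assume id: "?s = id"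
    show False using fun_cong[OF id, of 1] fun_cong[OF id, of \<i>] by (simp add: complex_eq_iff)
  qed
  moreover have img: "?s ` A = A" if "\<And>z. z \<in> A \<Longrightarrow> ?s z \<in> A" for A
  proof
    show "?s ` A \<subseteq> A" using that by blast
    show "A \<subseteq> ?s ` A"
    proof
      fix z assume "z \<in> A"
      then show "z \<in> ?s ` A" using that by (intro image_eqI[of _ _ "?s z"]) (simp_all only: inv)
    qed
  qed
  have "?s ` disk = disk" by (rule img) (simp add: disk_def norm_mult)
  moreover have "?s ` twist_mirror \<Psi> c = twist_mirror \<Psi> c"
  proof (rule img)
    fix z assume "z \<in> twist_mirror \<Psi> c"
    then show "?s z \<in> twist_mirror \<Psi> c" unfolding twist_mirror_def mem_Collect_eq inv by blast
  qed
  moreover have "twist_mirror \<Psi> c \<subseteq> disk" using sub by (auto simp: twist_half_def)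
  ultimately show "symmetric_set (twist_mirror \<Psi> c)" unfolding symmetric_set_def by blast
qed

context
  fixes \<Psi> :: "real \<Rightarrow> real"
  assumes \<Psi>: "continuous_on UNIV \<Psi>"
    and null: "\<And>y. emeasure lborel {z \<in> disk. sin (y - 2 * \<Psi> (cmod z)) = 0} = 0"
begin

abbreviation (input) arc_measure :: "real \<Rightarrow> real" where
  "arc_measure y \<equiv> measure lborel (twist_arcs \<Psi> y)"

lemma null_arc_boundary: "{z \<in> disk. sin (y - 2 * \<Psi> (cmod z)) = 0} \<in> null_sets lborel"
proof -
  have "continuous_on UNIV (\<lambda>z. sin (y - 2 * \<Psi> (cmod z)))"
    by (intro continuous_intros continuous_on_compose_cmod \<Psi>)
  from measurable_open_condition(2)[OF this] have "{z \<in> disk. sin (y - 2 * \<Psi> (cmod z)) = 0} \<in> sets borel"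
    by (simp add: Collect_conj_eq sets.Int disk_borel)
  then show ?thesis using null by (auto simp: null_sets_def)
qed

lemma arcs_fmeasurable: "twist_arcs \<Psi> y \<in> fmeasurable lborel"
proof (rule fmeasurableI2)
  show "disk \<in> fmeasurable lborel" by (intro fmeasurableI) (auto simp: emeasure_disk disk_borel)
qed (use twist_arcs_borel[OF \<Psi>] in \<open>auto simp: twist_arcs_def\<close>)

lemma arc_measure_add_pi: "arc_measure y + arc_measure (y + pi) = 1"
proof -
  let ?N = "{z \<in> disk. sin (y - 2 * \<Psi> (cmod z)) = 0}"
  have neg: "twist_arcs \<Psi> (y + pi) = {z \<in> disk. sin (y - 2 * \<Psi> (cmod z)) < 0}"
  proof -
    have "sin (y + pi - u) = - sin (y - u)" for u using sin_periodic_pi[of "y - u"] by (simp add: algebra_simps)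
    then show ?thesis by (simp add: twist_arcs_def)
  qed
  have "disk = (twist_arcs \<Psi> y \<union> twist_arcs \<Psi> (y + pi)) \<union> ?N" unfolding neg by (auto simp: twist_arcs_def)
  then have "measure lborel disk = measure lborel ((twist_arcs \<Psi> y \<union> twist_arcs \<Psi> (y + pi)) \<union> ?N)" by simp
  also have "\<dots> = measure lborel (twist_arcs \<Psi> y \<union> twist_arcs \<Psi> (y + pi))"
    using twist_arcs_borel[OF \<Psi>] by (intro measure_Un_null_set null_arc_boundary) auto
  also have "\<dots> = arc_measure y + arc_measure (y + pi)"
  proof -
    have "twist_arcs \<Psi> (y + pi) - twist_arcs \<Psi> y = twist_arcs \<Psi> (y + pi)" unfolding neg by (auto simp: twist_arcs_def)
    then show ?thesis using measure_Un2[OF arcs_fmeasurable[of y] arcs_fmeasurable[of "y + pi"]] by simp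
  qed
  finally show ?thesis using emeasure_disk by (simp add: measure_def)
qed

text \<open>Dominated convergence: at each z the indicator is locally constant in y unless the sine
  vanishes there, which happens on a null set.\<close>

lemma isCont_arc_measure: "isCont arc_measure y"
  unfolding continuous_at_sequentially
proof (intro allI impI)
  fix u :: "nat \<Rightarrow> real" assume u: "u \<longlonglongrightarrow> y"
  have fin: "integrable lborel (indicator disk :: complex \<Rightarrow> real)"
    by (intro integrable_real_indicator) (auto simp: disk_borel emeasure_disk)
  have "(\<lambda>n. \<integral>z. (indicator (twist_arcs \<Psi> (u n)) z :: real) \<partial>lborel) \<longlonglongrightarrow> (\<integral>z. indicator (twist_arcs \<Psi> y) z \<partial>lborel)"
  proof (rule integral_dominated_convergence[OF _ _ fin])
    show "AE z in lborel. (\<lambda>n. indicator (twist_arcs \<Psi> (u n)) z :: real) \<longlonglongrightarrow> indicator (twist_arcs \<Psi> y) z"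
      using AE_not_in[OF null_arc_boundary[of y]]
    proof eventually_elim
      case (elim z)
      show ?case
      proof (cases "z \<in> disk")
        case True
        have lim: "(\<lambda>n. sin (u n - 2 * \<Psi> (cmod z))) \<longlonglongrightarrow> sin (y - 2 * \<Psi> (cmod z))" by (intro tendsto_intros u)
        have "sin (y - 2 * \<Psi> (cmod z)) \<noteq> 0" using elim True by simp
        then have "eventually (\<lambda>n. sin (u n - 2 * \<Psi> (cmod z)) > 0 \<longleftrightarrow> sin (y - 2 * \<Psi> (cmod z)) > 0) sequentially"
        proof (cases "sin (y - 2 * \<Psi> (cmod z)) > 0")
          case True
          then show ?thesis using order_tendstoD(1)[OF lim, of 0] by (auto elim: eventually_mono)
        next
          case False
          then have "sin (y - 2 * \<Psi> (cmod z)) < 0" using \<open>sin _ \<noteq> 0\<close> by simp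
          then show ?thesis using order_tendstoD(2)[OF lim, of 0] False by (auto elim!: eventually_mono)
        qed
        then have "eventually (\<lambda>n. indicator (twist_arcs \<Psi> (u n)) z = (indicator (twist_arcs \<Psi> y) z :: real)) sequentially"
          by eventually_elim (auto simp: twist_arcs_def split: split_indicator)
        then show ?thesis by (rule tendsto_eventually)
      qed (simp add: twist_arcs_def)
    qed
    show "AE z in lborel. norm (indicator (twist_arcs \<Psi> (u n)) z :: real) \<le> indicator disk z" for n
      by (auto simp: twist_arcs_def split: split_indicator)
  qed (use twist_arcs_borel[OF \<Psi>] in auto)
  then show "(arc_measure \<circ> u) \<longlonglongrightarrow> arc_measure y"
    using twist_arcs_borel[OF \<Psi>] by (simp add: o_def)
qed

text \<open>H is 2 pi times the mirror overlap, hence at most pi / 2 by perfectness, while H y + H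
  (y + pi) = pi; so H is constant. As H v is the integral of the density over [v - pi, v], its
  derivative shows that the density has the same value at y and y - pi, and these two values add up
  to 1.\<close>

lemma arc_measure_eq_half:
  assumes perf: "perfect_set (twist_half \<Psi>)"
  shows "arc_measure y = 1 / 2"
proof -
  have cont: "continuous_on A arc_measure" for A by (intro continuous_at_imp_continuous_on ballI isCont_arc_measure)
  define H where "H y = integral {0..pi} (\<lambda>x. arc_measure (y - x))" for y
  have ci: "continuous_on {0..pi} (\<lambda>x. arc_measure (y - x))" for y
    by (rule continuous_on_compose2[OF cont[of UNIV]]) (auto intro!: continuous_intros)
  have hi: "((\<lambda>x. arc_measure (y - x)) has_integral H y) {0..pi}" for y
    unfolding H_def by (intro integrable_integral integrable_continuous_real ci)
  have Hle: "H y \<le> pi / 2" for y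
  proof -
    have "measure lebesgue (twist_mirror \<Psi> y) \<le> 1 / 4"
      using perf twist_mirror_symmetric[of \<Psi> y] twist_mirror_borel[OF \<Psi>] unfolding perfect_set_def by (metis sets_completionI_sets sets_lborel)
    moreover have fm: "twist_mirror \<Psi> y \<in> fmeasurable lborel"
    proof (rule fmeasurableI2)
      show "disk \<in> fmeasurable lborel" by (intro fmeasurableI) (auto simp: emeasure_disk disk_borel)
    qed (use twist_mirror_borel[OF \<Psi>] in \<open>auto simp: twist_mirror_def twist_half_def\<close>)
    ultimately have le: "measure lborel (twist_mirror \<Psi> y) \<le> 1 / 4" using twist_mirror_borel[OF \<Psi>] by simp
    have "ennreal (2 * pi) * ennreal (measure lborel (twist_mirror \<Psi> y)) = (\<integral>\<^sup>+x. indicator {0<..<pi} x * emeasure lborel (twist_arcs \<Psi> (y - x)) \<partial>lborel)"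
      using emeasure_twist_mirror[OF \<Psi>, of y] emeasure_eq_measure2[OF fm] by simp
    also have "\<dots> = (\<integral>\<^sup>+x. ennreal (arc_measure (y - x)) * indicator {0<..<pi} x \<partial>lborel)"
      by (simp add: emeasure_eq_measure2[OF arcs_fmeasurable] mult.commute)
    also have "\<dots> = ennreal (H y)"
      by (rule nn_integral_has_integral_lebesgue') (use hi[of y] in \<open>auto simp: has_integral_Icc_iff_Ioo\<close>)
    finally have "ennreal (2 * pi * measure lborel (twist_mirror \<Psi> y)) = ennreal (H y)"
      by (subst (asm) ennreal_mult[symmetric]) auto
    moreover have "0 \<le> H y" unfolding H_def by (intro integral_nonneg integrable_continuous_real ci) simp
    ultimately have "2 * pi * measure lborel (twist_mirror \<Psi> y) = H y"
      by (subst (asm) ennreal_inj) auto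
    then show ?thesis using mult_left_mono[OF le, of "2 * pi"] by simp
  qed
  have Hsum: "H y + H (y + pi) = pi" for y
  proof -
    have "((\<lambda>x. arc_measure (y - x) + arc_measure (y + pi - x)) has_integral (H y + H (y + pi))) {0..pi}"
      by (intro has_integral_add hi)
    moreover have "arc_measure (y - x) + arc_measure (y + pi - x) = 1" for x
      using arc_measure_add_pi[of "y - x"] by (simp add: algebra_simps)
    ultimately have "((\<lambda>x::real. 1) has_integral (H y + H (y + pi))) {0..pi}" by simp
    from has_integral_unique[OF this has_integral_const_real[of "1::real" 0 pi]] show ?thesis by simp
  qed
  have Heq: "H y = pi / 2" for y using Hle[of y] Hle[of "y + pi"] Hsum[of y] by linarith
  \<comment> \<open>The base point lies to the left of y - pi by a margin, so that A is
    differentiable around both y and y - pi.\<close>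
  define A where "A t = integral {y - pi - 1..t} arc_measure" for t
  have A: "(A has_real_derivative arc_measure t) (at t)" if "t \<in> {y - pi - 1<..<y + 1}" for t
  proof -
    have "(A has_real_derivative arc_measure t) (at t within {y - pi - 1..y + 1})"
      unfolding A_def by (rule integral_has_real_derivative[OF cont]) (use that in auto)
    then show ?thesis using that by (simp add: at_within_Icc_at)
  qed
  have AH: "A v - A (v - pi) = pi / 2" if v: "v \<in> {y - 1<..<y + 1}" for v
  proof -
    have "((\<lambda>x. arc_measure (v - x)) has_integral (- A (v - pi) - - A (v - 0))) {0..pi}"
    proof (rule fundamental_theorem_of_calculus)
      fix x :: real assume x: "x \<in> {0..pi}"
      have "((\<lambda>x. A (v - x)) has_real_derivative arc_measure (v - x) * (- 1)) (at x)"
      proof (rule DERIV_chain2[where f = A and g = "\<lambda>x. v - x"])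
        show "(A has_real_derivative arc_measure (v - x)) (at (v - x))" by (rule A) (use x v in auto)
        show "((\<lambda>x. v - x) has_real_derivative - 1) (at x)" by (auto intro!: derivative_eq_intros)
      qed
      from DERIV_minus[OF this] have "((\<lambda>x. - A (v - x)) has_real_derivative arc_measure (v - x)) (at x)" by simp
      then show "((\<lambda>x. - A (v - x)) has_vector_derivative arc_measure (v - x)) (at x within {0..pi})"
        by (simp add: has_real_derivative_iff_has_vector_derivative has_vector_derivative_at_within)
    qed simp
    from has_integral_unique[OF this hi[of v]] Heq show ?thesis by simp
  qed
  have "((\<lambda>v. A v - A (v - pi)) has_real_derivative arc_measure y - arc_measure (y - pi)) (at y)"
  proof (rule DERIV_diff)
    show "(A has_real_derivative arc_measure y) (at y)" 
      by (rule A) (use pi_gt_zero in \<open>unfold greaterThanLessThan_iff, linarith\<close>)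
    have "(A has_real_derivative arc_measure (y - pi)) (at (y - pi))"
      by (rule A) (use pi_gt_zero in \<open>unfold greaterThanLessThan_iff, linarith\<close>)
    moreover have "((\<lambda>v. v - pi) has_real_derivative 1) (at y)" by (auto intro!: derivative_eq_intros)
    ultimately have "((\<lambda>v. A (v - pi)) has_real_derivative arc_measure (y - pi) * 1) (at y)"
      by (rule DERIV_chain2[where f = A and g = "\<lambda>v. v - pi"])
    then show "((\<lambda>v. A (v - pi)) has_real_derivative arc_measure (y - pi)) (at y)" by simp
  qed
  moreover have "((\<lambda>v. A v - A (v - pi)) has_real_derivative 0) (at y)"
  proof -
    have "eventually (\<lambda>v. v \<in> {y - 1<..<y + 1}) (nhds y)" by (intro eventually_nhds_in_open) auto
    then have "eventually (\<lambda>v. A v - A (v - pi) = pi / 2) (nhds y)" by eventually_elim (rule AH)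
    from DERIV_cong_ev[OF refl this refl, of 0] show ?thesis by simp
  qed
  ultimately have "arc_measure y = arc_measure (y - pi)" using DERIV_unique by (metis eq_iff_diff_eq_0)
  then show ?thesis using arc_measure_add_pi[of "y - pi"] by simp
qed

end

section \<open>The functional equation\<close>

lemma pexp_cong:
  assumes "pexp f x" "eventually (\<lambda>y. f y = h y) (at x)" shows "pexp h x"
proof -
  obtain M where M: "odd M" "texp (\<lambda>s. f (x + s ^ M))" using assms(1) unfolding pexp_def by blast
  have "filterlim (\<lambda>s. x + s ^ M) (at x) (at 0)"
    using odd_pos[OF M(1)]
    by (intro filterlim_atI eventually_mono[OF eventually_neq_at_within[of 0]]) (auto intro!: tendsto_eq_intros simp: power_0_left)
  from eventually_compose_filterlim[OF assms(2) this] have "texp (\<lambda>s. h (x + s ^ M))" by (rule texp_cong[OF M(2)])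
  then show ?thesis using M(1) unfolding pexp_def by blast
qed

lemma pexp_shift: "pexp f (x + c) \<Longrightarrow> pexp (\<lambda>y. f (y + c)) x"
  unfolding pexp_def by (simp add: algebra_simps)

text \<open>The product of two odd exponents is a common odd exponent.\<close>

lemma pexp_add:
  assumes "pexp f x" "pexp h x" shows "pexp (\<lambda>y. f y + h y) x"
proof -
  obtain M N where M: "odd M" "texp (\<lambda>s. f (x + s ^ M))" and N: "odd N" "texp (\<lambda>s. h (x + s ^ N))"
    using assms unfolding pexp_def by blast
  have "texp (\<lambda>s. f (x + (s ^ N) ^ M))" "texp (\<lambda>s. h (x + (s ^ M) ^ N))"
    using texp_compose_power[OF M(2) odd_pos[OF N(1)]] texp_compose_power[OF N(2) odd_pos[OF M(1)]] by auto
  then have "texp (\<lambda>s. f (x + s ^ (M * N)) + h (x + s ^ (M * N)))"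
    by (intro texp_add) (simp_all add: mult.commute flip: power_mult)
  then show ?thesis using M(1) N(1) unfolding pexp_def by (intro exI[of _ "M * N"]) simp
qed

lemma pexp_cmult:
  assumes "pexp f x" shows "pexp (\<lambda>y. c * f y) x"
  using assms texp_mult[OF texp_const] unfolding pexp_def by blast

lemma pexp_const: "pexp (\<lambda>y. c) x"
  unfolding pexp_def by (intro exI[of _ 1]) (simp add: texp_const)

lemma sphere_null: "sphere (c::complex) r \<in> null_sets lborel"
  using negligible_sphere[of c r] by (auto simp: null_sets_completion_iff negligible_iff_null_sets)

lemma measure_annulus:
  assumes "0 \<le> r" "r \<le> s"
  shows "measure lborel (cball (0::complex) s - cball 0 r) = pi * s\<^sup>2 - pi * r\<^sup>2"
    "measure lborel (ball (0::complex) s - cball 0 r) = pi * s\<^sup>2 - pi * r\<^sup>2"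
proof -
  have vol: "measure lborel (cball (0::complex) s) = pi * s\<^sup>2" "measure lborel (cball (0::complex) r) = pi * r\<^sup>2"
    using assms by (simp_all add: content_cball unit_ball_vol_2)
  have "measure lborel (cball (0::complex) s - cball 0 r) = measure lborel (cball (0::complex) s) - measure lborel (cball (0::complex) r)"
    by (rule measurable_measure_Diff) (use assms in \<open>auto intro: fmeasurable_compact\<close>)
  then show *: "measure lborel (cball (0::complex) s - cball 0 r) = pi * s\<^sup>2 - pi * r\<^sup>2" by (simp add: vol)
  have "measure lborel (cball (0::complex) s - cball 0 r - sphere 0 s) = measure lborel (cball (0::complex) s - cball 0 r)"
    by (rule measure_Diff_null_set[OF _ sphere_null]) simp
  moreover have "cball (0::complex) s - cball 0 r - sphere 0 s = ball 0 s - cball 0 r" by auto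
  ultimately show "measure lborel (ball (0::complex) s - cball 0 r) = pi * s\<^sup>2 - pi * r\<^sup>2" using * by simp
qed

text \<open>As a function of x the sine has period pi and is positive on the intervals of length pi
  / 2 that end at p, p + pi and p + 2 pi. The outer two are truncated at 0 and 2 pi.\<close>

lemma sin_double_pos_iff:
  assumes p: "0 < p" "p < pi / 2" and x: "0 \<le> x" "x \<le> 2 * pi"
  shows "sin (2 * (p - x)) > 0 \<longleftrightarrow> x < p \<or> (p + pi / 2 < x \<and> x < p + pi) \<or> p + 3 * pi / 2 < x"
proof -
  have per: "sin (v + 2 * pi) = sin v" "sin (v + 4 * pi) = sin v" for v
    using sin_periodic[of v] sin_periodic[of "v + 2 * pi"] by (simp_all add: algebra_simps)
  have neg: "sin v \<le> 0" if "- pi \<le> v" "v \<le> 0" for v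
    using sin_ge_zero[of "- v"] that by simp
  consider "x < p" | "p \<le> x" "x \<le> p + pi / 2" | "p + pi / 2 < x" "x < p + pi"
    | "p + pi \<le> x" "x \<le> p + 3 * pi / 2" | "p + 3 * pi / 2 < x" by linarith
  then show ?thesis
  proof cases
    case 1
    then have "sin (2 * (p - x)) > 0" using p x by (intro sin_gt_zero) auto
    then show ?thesis using 1 by simp
  next
    case 2
    then have "sin (2 * (p - x)) \<le> 0" using p by (intro neg) auto
    then show ?thesis using 2 p pi_gt_zero by linarith
  next
    case 3
    then have "sin (2 * (p - x) + 2 * pi) > 0" by (intro sin_gt_zero) auto
    then show ?thesis using 3 by (simp add: per)
  next
    case 4
    then have "sin (2 * (p - x) + 2 * pi) \<le> 0" using p by (intro neg) auto
    then show ?thesis unfolding per using 4 p pi_gt_zero by linarith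
  next
    case 5
    then have "sin (2 * (p - x) + 4 * pi) > 0" using p x by (intro sin_gt_zero) auto
    then show ?thesis using 5 by (simp add: per)
  qed
qed

section \<open>The condition on the squared radius and its solution\<close>

context polar_spiral
begin

lemma g_less_iff: "\<rho> \<in> {0..1 / sqrt pi} \<Longrightarrow> u \<in> {0..2 * pi} \<Longrightarrow> g u < \<rho> \<longleftrightarrow> u < \<Phi> \<rho>"
  "\<rho> \<in> {0..1 / sqrt pi} \<Longrightarrow> u \<in> {0..2 * pi} \<Longrightarrow> \<rho> < g u \<longleftrightarrow> \<Phi> \<rho> < u"
  using \<Phi>_range[of \<rho>] strict_mono_on_less[OF g_mono, of u "\<Phi> \<rho>"] strict_mono_on_less[OF g_mono, of "\<Phi> \<rho>" u] by auto

text \<open>Each of the countably many critical values of \<open>\<Phi>\<close> is attained on a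
  single circle.\<close>

lemma arc_boundary_null:
  "emeasure lborel {z \<in> disk. sin (y - 2 * (a + \<Phi> (cmod z))) = 0} = 0"
proof -
  let ?U = "\<Union>k::int. sphere (0::complex) (g ((y - 2 * a - of_int k * pi) / 2))"
  have U: "?U \<in> null_sets lborel" by (intro null_sets_UN sphere_null)
  have "{z \<in> disk. sin (y - 2 * (a + \<Phi> (cmod z))) = 0} \<subseteq> ?U"
  proof
    fix z assume "z \<in> {z \<in> disk. sin (y - 2 * (a + \<Phi> (cmod z))) = 0}"
    then have z: "cmod z \<in> {0..1 / sqrt pi}" "sin (y - 2 * (a + \<Phi> (cmod z))) = 0" by (auto simp: disk_def)
    obtain k :: int where "y - 2 * (a + \<Phi> (cmod z)) = of_int k * pi" using z(2) sin_zero_iff_int2 by blast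
    then have "\<Phi> (cmod z) = (y - 2 * a - of_int k * pi) / 2" by (simp add: field_simps)
    from \<Phi>_range(2)[OF z(1), unfolded this] have "cmod z = g ((y - 2 * a - of_int k * pi) / 2)" by (rule sym)
    then show "z \<in> ?U" by auto
  qed
  then show ?thesis by (rule emeasure_eq_0[OF null_setsD2[OF U] null_setsD1[OF U]])
qed

text \<open>As g is increasing, the angles p + j pi / 2 for j = 0, ..., 3 cut the disk into an inner
  disk and four annuli on which the sign of the sine alternates; the pieces where it is positive are
  the first, third and fifth.\<close>

lemma measure_arcs:
  assumes p: "p \<in> {0<..<pi / 2}"
  shows "measure lborel (twist_arcs (\<lambda>\<rho>. a + \<Phi> \<rho>) (2 * a + 2 * p))
    = pi * ((g p)\<^sup>2 + ((g (p + pi))\<^sup>2 - (g (p + pi / 2))\<^sup>2)) + (1 - pi * (g (p + 3 * pi / 2))\<^sup>2)"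
proof -
  let ?A = "ball (0::complex) (g p)" and ?B = "ball (0::complex) (g (p + pi)) - cball 0 (g (p + pi / 2))"
    and ?C = "disk - cball 0 (g (p + 3 * pi / 2))"
  have in01: "p \<in> {0..2 * pi}" "p + pi / 2 \<in> {0..2 * pi}" "p + pi \<in> {0..2 * pi}" "p + 3 * pi / 2 \<in> {0..2 * pi}"
    using p by auto
  have le: "g p \<le> g (p + pi / 2)" "g (p + pi / 2) \<le> g (p + pi)" "g (p + pi) \<le> g (p + 3 * pi / 2)"
    using in01 strict_mono_on_imp_mono_on[OF g_mono] by (auto simp: mono_on_def)
  have rng: "g u \<in> {0..1 / sqrt pi}" if "u \<in> {0..2 * pi}" for u using that g_image by blast
  have eq: "twist_arcs (\<lambda>\<rho>. a + \<Phi> \<rho>) (2 * a + 2 * p) = (?A \<union> ?B) \<union> ?C"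
  proof (rule set_eqI)
    fix z :: complex
    show "z \<in> twist_arcs (\<lambda>\<rho>. a + \<Phi> \<rho>) (2 * a + 2 * p) \<longleftrightarrow> z \<in> (?A \<union> ?B) \<union> ?C"
    proof (cases "z \<in> disk")
      case True
      then have r: "cmod z \<in> {0..1 / sqrt pi}" by (simp add: disk_def)
      have "z \<in> twist_arcs (\<lambda>\<rho>. a + \<Phi> \<rho>) (2 * a + 2 * p) \<longleftrightarrow> sin (2 * (p - \<Phi> (cmod z))) > 0"
        using True by (simp add: twist_arcs_def algebra_simps)
      also have "\<dots> \<longleftrightarrow> \<Phi> (cmod z) < p \<or> (p + pi / 2 < \<Phi> (cmod z) \<and> \<Phi> (cmod z) < p + pi) \<or> p + 3 * pi / 2 < \<Phi> (cmod z)"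
        using p \<Phi>_range(1)[OF r] by (intro sin_double_pos_iff) auto
      also have "\<dots> \<longleftrightarrow> cmod z < g p \<or> (g (p + pi / 2) < cmod z \<and> cmod z < g (p + pi)) \<or> g (p + 3 * pi / 2) < cmod z"
        using g_less_iff[OF r in01(1)] g_less_iff[OF r in01(2)] g_less_iff[OF r in01(3)] g_less_iff[OF r in01(4)] by blast
      also have "\<dots> \<longleftrightarrow> z \<in> (?A \<union> ?B) \<union> ?C" using True by auto
      finally show ?thesis .
    next
      case False
      then have "cmod z > 1 / sqrt pi" by (simp add: disk_def)
      then show ?thesis using False rng[OF in01(1)] rng[OF in01(3)] by (auto simp: twist_arcs_def)
    qed
  qed
  have ball: "ball (0::complex) r \<in> fmeasurable lborel" for r
    by (rule fmeasurableI) (use emeasure_lborel_ball_finite in auto)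
  have cball: "cball (0::complex) r \<in> fmeasurable lborel" for r by (intro fmeasurable_compact) simp
  have fm: "?A \<in> fmeasurable lborel" "?B \<in> fmeasurable lborel" "?C \<in> fmeasurable lborel"
    unfolding disk_def by (intro fmeasurable.Diff ball cball)+
  have "?C - (?A \<union> ?B) = ?C" "?B - ?A = ?B" using le by auto
  then have "measure lborel ((?A \<union> ?B) \<union> ?C) = (measure lborel ?A + measure lborel ?B) + measure lborel ?C"
    using measure_Un2[OF fmeasurable.Un[OF fm(1,2)] fm(3)] measure_Un2[OF fm(1,2)] by simp
  also have "measure lborel ?A = pi * (g p)\<^sup>2" using rng[OF in01(1)] by (simp add: content_ball unit_ball_vol_2)
  also have "measure lborel ?B = pi * (g (p + pi))\<^sup>2 - pi * (g (p + pi / 2))\<^sup>2"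
    using rng[OF in01(2)] le by (intro measure_annulus) auto
  also have "measure lborel ?C = pi * (1 / sqrt pi)\<^sup>2 - pi * (g (p + 3 * pi / 2))\<^sup>2"
    unfolding disk_def using rng[OF in01(4)] by (intro measure_annulus) auto
  also have "pi * (1 / sqrt pi)\<^sup>2 = 1" by (simp add: power_divide)
  finally show ?thesis unfolding eq by (simp add: algebra_simps)
qed

text \<open>The right-hand side is (1/2 - 1) / pi, where 1/2 is the measure of the arcs and 1 the
  area of the disk bounding the outermost annulus.\<close>

lemma functional_equation:
  assumes cont: "continuous_on UNIV \<Phi>" and perf: "perfect_set (twist_half (\<lambda>\<rho>. a + \<Phi> \<rho>))" and p: "p \<in> {0<..<pi / 2}"
  shows "(g p)\<^sup>2 - (g (p + pi / 2))\<^sup>2 + (g (p + pi))\<^sup>2 - (g (p + 3 * pi / 2))\<^sup>2 = - 1 / (2 * pi)"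
proof -
  have c: "continuous_on UNIV (\<lambda>\<rho>. a + \<Phi> \<rho>)" by (intro continuous_intros cont)
  have "measure lborel (twist_arcs (\<lambda>\<rho>. a + \<Phi> \<rho>) (2 * a + 2 * p)) = 1 / 2"
    by (rule arc_measure_eq_half[OF c arc_boundary_null perf])
  then have eq: "pi * ((g p)\<^sup>2 - (g (p + pi / 2))\<^sup>2 + (g (p + pi))\<^sup>2 - (g (p + 3 * pi / 2))\<^sup>2) = - 1 / 2"
    unfolding measure_arcs[OF p] by (simp add: algebra_simps)
  have "X = - 1 / (2 * pi)" if "pi * X = - 1 / 2" for X :: real
    using that pi_gt_zero by (simp add: field_simps)
  from this[OF eq] show ?thesis .
qed

lemma linear_square:
  assumes cont: "continuous_on UNIV \<Phi>" and perf: "perfect_set (twist_half (\<lambda>\<rho>. a + \<Phi> \<rho>))"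
    and smooth: "cond_smooth (twist_curve (\<lambda>\<rho>. a + \<Phi> \<rho>))"
    and alg: "algebraic_in_polar (twist_curve (\<lambda>\<rho>. a + \<Phi> \<rho>))"
    and x: "x \<in> {0..2 * pi}"
  shows "(g x)\<^sup>2 = x / (2 * pi\<^sup>2)"
proof -
  define h where "h x = (g x)\<^sup>2" for x
  have hc: "continuous_on {0..2 * pi} h" unfolding h_def by (intro continuous_intros g_cont)
  have h0: "h 0 = 0" and h1: "h (2 * pi) = 1 / pi" by (auto simp: h_def g_0 g_1 power_divide)
  obtain P where P: "P \<noteq> 0" "\<And>x. x \<in> {0<..<2 * pi} \<Longrightarrow> bpoly P x (h x) = 0"
    using algebraic_relation[OF alg] unfolding h_def by metis
  have ph: "pexp h x" if "x \<in> {0<..<2 * pi}" for x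
    using smooth smooth_expansion[OF _ _ _ P(1) P(2)[unfolded h_def] that] unfolding cond_smooth_def h_def[abs_def] by blast
  have fe: "h p - h (p + pi / 2) + h (p + pi) - h (p + 3 * pi / 2) = - 1 / (2 * pi)" if "p \<in> {0<..<pi / 2}" for p
    using functional_equation[OF cont perf that] by (simp add: h_def)
  \<comment> \<open>1 / pi = h (2 pi) - h 0, so the two pieces fit continuously at 2 pi.\<close>
  define H where "H x = (if x \<le> 2 * pi then h x else h (x - 2 * pi) + 1 / pi)" for x
  have Hc: "continuous_on {0<..<2 * (2 * pi)} H"
  proof -
    have "continuous_on ({0..2 * pi} \<union> {2 * pi..4 * pi}) H"
      unfolding H_def
    proof (rule continuous_on_cases)
      show "continuous_on {2 * pi..4 * pi} (\<lambda>x. h (x - 2 * pi) + 1 / pi)"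
        by (intro continuous_intros continuous_on_compose2[OF hc]) auto
    qed (use hc h0 h1 in \<open>auto dest!: antisym\<close>)
    then show ?thesis by (rule continuous_on_subset) auto
  qed
  have Hp: "pexp H x" if x: "x \<in> {0<..<2 * (2 * pi)}" for x
  proof -
    consider "x < 2 * pi" | "x > 2 * pi" | "x = 2 * pi" by linarith
    then show ?thesis
    proof cases
      case 1
      have "eventually (\<lambda>y. y \<in> {0<..<2 * pi}) (at x)" using x 1 by (intro eventually_at_in_open') auto
      then have "eventually (\<lambda>y. h y = H y) (at x)" by eventually_elim (simp add: H_def)
      moreover have "pexp h x" using x 1 by (intro ph) auto
      ultimately show ?thesis by (rule pexp_cong[rotated])
    next
      case 2
      have "eventually (\<lambda>y. y \<in> {2 * pi<..}) (at x)" using x 2 by (intro eventually_at_in_open') auto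
      then have "eventually (\<lambda>y. h (y + (- 2 * pi)) + 1 / pi = H y) (at x)" by eventually_elim (simp add: H_def)
      moreover have "pexp (\<lambda>y. h (y + (- 2 * pi)) + 1 / pi) x"
        by (intro pexp_add pexp_const pexp_shift ph) (use x 2 in auto)
      ultimately show ?thesis by (rule pexp_cong[rotated])
    next
      case 3
      have "eventually (\<lambda>y. y \<in> {2 * pi - pi / 2<..<2 * pi + pi / 2}) (at x)"
        using 3 by (intro eventually_at_in_open') auto
      moreover have "eventually (\<lambda>y. y \<noteq> x) (at x)" by (rule eventually_neq_at_within)
      \<comment> \<open>To the left of 2 pi this is the functional equation at p = y - 3 pi / 2, to
        the right the one at p = y - 2 pi increased by 1 / pi. Both give the same combination, and
        its arguments are near pi / 2, pi and 3 pi / 2, where h has expansions.\<close>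
      ultimately have "eventually (\<lambda>y. h (y + (- 3 * pi / 2)) + ((- 1) * h (y + (- pi)) + (h (y + (- pi / 2)) + 1 / (2 * pi))) = H y) (at x)"
      proof eventually_elim
        case (elim y)
        show ?case
        proof (cases "y < 2 * pi")
          case True
          then have "y - 3 * pi / 2 \<in> {0<..<pi / 2}" using elim by auto
          from fe[OF this] True show ?thesis by (simp add: H_def algebra_simps)
        next
          case False
          then have "y - 2 * pi \<in> {0<..<pi / 2}" using elim 3 by auto
          from fe[OF this] False elim 3 show ?thesis by (simp add: H_def algebra_simps)
        qed
      qed
      moreover have "pexp (\<lambda>y. h (y + (- 3 * pi / 2)) + ((- 1) * h (y + (- pi)) + (h (y + (- pi / 2)) + 1 / (2 * pi)))) x"
        by (intro pexp_add pexp_cmult pexp_const pexp_shift ph) (use 3 in auto)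
      ultimately show ?thesis by (rule pexp_cong[rotated])
    qed
  qed
  \<comment> \<open>P serves x < 2 pi, its translate x > 2 pi, and the linear factor the gluing
    point.\<close>
  define Q where "Q = [:[:- 2 * pi, 1:]:] * (P * bshift (- 2 * pi) (- 1 / pi) P)"
  have "Q \<noteq> 0" using P(1) bshift_nonzero[OF P(1)] by (simp add: Q_def)
  moreover have "bpoly Q x (H x) = 0" if x: "x \<in> {0<..<2 * (2 * pi)}" for x
  proof -
    consider "x < 2 * pi" | "x > 2 * pi" | "x = 2 * pi" by linarith
    then show ?thesis
    proof cases
      case 1
      then show ?thesis using P(2)[of x] x by (simp add: Q_def H_def)
    next
      case 2
      then show ?thesis using P(2)[of "x - 2 * pi"] x by (simp add: Q_def H_def)
    next
      case 3
      then show ?thesis by (simp add: Q_def)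
    qed
  qed
  moreover have "H (x + 2 * pi) = H x + 1 / pi" if "x \<in> {0<..<2 * pi}" for x using that by (simp add: H_def)
  ultimately obtain e where e: "\<And>x. x \<in> {0<..<2 * pi} \<Longrightarrow> H x = 1 / pi * x / (2 * pi) + e"
    using algebraic_quasiperiodic_linear[of "2 * pi" H Q "1 / pi"] Hc Hp pi_gt_zero by auto
  have lin: "h x = x / (2 * pi\<^sup>2) + e" if "x \<in> {0<..<2 * pi}" for x
    using e[OF that] that by (simp add: H_def power2_eq_square)
  \<comment> \<open>The linear form holds on the open interval; continuity of h at 0, where h
    vanishes, fixes the constant.\<close>
  have "e = 0"
  proof -
    have "(h \<longlongrightarrow> h 0) (at_right 0)"
      using hc by (simp add: continuous_on_Icc_at_rightD)
    moreover have "eventually (\<lambda>x. x \<in> {0<..<2 * pi}) (at_right 0)" by (rule eventually_at_right_real) simp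
    then have "eventually (\<lambda>x. h x = x / (2 * pi\<^sup>2) + e) (at_right 0)" by eventually_elim (rule lin)
    moreover have "((\<lambda>x. x / (2 * pi\<^sup>2) + e) \<longlongrightarrow> 0 / (2 * pi\<^sup>2) + e) (at_right 0)" by (intro tendsto_intros) auto
    ultimately have "(h \<longlongrightarrow> h 0) (at_right 0)" "(h \<longlongrightarrow> 0 / (2 * pi\<^sup>2) + e) (at_right 0)"
      using tendsto_cong[of h "\<lambda>x. x / (2 * pi\<^sup>2) + e" "at_right 0"] by blast+
    from tendsto_unique[OF _ this] h0 show ?thesis by simp
  qed
  then have "h x = x / (2 * pi\<^sup>2)"
    using lin[of x] x h0 h1 by (cases "x = 0"; cases "x = 2 * pi") (auto simp: power2_eq_square)
  then show ?thesis by (simp add: h_def)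
qed

end

section \<open>Fermat's spiral\<close>

lemma twist_curve_cong:
  assumes "\<And>\<rho>. \<rho> \<in> {0..1 / sqrt pi} \<Longrightarrow> \<Psi> \<rho> = \<Psi>' \<rho>" shows "twist_curve \<Psi> = twist_curve \<Psi>'"
  using assms by (auto simp: twist_curve_def disk_def)

text \<open>The signed modulus x sweeps the whole curve through the center; the two antipodal arms
  are x > 0 and x < 0.\<close>

lemma twist_curve_image:
  "twist_curve \<Psi> = (\<lambda>x. complex_of_real x * cis (\<Psi> \<bar>x\<bar>)) ` {- (1 / sqrt pi)..1 / sqrt pi}"
proof (intro equalityI subsetI)
  fix z assume z: "z \<in> twist_curve \<Psi>"
  define w where "w = z * cis (- \<Psi> (cmod z))"
  have w: "w = complex_of_real (Re w)" using z by (simp add: twist_curve_def w_def complex_eq_iff)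
  have "cmod z = cmod w" unfolding w_def norm_mult by simp
  also have "\<dots> = \<bar>Re w\<bar>" by (subst w) (simp only: norm_of_real)
  finally have n: "cmod z = \<bar>Re w\<bar>" .
  have "z = w * cis (\<Psi> (cmod z))" by (simp add: w_def mult.assoc cis_mult)
  also have "\<dots> = complex_of_real (Re w) * cis (\<Psi> \<bar>Re w\<bar>)" using w n by simp
  finally have "z = complex_of_real (Re w) * cis (\<Psi> \<bar>Re w\<bar>)" .
  moreover have "Re w \<in> {- (1 / sqrt pi)..1 / sqrt pi}" using z n by (simp add: twist_curve_def disk_def abs_le_iff)
  ultimately show "z \<in> (\<lambda>x. complex_of_real x * cis (\<Psi> \<bar>x\<bar>)) ` {- (1 / sqrt pi)..1 / sqrt pi}" by blast
next
  fix z assume "z \<in> (\<lambda>x. complex_of_real x * cis (\<Psi> \<bar>x\<bar>)) ` {- (1 / sqrt pi)..1 / sqrt pi}"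
  then obtain x where "x \<in> {- (1 / sqrt pi)..1 / sqrt pi}" "z = complex_of_real x * cis (\<Psi> \<bar>x\<bar>)" by blast
  then have x: "\<bar>x\<bar> \<le> 1 / sqrt pi" "z = complex_of_real x * cis (\<Psi> \<bar>x\<bar>)" unfolding atLeastAtMost_iff by linarith+
  have n: "cmod z = \<bar>x\<bar>" by (simp add: x norm_mult)
  have "Im (z * cis (- \<Psi> (cmod z))) = 0" unfolding n unfolding x(2) Im_rcis_cis by simp
  then show "z \<in> twist_curve \<Psi>" using x(1) n unfolding twist_curve_def disk_def by simp
qed

lemma polar_eq_rcis: "polar (\<phi>, r) = complex_of_real r * cis \<phi>"
  by (simp add: polar_def complex_eq_iff)

text \<open>With e = 1 or e = -1 these angles give the images of Fermat's spiral under the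
  isometries fixing the center: rotations for e = 1, reflections for e = -1.\<close>

definition fermat_angle :: "real \<Rightarrow> real \<Rightarrow> real \<Rightarrow> real" where
  "fermat_angle e c \<rho> = e * (2 * pi\<^sup>2 * \<rho>\<^sup>2) + c"

lemma fermat_angle_abs [simp]: "fermat_angle e c \<bar>x\<bar> = fermat_angle e c x"
  by (simp add: fermat_angle_def)

lemma continuous_fermat_angle: "continuous_on A (fermat_angle e c)"
  unfolding fermat_angle_def by (intro continuous_intros)

lemma fermat_spiral_twist: "fermat_spiral = twist_curve (fermat_angle 1 0)"
proof -
  have "\<bar>r\<bar> \<le> 1 / sqrt pi \<longleftrightarrow> 2 * pi\<^sup>2 * r\<^sup>2 \<le> 2 * pi" for r :: real
  proof -
    have "\<bar>r\<bar> \<le> 1 / sqrt pi \<longleftrightarrow> r\<^sup>2 \<le> (1 / sqrt pi)\<^sup>2" by (subst abs_le_square_iff[symmetric]) simp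
    also have "\<dots> \<longleftrightarrow> r\<^sup>2 \<le> 1 / pi" by (simp add: power_divide)
    also have "\<dots> \<longleftrightarrow> 2 * pi\<^sup>2 * r\<^sup>2 \<le> 2 * pi" by (simp add: power2_eq_square field_simps)
    finally show ?thesis .
  qed
  then have iff: "r \<in> {- (1 / sqrt pi)..1 / sqrt pi} \<longleftrightarrow> 2 * pi\<^sup>2 * r\<^sup>2 \<le> 2 * pi" for r :: real
    unfolding atLeastAtMost_iff by (metis abs_le_iff minus_le_iff)
  show ?thesis
    unfolding fermat_spiral_def twist_curve_image fermat_angle_abs
  proof (intro equalityI subsetI)
    fix z assume "z \<in> polar ` {(\<phi>, r). 2 * pi\<^sup>2 * r\<^sup>2 = \<phi> \<and> 0 \<le> \<phi> \<and> \<phi> \<le> 2 * pi}"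
    then obtain r where "z = polar (2 * pi\<^sup>2 * r\<^sup>2, r)" "2 * pi\<^sup>2 * r\<^sup>2 \<le> 2 * pi" by auto
    then show "z \<in> (\<lambda>x. complex_of_real x * cis (fermat_angle 1 0 x)) ` {- (1 / sqrt pi)..1 / sqrt pi}"
      by (intro image_eqI[of _ _ r]) (auto simp only: polar_eq_rcis iff fermat_angle_def mult_1 add_0_right)
  next
    fix z assume "z \<in> (\<lambda>x. complex_of_real x * cis (fermat_angle 1 0 x)) ` {- (1 / sqrt pi)..1 / sqrt pi}"
    then obtain r where r: "z = polar (2 * pi\<^sup>2 * r\<^sup>2, r)" "2 * pi\<^sup>2 * r\<^sup>2 \<le> 2 * pi"
      by (auto simp only: polar_eq_rcis iff fermat_angle_def mult_1 add_0_right)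
    then show "z \<in> polar ` {(\<phi>, r). 2 * pi\<^sup>2 * r\<^sup>2 = \<phi> \<and> 0 \<le> \<phi> \<and> \<phi> \<le> 2 * pi}" by auto
  qed
qed

lemma rotate_twist_curve: "(\<lambda>z. cis b * z) ` twist_curve \<Psi> = twist_curve (\<lambda>\<rho>. \<Psi> \<rho> + b)"
  unfolding twist_curve_image image_image
  by (intro image_cong refl) (simp add: cis_mult mult.left_commute add.commute)

lemma mirror_twist_curve: "(\<lambda>z. cis b * cnj z) ` twist_curve \<Psi> = twist_curve (\<lambda>\<rho>. b - \<Psi> \<rho>)"
  unfolding twist_curve_image image_image
  by (intro image_cong refl) (simp add: cis_cnj cis_mult mult.left_commute)

lemma twist_cong:
  assumes "continuous_on {0<..1 / sqrt pi} \<Psi>" shows "cond_cong (twist_curve \<Psi>)"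
  unfolding cond_cong_def congruent_sets_def
  using twist_components[OF assms] uminus_twist_half[of \<Psi>]
  by (intro exI[of _ "twist_half \<Psi>"] exI[of _ "twist_half (\<lambda>\<rho>. \<Psi> \<rho> + pi)"] conjI exI[of _ uminus])
    (auto simp: plane_isometry_def dist_norm norm_minus_commute)

lemma twist_conc: "cond_conc (twist_curve \<Psi>)"
  unfolding cond_conc_def
proof (intro allI impI)
  fix \<rho> :: real assume r: "0 < \<rho> \<and> \<rho> \<le> 1 / sqrt pi"
  let ?p = "complex_of_real \<rho> * cis (\<Psi> \<rho>)"
  have "twist_curve \<Psi> \<inter> sphere 0 \<rho> = {?p, - ?p}"
  proof (intro equalityI subsetI)
    fix z assume "z \<in> twist_curve \<Psi> \<inter> sphere 0 \<rho>"
    then obtain x where x: "z = complex_of_real x * cis (\<Psi> \<bar>x\<bar>)" "cmod z = \<rho>" unfolding twist_curve_image by auto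
    then have "\<bar>x\<bar> = \<rho>" by (simp add: norm_mult)
    then show "z \<in> {?p, - ?p}" using x by (cases "x \<ge> 0") auto
  next
    fix z assume "z \<in> {?p, - ?p}"
    then have "z = complex_of_real \<rho> * cis (\<Psi> \<bar>\<rho>\<bar>) \<or> z = complex_of_real (- \<rho>) * cis (\<Psi> \<bar>- \<rho>\<bar>)" using r by auto
    moreover have "\<rho> \<in> {- (1 / sqrt pi)..1 / sqrt pi}" "- \<rho> \<in> {- (1 / sqrt pi)..1 / sqrt pi}" using r by auto
    ultimately have "z \<in> twist_curve \<Psi>" unfolding twist_curve_image by blast
    moreover have "cmod z = \<rho>" using \<open>z \<in> {?p, - ?p}\<close> r by (auto simp: norm_mult)
    ultimately show "z \<in> twist_curve \<Psi> \<inter> sphere 0 \<rho>" by simp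
  qed
  moreover have "?p \<noteq> - ?p" using r by simp
  ultimately show "card (twist_curve \<Psi> \<inter> sphere 0 \<rho>) = 2" by simp
qed

text \<open>The interval is half-open to fit a radius: 0 stands for the center, which is excluded,
  and 2 pi for the rim, which counts. Taking the ceiling minus 1 puts x0 into (0, pi] rather than
  [0, pi).\<close>

lemma sin_zeros_in_two_periods:
  obtains x0 where "x0 \<in> {0<..pi}" "{x \<in> {0<..2 * pi}. sin (x - y) = 0} = {x0, x0 + pi}"
proof -
  define k where "k = \<lceil>y / pi\<rceil> - 1"
  define x0 where "x0 = y - of_int k * pi"
  have x0: "0 < x0" "x0 \<le> pi"
    using ceiling_divide_lower[of pi y] ceiling_divide_upper[of pi y] by (auto simp: x0_def k_def algebra_simps)
  have "{x \<in> {0<..2 * pi}. sin (x - y) = 0} = {x0, x0 + pi}"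
  proof (intro equalityI subsetI)
    fix x assume "x \<in> {x \<in> {0<..2 * pi}. sin (x - y) = 0}"
    then have x: "0 < x" "x \<le> 2 * pi" "sin (x - y) = 0" by auto
    obtain n :: int where "x - y = of_int n * pi" using x(3) sin_zero_iff_int2 by blast
    then have n: "x = x0 + of_int (n + k) * pi" by (simp add: x0_def algebra_simps)
    have "of_int (n + k) * pi < 2 * pi" "(- 1) * pi < of_int (n + k) * pi" using n x x0 by linarith+
    then have "real_of_int (n + k) < 2" "- 1 < real_of_int (n + k)"
      using mult_less_cancel_right_pos[OF pi_gt_zero] by blast+
    then have "n + k = 0 \<or> n + k = 1" by linarith
    then show "x \<in> {x0, x0 + pi}" using n by auto
  next
    fix x assume x: "x \<in> {x0, x0 + pi}"
    then have "x - y = of_int (- k) * pi \<or> x - y = of_int (1 - k) * pi" by (auto simp: x0_def algebra_simps)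
    then have "sin (x - y) = 0" using sin_zero_iff_int2 by blast
    then show "x \<in> {x \<in> {0<..2 * pi}. sin (x - y) = 0}" using x x0 pi_gt_zero by auto
  qed
  then show ?thesis using that x0 by auto
qed

text \<open>In the variable x = 2 pi^2 \<rho>^2 the radius without the center is (0, 2 pi], and the
  angle of the spiral is linear in x. So the crossings are the zeros of a shifted sine over one full
  period.\<close>

lemma fermat_rad':
  assumes e: "e = 1 \<or> e = -1" shows "cond_rad' (twist_curve (fermat_angle e c))"
  unfolding cond_rad'_def
proof
  fix p :: complex assume "p \<in> sphere 0 (1 / sqrt pi)"
  define \<theta> where "\<theta> = Arg p"
  have p: "p = complex_of_real (1 / sqrt pi) * cis \<theta>" using \<open>p \<in> _\<close> polar_form[of p] by (simp add: \<theta>_def)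
  obtain x0 where x0: "x0 \<in> {0<..pi}" "{x \<in> {0<..2 * pi}. sin (x - e * (\<theta> - c)) = 0} = {x0, x0 + pi}"
    using sin_zeros_in_two_periods by metis
  let ?F = "\<lambda>x. complex_of_real (sqrt (x / (2 * pi\<^sup>2))) * cis \<theta>"
  let ?S = "twist_curve (fermat_angle e c) \<inter> closed_segment 0 p - {0}"
  have onray: "complex_of_real \<rho> * cis \<theta> \<in> twist_curve (fermat_angle e c) \<longleftrightarrow> sin (2 * pi\<^sup>2 * \<rho>\<^sup>2 - e * (\<theta> - c)) = 0"
    if r: "0 < \<rho>" "\<rho> \<le> 1 / sqrt pi" for \<rho>
  proof -
    have "complex_of_real \<rho> * cis \<theta> \<in> twist_curve (fermat_angle e c) \<longleftrightarrow> \<rho> * sin (\<theta> - fermat_angle e c \<rho>) = 0"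
      unfolding twist_curve_def mem_Collect_eq Im_rcis_cis using r by (simp add: norm_mult disk_def)
    also have "\<dots> \<longleftrightarrow> sin (\<theta> - fermat_angle e c \<rho>) = 0" using r by simp
    also have "\<dots> \<longleftrightarrow> sin (2 * pi\<^sup>2 * \<rho>\<^sup>2 - e * (\<theta> - c)) = 0"
    proof -
      have "\<theta> - fermat_angle e c \<rho> = - (2 * pi\<^sup>2 * \<rho>\<^sup>2 - e * (\<theta> - c)) \<or> \<theta> - fermat_angle e c \<rho> = 2 * pi\<^sup>2 * \<rho>\<^sup>2 - e * (\<theta> - c)"
        using e by (auto simp: fermat_angle_def)
      then show ?thesis by (auto simp only: sin_minus neg_equal_0_iff_equal)
    qed
    finally show ?thesis .
  qed
  have "?S = ?F ` {x0, x0 + pi}"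
  proof (intro equalityI subsetI)
    fix z assume z: "z \<in> ?S"
    then obtain u where u: "0 \<le> u" "u \<le> 1" "z = u *\<^sub>R p" by (auto simp: in_segment)
    define \<rho> where "\<rho> = u / sqrt pi"
    have zr: "z = complex_of_real \<rho> * cis \<theta>" by (simp add: u p \<rho>_def scaleR_conv_of_real)
    then have "\<rho> \<noteq> 0" using z by auto
    then have r: "0 < \<rho>" "\<rho> \<le> 1 / sqrt pi" using u by (auto simp: \<rho>_def divide_right_mono)
    have "sin (2 * pi\<^sup>2 * \<rho>\<^sup>2 - e * (\<theta> - c)) = 0" using onray[OF r] z zr by simp
    moreover have "2 * pi\<^sup>2 * \<rho>\<^sup>2 \<le> 2 * pi"
    proof -
      have "\<rho>\<^sup>2 \<le> (1 / sqrt pi)\<^sup>2" using r by (intro power_mono) auto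
      then have "\<rho>\<^sup>2 \<le> 1 / pi" by (simp add: power_divide)
      then show ?thesis by (simp add: power2_eq_square field_simps)
    qed
    ultimately have "2 * pi\<^sup>2 * \<rho>\<^sup>2 \<in> {x0, x0 + pi}" using r unfolding x0(2)[symmetric] by auto
    moreover have "z = ?F (2 * pi\<^sup>2 * \<rho>\<^sup>2)" using r by (simp add: zr)
    ultimately show "z \<in> ?F ` {x0, x0 + pi}" by blast
  next
    fix z assume "z \<in> ?F ` {x0, x0 + pi}"
    then obtain x where x: "x \<in> {x0, x0 + pi}" "z = ?F x" by blast
    then have x': "0 < x" "x \<le> 2 * pi" "sin (x - e * (\<theta> - c)) = 0" unfolding x0(2)[symmetric] by auto
    define \<rho> where "\<rho> = sqrt (x / (2 * pi\<^sup>2))"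
    have sq: "2 * pi\<^sup>2 * \<rho>\<^sup>2 = x" using x' by (simp add: \<rho>_def)
    have r0: "0 < \<rho>" using x' by (simp add: \<rho>_def)
    have "x / (2 * pi\<^sup>2) \<le> 1 / pi" using x' by (simp add: power2_eq_square field_simps)
    then have "\<rho> \<le> sqrt (1 / pi)" unfolding \<rho>_def by (rule real_sqrt_le_mono)
    then have r1: "\<rho> \<le> 1 / sqrt pi" by (simp add: real_sqrt_divide)
    have zr: "z = complex_of_real \<rho> * cis \<theta>" by (simp add: x \<rho>_def)
    have "z \<in> twist_curve (fermat_angle e c)" unfolding zr onray[OF r0 r1] sq by (rule x'(3))
    moreover have "z \<in> closed_segment 0 p"
      unfolding in_segment using r0 r1
      by (intro exI[of _ "\<rho> * sqrt pi"]) (auto simp: zr p scaleR_conv_of_real field_simps)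
    moreover have "z \<noteq> 0" using r0 by (simp add: zr)
    ultimately show "z \<in> ?S" by blast
  qed
  moreover have "?F x0 \<noteq> ?F (x0 + pi)" by (simp add: power2_eq_square)
  ultimately show "card ?S = 2" by simp
qed

interpretation fermat: polar_spiral 0 "\<lambda>x. sqrt (x / (2 * pi\<^sup>2))" "\<lambda>\<rho>. 2 * pi\<^sup>2 * \<rho>\<^sup>2"
proof
  show "strict_mono_on {0..2 * pi} (\<lambda>x. sqrt (x / (2 * pi\<^sup>2)))"
    by (intro strict_mono_onI) (simp add: divide_strict_right_mono)
  show "continuous_on {0..2 * pi} (\<lambda>x. sqrt (x / (2 * pi\<^sup>2)))" by (intro continuous_intros) auto
  show "sqrt (2 * pi / (2 * pi\<^sup>2)) = 1 / sqrt pi" by (simp add: power2_eq_square real_sqrt_divide)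
qed auto

text \<open>For a linear squared radius the alternating sum in \<open>measure_arcs\<close> does not
  depend on p, which settles 0 < y < pi. Continuity adds y = 0, and
  \<open>arc_measure_add_pi\<close> carries the value to all other y.\<close>

lemma fermat_arcs: "emeasure lborel (twist_arcs (fermat_angle 1 0) y) = ennreal (1 / 2)"
proof -
  have fa: "fermat_angle 1 0 = (\<lambda>\<rho>. 0 + 2 * pi\<^sup>2 * \<rho>\<^sup>2)" by (auto simp: fermat_angle_def)
  have c: "continuous_on UNIV (fermat_angle 1 0)" by (rule continuous_fermat_angle)
  have n: "emeasure lborel {z \<in> disk. sin (y - 2 * fermat_angle 1 0 (cmod z)) = 0} = 0" for y
    unfolding fa by (rule fermat.arc_boundary_null)
  define G where "G y = measure lborel (twist_arcs (fermat_angle 1 0) y)" for y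
  have add: "G y + G (y + pi) = 1" for y unfolding G_def by (rule arc_measure_add_pi[OF c n])
  have inner: "G y = 1 / 2" if y: "y \<in> {0<..<pi}" for y
  proof -
    have p: "y / 2 \<in> {0<..<pi / 2}" using y by auto
    have sq: "(sqrt (x / (2 * pi\<^sup>2)))\<^sup>2 = x / (2 * pi\<^sup>2)" if "x \<ge> 0" for x using that by simp
    have "G y = pi * (y / 2 / (2 * pi\<^sup>2) + ((y / 2 + pi) / (2 * pi\<^sup>2) - (y / 2 + pi / 2) / (2 * pi\<^sup>2))) + (1 - pi * ((y / 2 + 3 * pi / 2) / (2 * pi\<^sup>2)))"
      using fermat.measure_arcs[OF p] y unfolding G_def fa by (simp add: sq)
    also have "\<dots> = 1 + pi * (y / 2 + (y / 2 + pi) - (y / 2 + pi / 2) - (y / 2 + 3 * pi / 2)) / (2 * pi\<^sup>2)"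
    proof -
      have "pi * (s / d + (t / d - u / d)) + (1 - pi * (v / d)) = 1 + pi * (s + t - u - v) / d" for s t u v d :: real
        by (simp add: algebra_simps add_divide_distrib diff_divide_distrib)
      then show ?thesis by blast
    qed
    also have "y / 2 + (y / 2 + pi) - (y / 2 + pi / 2) - (y / 2 + 3 * pi / 2) = - pi" by simp
    also have "1 + pi * (- pi) / (2 * pi\<^sup>2) = 1 / 2" by (simp add: power2_eq_square)
    finally show ?thesis .
  qed
  have zero: "G 0 = 1 / 2"
  proof -
    have "isCont G 0" unfolding G_def by (rule isCont_arc_measure[OF c n])
    then have "(G \<longlongrightarrow> G 0) (at_right 0)" by (simp add: isCont_def filterlim_at_split)
    moreover have "eventually (\<lambda>y. y \<in> {0<..<pi}) (at_right 0)" by (rule eventually_at_right_real) simp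
    then have "eventually (\<lambda>y. G y = 1 / 2) (at_right 0)" by eventually_elim (rule inner)
    then have "(G \<longlongrightarrow> 1 / 2) (at_right 0)" by (rule tendsto_eventually)
    ultimately show ?thesis using tendsto_unique[OF trivial_limit_at_right_real] by blast
  qed
  have base: "G y = 1 / 2" if "0 \<le> y" "y < pi" for y using inner[of y] zero that by (cases "y = 0") auto
  have shift: "G (y + of_int k * pi) = 1 / 2" if "G y = 1 / 2" for y and k :: int
  proof (induction k rule: int_induct[where k = 0])
    case (step1 i)
    then show ?case using add[of "y + of_int i * pi"] by (simp add: algebra_simps)
  next
    case (step2 i)
    then show ?case using add[of "y + of_int (i - 1) * pi"] by (simp add: algebra_simps)
  qed (use that in simp)
  define k where "k = \<lfloor>y / pi\<rfloor>"
  have "G (y - of_int k * pi) = 1 / 2"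
    using floor_divide_lower[OF pi_gt_zero, of y] floor_divide_upper[OF pi_gt_zero, of y]
    by (intro base) (auto simp: k_def algebra_simps)
  from shift[OF this, of k] have "G y = 1 / 2" by simp
  then show ?thesis using emeasure_eq_measure2[OF arcs_fmeasurable[OF c n], of y] by (simp only: G_def)
qed

lemma fermat_perfect:
  assumes e: "e = 1 \<or> e = -1" shows "perfect_set (twist_half (fermat_angle e c))"
proof (rule twist_half_perfect[OF continuous_fermat_angle])
  fix y
  show "emeasure lborel (twist_arcs (fermat_angle e c) y) = ennreal (1 / 2)"
  proof (cases "e = 1")
    case True
    then have "twist_arcs (fermat_angle e c) y = twist_arcs (fermat_angle 1 0) (y - 2 * c)"
      by (simp add: twist_arcs_def fermat_angle_def algebra_simps)
    then show ?thesis by (simp only: fermat_arcs)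
  next
    case False
    then have e': "e = -1" using e by simp
    \<comment> \<open>The mirror image reverses the sign of the angle; the extra pi restores the
      sign of the sine.\<close>
    have "2 * c - y + pi - 2 * fermat_angle 1 0 \<rho> = pi - (y - 2 * fermat_angle e c \<rho>)" for \<rho>
      by (simp add: fermat_angle_def e')
    then have "twist_arcs (fermat_angle e c) y = twist_arcs (fermat_angle 1 0) (2 * c - y + pi)"
      unfolding twist_arcs_def by (simp only: sin_pi_minus)
    then show ?thesis by (simp only: fermat_arcs)
  qed
qed

lemma fermat_perf:
  assumes e: "e = 1 \<or> e = -1" shows "cond_perf (twist_curve (fermat_angle e c))"
proof -
  have "(\<lambda>\<rho>. fermat_angle e c \<rho> + pi) = fermat_angle e (c + pi)" by (auto simp: fermat_angle_def)
  then show ?thesis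
    unfolding cond_perf_def using twist_components[OF continuous_fermat_angle[of _ e c]] fermat_perfect[OF e] by metis
qed

text \<open>The polynomial factors in the successive derivatives of z exp (k z^2 + b), of the same
  type as Hermite polynomials.\<close>

primrec gauss_poly :: "complex \<Rightarrow> nat \<Rightarrow> complex poly" where
  "gauss_poly k 0 = [:0, 1:]"
| "gauss_poly k (Suc n) = pderiv (gauss_poly k n) + [:0, 2 * k:] * gauss_poly k n"

lemma gauss_poly_deriv:
  "((\<lambda>z. poly (gauss_poly k n) z * exp (k * z\<^sup>2 + b)) has_field_derivative
      poly (gauss_poly k (Suc n)) z * exp (k * z\<^sup>2 + b)) (at z)"
  by (rule derivative_eq_intros poly_DERIV refl | simp add: algebra_simps)+

text \<open>The parameter is the signed modulus, rescaled to [0, 1]. In it the curve is the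
  restriction of an entire function and passes through the center with nonzero speed.\<close>

lemma fermat_smooth: "cond_smooth (twist_curve (fermat_angle e c))"
proof -
  define R where "R = 1 / sqrt pi"
  have R: "R > 0" by (simp add: R_def)
  define k where "k = \<i> * complex_of_real (e * (2 * pi\<^sup>2))"
  define b where "b = \<i> * complex_of_real c"
  define X where "X t = complex_of_real (R * (2 * t - 1))" for t
  define F where "F n z = poly (gauss_poly k n) z * exp (k * z\<^sup>2 + b)" for n z
  \<comment> \<open>The power of 2 R is the chain-rule factor of the affine substitution X.\<close>
  define d where "d n t = complex_of_real ((2 * R) ^ n) * F n (X t)" for n t
  have X_der: "(X has_vector_derivative complex_of_real (2 * R)) (at t within A)" for t A
    unfolding X_def by (auto intro!: derivative_eq_intros simp: has_vector_derivative_def scaleR_conv_of_real algebra_simps)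
  have d_der: "(d n has_vector_derivative d (Suc n) t) (at t within A)" for n t A
  proof -
    have "(F n has_field_derivative F (Suc n) (X t)) (at (X t) within X ` A)"
      unfolding F_def by (rule has_field_derivative_at_within[OF gauss_poly_deriv])
    from field_vector_diff_chain_within[OF X_der this]
    have "(F n \<circ> X has_vector_derivative complex_of_real (2 * R) * F (Suc n) (X t)) (at t within A)" .
    from has_vector_derivative_mult_right[OF this, of "complex_of_real ((2 * R) ^ n)"]
    show ?thesis by (simp add: d_def[abs_def] o_def mult_ac)
  qed
  have smooth: "infinitely_differentiable (d 0)"
    unfolding infinitely_differentiable_def by (intro exI[of _ d]) (use d_der in blast)
  have val: "d 0 t = complex_of_real (R * (2 * t - 1)) * cis (fermat_angle e c (R * (2 * t - 1)))" for t
  proof -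
    have "k * (X t)\<^sup>2 + b = \<i> * complex_of_real (fermat_angle e c (R * (2 * t - 1)))"
      by (simp add: k_def b_def X_def fermat_angle_def algebra_simps)
    then show ?thesis by (simp add: d_def F_def cis_conv_exp) (simp add: X_def)
  qed
  have lin: "(\<lambda>t. R * (2 * t - 1)) ` {0..1} = {- R..R}"
  proof (intro equalityI subsetI)
    fix x assume "x \<in> (\<lambda>t. R * (2 * t - 1)) ` {0..1}"
    then obtain t where t: "0 \<le> t" "t \<le> 1" "x = R * (2 * t - 1)" by auto
    then have "R * (2 * t) \<le> R * 2" "0 \<le> R * (2 * t)" using R by auto
    then show "x \<in> {- R..R}" unfolding t(3) by (simp add: algebra_simps)
  next
    fix x assume "x \<in> {- R..R}"
    then show "x \<in> (\<lambda>t. R * (2 * t - 1)) ` {0..1}"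
      using R by (intro image_eqI[of _ _ "(x / R + 1) / 2"]) (auto simp: field_simps)
  qed
  have img: "d 0 ` {0..1} = twist_curve (fermat_angle e c)"
    unfolding twist_curve_image fermat_angle_abs R_def[symmetric] lin[symmetric] image_image val ..
  have "vector_derivative (d 0) (at t within {0..1}) \<noteq> 0" if t: "t \<in> {0..1}" for t
  proof -
    have "vector_derivative (d 0) (at t within {0..1}) = d 1 t"
      using d_der[of 0 t] t by (intro vector_derivative_within_cbox[of 0 1, simplified]) auto
    moreover have "poly (gauss_poly k 1) (X t) \<noteq> 0"
    proof -
      \<comment> \<open>The polynomial is 1 + 2 k z^2, where k is imaginary and z = X t is
        real.\<close>
      have "Re (poly (gauss_poly k 1) (X t)) = 1" by (simp add: k_def X_def pderiv_pCons)
      then show ?thesis by (metis zero_complex.simps(1) zero_neq_one)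
    qed
    ultimately show ?thesis using R by (simp add: d_def F_def del: gauss_poly.simps)
  qed
  moreover have "d 0 ` {0..1} \<subseteq> disk" unfolding img by (auto simp: twist_curve_def)
  ultimately show ?thesis unfolding cond_smooth_def using smooth img by blast
qed

lemma fermat_algebraic: "algebraic_in_polar (twist_curve (fermat_angle e c))"
proof -
  let ?I = "{- (1 / sqrt pi)..1 / sqrt pi}"
  let ?C = "(\<lambda>x. (fermat_angle e c x, x)) ` ?I"
  let ?P = "[:[:c, -1:], 0, [:e * (2 * pi\<^sup>2):]:]"
  have "curve ?C"
    unfolding curve_def
    by (intro exI[of _ ?I] exI[of _ "\<lambda>x. (fermat_angle e c x, x)"] conjI continuous_intros continuous_fermat_angle)
      (auto simp: is_interval_cc)
  moreover have "?P \<noteq> 0" by simp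
  moreover have "\<forall>(\<phi>, r) \<in> ?C. poly (poly ?P [:r:]) \<phi> = 0"
    by (auto simp: fermat_angle_def power2_eq_square algebra_simps)
  ultimately have "algebraic_curve ?C" unfolding algebraic_curve_def by blast
  moreover have "twist_curve (fermat_angle e c) = polar ` ?C"
    unfolding twist_curve_image fermat_angle_abs image_image polar_eq_rcis ..
  ultimately show ?thesis unfolding algebraic_in_polar_def by blast
qed

text \<open>Continued by lines of slope 1, f becomes a monotone map of the real line onto itself,
  and such a map has no jumps.\<close>

lemma strict_mono_surj_continuous:
  fixes f :: "real \<Rightarrow> real"
  assumes mono: "strict_mono_on {a..b} f" and ab: "a \<le> b" and surj: "f ` {a..b} = {f a..f b}"
  shows "continuous_on {a..b} f"
proof -
  define F where "F x = (if x < a then f a + (x - a) else if x \<le> b then f x else f b + (x - b))" for x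
  have fab: "f a \<le> f b" using strict_mono_on_leD[OF mono, of a b] ab by simp
  have fr: "f a \<le> f x" "f x \<le> f b" if "x \<in> {a..b}" for x using surj that by (metis atLeastAtMost_iff image_eqI)+
  have "mono F"
  proof (rule monoI)
    fix x y :: real assume "x \<le> y"
    then show "F x \<le> F y"
      using fab fr[of x] fr[of y] strict_mono_on_leD[OF mono, of x y] by (auto simp: F_def)
  qed
  have "range F = UNIV"
  proof -
    have "y \<in> range F" for y
    proof -
      consider "y < f a" | "y \<in> {f a..f b}" | "y > f b" by force
      then show ?thesis
      proof cases
        case 1
        then have "y = F (a + (y - f a))" by (simp add: F_def)
        then show ?thesis by blast
      next
        case 2
        then obtain x where "x \<in> {a..b}" "y = f x" using surj by blast
        then have "y = F x" by (simp add: F_def)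
        then show ?thesis by blast
      next
        case 3
        then have "y = F (b + (y - f b))" using ab by (simp add: F_def)
        then show ?thesis by blast
      qed
    qed
    then show ?thesis by blast
  qed
  then have "continuous_on UNIV F" using monoD[OF \<open>mono F\<close>] by (intro continuous_onI_mono) auto
  then have "continuous_on {a..b} F" by (rule continuous_on_subset) simp
  then show ?thesis by (rule continuous_on_eq) (simp add: F_def)
qed

section \<open>Normal form of a spiral and the equivalence\<close>

lemma spiral_eq: "spiral l f = {complex_of_real r * cis \<phi> | r \<phi>. 0 \<le> \<phi> \<and> \<phi> \<le> pi * l \<and> \<bar>r\<bar> = f \<phi>}"
  unfolding spiral_def by (auto simp: polar_eq_rcis image_iff) (metis polar_eq_rcis)+

text \<open>The circle condition gives points of every modulus in (0, R], and compactness of the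
  smooth curve adds the center, so f vanishes at some a. Angles below a have f < 0 and carry no
  points. The radius condition fixes the remaining length at 2 pi. Hence f maps [a, pi l] onto
  [0, R], and a strictly monotone surjection is continuous.\<close>

lemma spiral_normal_form:
  assumes l: "l > 0" and mono: "strict_mono_on {0..pi * l} f" and last: "f (pi * l) = 1 / sqrt pi"
    and conc: "cond_conc (spiral l f)" and rad: "cond_rad' (spiral l f)" and smooth: "cond_smooth (spiral l f)"
  obtains a g \<Phi> where "polar_spiral g \<Phi>" "continuous_on UNIV \<Phi>" "spiral l f = twist_curve (\<lambda>\<rho>. a + \<Phi> \<rho>)"
proof -
  let ?R = "1 / sqrt pi" and ?\<beta> = "spiral l f"
  have R: "?R > 0" by simp
  have L0: "0 \<le> pi * l" using l by simp
  have mem: "complex_of_real r * cis \<phi> \<in> ?\<beta>" if "\<phi> \<in> {0..pi * l}" "\<bar>r\<bar> = f \<phi>" for r \<phi>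
    unfolding spiral_eq using that by auto
  have memE: "\<exists>r \<phi>. \<phi> \<in> {0..pi * l} \<and> \<bar>r\<bar> = f \<phi> \<and> z = complex_of_real r * cis \<phi>" if "z \<in> ?\<beta>" for z
    using that unfolding spiral_eq by auto
  have onto: "\<exists>\<phi>\<in>{0..pi * l}. f \<phi> = \<rho>" if "0 < \<rho>" "\<rho> \<le> ?R" for \<rho>
  proof -
    have "card (?\<beta> \<inter> sphere 0 \<rho>) = 2" using conc that unfolding cond_conc_def by blast
    then have "?\<beta> \<inter> sphere 0 \<rho> \<noteq> {}" by force
    then obtain z where "z \<in> ?\<beta> \<inter> sphere 0 \<rho>" by blast
    then have z: "z \<in> ?\<beta>" "cmod z = \<rho>" by auto
    from memE[OF z(1)] z(2) show ?thesis by (auto simp: norm_mult)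
  qed
  have "0 \<in> ?\<beta>"
  proof (rule ccontr)
    assume n: "0 \<notin> ?\<beta>"
    obtain \<gamma> where \<gamma>: "infinitely_differentiable \<gamma>" "\<gamma> ` {0..1} = ?\<beta>" using smooth unfolding cond_smooth_def by blast
    then obtain D where "D 0 = \<gamma>" "\<And>t. t \<in> {0..1} \<Longrightarrow> (D 0 has_vector_derivative D (Suc 0) t) (at t within {0..1})"
      unfolding infinitely_differentiable_def by blast
    then have "continuous_on {0..1} \<gamma>" by (intro continuous_on_vector_derivative) auto
    then have "closed ?\<beta>" unfolding \<gamma>(2)[symmetric] by (intro compact_imp_closed compact_continuous_image) auto
    then have "open (- ?\<beta>)" by (simp add: open_Compl)
    then obtain e where e: "e > 0" "ball 0 e \<subseteq> - ?\<beta>" using n open_contains_ball by (metis ComplI)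
    define \<rho> where "\<rho> = min (e / 2) ?R"
    have r: "0 < \<rho>" "\<rho> \<le> ?R" "\<rho> < e" using e R by (auto simp: \<rho>_def)
    obtain \<phi> where \<phi>: "\<phi> \<in> {0..pi * l}" "f \<phi> = \<rho>" using onto[OF r(1,2)] by blast
    have "complex_of_real \<rho> * cis \<phi> \<in> ?\<beta>" using \<phi> r by (intro mem) auto
    moreover have "complex_of_real \<rho> * cis \<phi> \<in> ball 0 e" using r by (simp add: norm_mult)
    ultimately show False using e(2) by blast
  qed
  from memE[OF this] obtain a where a: "a \<in> {0..pi * l}" "f a = 0" by auto
  have less: "\<phi> < \<phi>' \<longleftrightarrow> f \<phi> < f \<phi>'" if "\<phi> \<in> {0..pi * l}" "\<phi>' \<in> {0..pi * l}" for \<phi> \<phi>'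
    using strict_mono_on_less[OF mono that] by simp
  have inj: "\<phi> = \<phi>'" if "\<phi> \<in> {0..pi * l}" "\<phi>' \<in> {0..pi * l}" "f \<phi> = f \<phi>'" for \<phi> \<phi>'
    using less[OF that(1,2)] less[OF that(2,1)] that(3) by force
  have plmem: "pi * l \<in> {0..pi * l}" using L0 by simp
  have fpos: "0 < f \<phi>" "f \<phi> \<le> ?R" if "\<phi> \<in> {a<..pi * l}" for \<phi>
  proof -
    have p: "\<phi> \<in> {0..pi * l}" using that a by auto
    show "0 < f \<phi>" using less[OF a(1) p] that a(2) by auto
    show "f \<phi> \<le> ?R" using less[OF plmem p] that last by auto
  qed
  have seg: "complex_of_real \<rho> * cis \<theta> \<in> closed_segment 0 (complex_of_real ?R * cis \<theta>)" if "0 < \<rho>" "\<rho> \<le> ?R" for \<rho> \<theta>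
    unfolding in_segment using that
    by (intro exI[of _ "\<rho> * sqrt pi"]) (auto simp: scaleR_conv_of_real field_simps)
  \<comment> \<open>A longer spiral meets the radius at angle pi l in three points besides the
    center, a shorter one meets the radius at angle a in at most one.\<close>
  have L: "pi * l - a = 2 * pi"
  proof (rule ccontr)
    assume "pi * l - a \<noteq> 2 * pi"
    then consider "pi * l - a > 2 * pi" | "pi * l - a < 2 * pi" by linarith
    then show False
    proof cases
      case 1
      let ?p = "complex_of_real ?R * cis (pi * l)"
      let ?S = "?\<beta> \<inter> closed_segment 0 ?p - {0}"
      have "card ?S = 2" using rad unfolding cond_rad'_def by (simp add: norm_mult norm_divide)
      then have fin: "finite ?S" by (intro card_ge_0_finite) simp
      \<comment> \<open>Going back by j half turns leads to the same line through the center, and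
        the sign of r, left free by |r| = f, selects the same ray.\<close>
      let ?q = "\<lambda>j. complex_of_real (f (pi * l - real j * pi)) * cis (pi * l)"
      have jin: "pi * l - real j * pi \<in> {a<..pi * l}" if "j \<in> {0, 1, 2}" for j
      proof -
        have "0 \<le> real j" "real j \<le> 2" using that by auto
        then have "0 \<le> real j * pi" "real j * pi \<le> 2 * pi" by (auto intro: mult_right_mono)
        then show ?thesis using 1 unfolding greaterThanAtMost_iff by linarith
      qed
      have qS: "?q j \<in> ?S" if j: "j \<in> {0, 1, 2}" for j
      proof -
        have p: "0 < f (pi * l - real j * pi)" "f (pi * l - real j * pi) \<le> ?R" using fpos[OF jin[OF j]] by auto
        have "cis (pi * l) = complex_of_real ((- 1) ^ j) * cis (pi * l - real j * pi)"
        proof -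
          have "cis (pi * l) = cis (real j * pi) * cis (pi * l - real j * pi)" by (simp add: cis_mult)
          moreover have "cis (real j * pi) = (- 1) ^ j"
          proof -
            have "cis pi = - 1" by (simp add: complex_eq_iff)
            then show ?thesis using Complex.DeMoivre[of pi j] by simp
          qed
          ultimately show ?thesis by simp
        qed
        then have "?q j = complex_of_real (f (pi * l - real j * pi) * (- 1) ^ j) * cis (pi * l - real j * pi)" by simp
        moreover have "complex_of_real (f (pi * l - real j * pi) * (- 1) ^ j) * cis (pi * l - real j * pi) \<in> ?\<beta>"
        proof (rule mem)
          show "pi * l - real j * pi \<in> {0..pi * l}"
            using jin[OF j] a(1) unfolding greaterThanAtMost_iff atLeastAtMost_iff by linarith
          show "\<bar>f (pi * l - real j * pi) * (- 1) ^ j\<bar> = f (pi * l - real j * pi)" using p by (simp add: abs_mult power_abs)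
        qed
        ultimately have "?q j \<in> ?\<beta>" by (simp only:)
        then show ?thesis using seg[OF p] p by auto
      qed
      have "?q ` {0, 1, 2} \<subseteq> ?S" by (rule image_subsetI) (rule qS)
      from card_mono[OF fin this] have "card (?q ` {0, 1, 2}) \<le> 2" using \<open>card ?S = 2\<close> by simp
      moreover have "inj_on ?q {0, 1, 2}"
      proof (rule inj_onI)
        fix i j assume ij: "i \<in> {0, 1, 2}" "j \<in> {0, 1, 2::nat}" "?q i = ?q j"
        then have feq: "f (pi * l - real i * pi) = f (pi * l - real j * pi)" by simp
        have kin: "pi * l - real k * pi \<in> {0..pi * l}" if "k \<in> {0, 1, 2}" for k
          using jin[OF that] a(1) unfolding greaterThanAtMost_iff atLeastAtMost_iff by linarith
        have "pi * l - real i * pi = pi * l - real j * pi" by (rule inj[OF kin[OF ij(1)] kin[OF ij(2)] feq])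
        then show "i = j" by simp
      qed
      ultimately show False by (simp add: card_image)
    next
      case 2
      let ?p = "complex_of_real ?R * cis a"
      let ?S = "?\<beta> \<inter> closed_segment 0 ?p - {0}"
      have c: "card ?S = 2" using rad unfolding cond_rad'_def by (simp add: norm_mult norm_divide)
      have "z = complex_of_real (f (a + pi)) * cis a" if z: "z \<in> ?S" for z
      proof -
        obtain u where u: "0 \<le> u" "z = u *\<^sub>R ?p" using z by (auto simp: in_segment)
        define \<rho> where "\<rho> = u * ?R"
        have zr: "z = complex_of_real \<rho> * cis a" by (simp add: u \<rho>_def scaleR_conv_of_real)
        then have r: "\<rho> > 0" using z u by (auto simp: \<rho>_def)
        obtain r \<phi> where rp: "\<phi> \<in> {0..pi * l}" "\<bar>r\<bar> = f \<phi>" "z = complex_of_real r * cis \<phi>" using memE z by blast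
        have "cmod z = \<rho>" unfolding zr using r by (simp add: norm_mult)
        moreover have "cmod z = f \<phi>" unfolding rp(3) using rp(2) by (simp add: norm_mult)
        ultimately have fr: "f \<phi> = \<rho>" by simp
        then have "a < \<phi>" using less[OF a(1) rp(1)] a(2) r by simp
        have "r * sin (\<phi> - a) = Im (z * cis (- a))" unfolding rp(3) Im_rcis_cis ..
        also have "\<dots> = 0" unfolding zr Im_rcis_cis by simp
        finally have "r * sin (\<phi> - a) = 0" .
        then have "sin (\<phi> - a) = 0" using rp(2) fr r by auto
        then obtain n :: int where n: "\<phi> - a = of_int n * pi" using sin_zero_iff_int2 by blast
        have "0 * pi < of_int n * pi" "of_int n * pi < 2 * pi" using n \<open>a < \<phi>\<close> rp(1) 2 unfolding atLeastAtMost_iff by linarith+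
        then have "0 < real_of_int n" "real_of_int n < 2" using mult_less_cancel_right_pos[OF pi_gt_zero] by blast+
        then have "n = 1" by linarith
        then have "\<phi> = a + pi" using n by simp
        then show ?thesis using zr fr by simp
      qed
      then have "?S \<subseteq> {complex_of_real (f (a + pi)) * cis a}" by blast
      from card_mono[OF _ this] c show False by simp
    qed
  qed
  define g where "g x = f (a + x)" for x
  have sh: "a + x \<in> {0..pi * l}" if "x \<in> {0..2 * pi}" for x using that a L by auto
  have g0: "g 0 = 0" by (simp add: g_def a)
  have g1: "g (2 * pi) = ?R" using L last by (simp add: g_def algebra_simps)
  have gmono: "strict_mono_on {0..2 * pi} g"
    unfolding g_def by (rule strict_mono_onI, rule less[THEN iffD1, OF sh sh]) auto
  have gsurj: "g ` {0..2 * pi} = {g 0..g (2 * pi)}"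
  proof (intro equalityI subsetI)
    fix y assume "y \<in> g ` {0..2 * pi}"
    then show "y \<in> {g 0..g (2 * pi)}" using strict_mono_on_leD[OF gmono] by auto
  next
    fix y assume y: "y \<in> {g 0..g (2 * pi)}"
    show "y \<in> g ` {0..2 * pi}"
    proof (cases "y = 0")
      case True
      then show ?thesis using g0 by (intro image_eqI[of _ _ 0]) auto
    next
      case False
      then obtain \<phi> where p: "\<phi> \<in> {0..pi * l}" "f \<phi> = y" using onto[of y] y g0 g1 by auto
      then have "a < \<phi>" using less[OF a(1) p(1)] a(2) y g0 False by auto
      then show ?thesis using p L by (intro image_eqI[of _ _ "\<phi> - a"]) (auto simp: g_def)
    qed
  qed
  have gcont: "continuous_on {0..2 * pi} g" by (rule strict_mono_surj_continuous[OF gmono _ gsurj]) simp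
  \<comment> \<open>Clamping the argument to [0, R] makes the inverse continuous on the whole line,
    as the results on measures ask.\<close>
  define \<Phi> where "\<Phi> \<rho> = inv_into {0..2 * pi} g (max 0 (min ?R \<rho>))" for \<rho>
  have \<Phi>g: "\<Phi> (g x) = x" if x: "x \<in> {0..2 * pi}" for x
  proof -
    have "g x \<in> {g 0..g (2 * pi)}" using gsurj x by blast
    then have "max 0 (min ?R (g x)) = g x" using g0 g1 by auto
    then show ?thesis using inv_into_f_f[OF strict_mono_on_imp_inj_on[OF gmono] x] by (simp add: \<Phi>_def)
  qed
  have ps: "polar_spiral g \<Phi>" by unfold_locales (use gmono gcont g0 g1 \<Phi>g in auto)
  interpret polar_spiral a g \<Phi> by (rule ps)
  have \<Phi>c: "continuous_on UNIV \<Phi>"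
  proof -
    have "continuous_on UNIV (\<lambda>\<rho>. \<Phi> (max 0 (min ?R \<rho>)))"
    proof (rule continuous_on_compose2[OF \<Phi>_cont])
      show "continuous_on UNIV (\<lambda>\<rho>. max 0 (min ?R \<rho>))" by (intro continuous_intros)
    qed (use R in auto)
    moreover have "\<Phi> (max 0 (min ?R \<rho>)) = \<Phi> \<rho>" for \<rho>
    proof -
      have "max 0 (min ?R (max 0 (min ?R \<rho>))) = max 0 (min ?R \<rho>)" using R by linarith
      then show ?thesis unfolding \<Phi>_def by simp
    qed
    ultimately show ?thesis by simp
  qed
  have "?\<beta> = twist_curve (\<lambda>\<rho>. a + \<Phi> \<rho>)"
  proof (intro equalityI subsetI)
    fix z assume "z \<in> ?\<beta>"
    then obtain r \<phi> where rp: "\<phi> \<in> {0..pi * l}" "\<bar>r\<bar> = f \<phi>" "z = complex_of_real r * cis \<phi>" using memE by blast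
    have "\<not> \<phi> < a" using less[OF rp(1) a(1)] a(2) rp(2) by auto
    then have x: "\<phi> - a \<in> {0..2 * pi}" using rp(1) L by auto
    have gx: "g (\<phi> - a) = \<bar>r\<bar>" by (simp add: g_def rp)
    then have "\<Phi> \<bar>r\<bar> = \<phi> - a" using \<Phi>g[OF x] by simp
    then have zr: "z = complex_of_real r * cis (a + \<Phi> \<bar>r\<bar>)" using rp(3) by simp
    have "g (\<phi> - a) \<in> {0..?R}" unfolding g_image[symmetric] using x by (rule imageI)
    then have "r \<in> {- ?R..?R}" unfolding gx atLeastAtMost_iff by linarith
    then show "z \<in> twist_curve (\<lambda>\<rho>. a + \<Phi> \<rho>)"
      unfolding twist_curve_image using zr by (rule image_eqI[rotated])
  next
    fix z assume "z \<in> twist_curve (\<lambda>\<rho>. a + \<Phi> \<rho>)"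
    then obtain r where r: "r \<in> {- ?R..?R}" "z = complex_of_real r * cis (a + \<Phi> \<bar>r\<bar>)"
      unfolding twist_curve_image by blast
    have "\<bar>r\<bar> \<in> {0..?R}" using r(1) unfolding atLeastAtMost_iff by linarith
    from \<Phi>_range[OF this] have "a + \<Phi> \<bar>r\<bar> \<in> {0..pi * l}" "\<bar>r\<bar> = f (a + \<Phi> \<bar>r\<bar>)" using sh by (auto simp: g_def)
    then show "z \<in> ?\<beta>" unfolding r(2) by (rule mem)
  qed
  then show ?thesis using that ps \<Phi>c by blast
qed

theorem theorem16:
  fixes l :: real and f :: "real \<Rightarrow> real" and \<beta> :: "complex set"
  assumes "l > 0"
    and "strict_mono_on {0..pi * l} f"
    and "f (pi * l) = 1 / sqrt pi"
    and "\<beta> = spiral l f"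
  shows "(cond_cong \<beta> \<and> cond_conc \<beta> \<and> cond_rad' \<beta> \<and> cond_perf \<beta> \<and>
          cond_smooth \<beta> \<and> algebraic_in_polar \<beta>)
         \<longleftrightarrow> congruent_sets \<beta> fermat_spiral"
proof
  assume A: "cond_cong \<beta> \<and> cond_conc \<beta> \<and> cond_rad' \<beta> \<and> cond_perf \<beta> \<and> cond_smooth \<beta> \<and> algebraic_in_polar \<beta>"
  then obtain a g \<Phi> where ps: "polar_spiral g \<Phi>" and \<Phi>c: "continuous_on UNIV \<Phi>"
    and \<beta>: "\<beta> = twist_curve (\<lambda>\<rho>. a + \<Phi> \<rho>)"
    using spiral_normal_form[OF assms(1-3)] unfolding assms(4) by metis
  interpret polar_spiral a g \<Phi> by (rule ps)
  have "continuous_on {0<..1 / sqrt pi} (\<lambda>\<rho>. a + \<Phi> \<rho>)"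
    by (intro continuous_intros continuous_on_subset[OF \<Phi>c]) auto
  \<comment> \<open>The two components form an unordered pair, so this half is one of the two
    perfect sets.\<close>
  from twist_components[OF this] A have perf: "perfect_set (twist_half (\<lambda>\<rho>. a + \<Phi> \<rho>))"
    unfolding cond_perf_def splits_disk_def \<beta> by (metis doubleton_eq_iff)
  have "a + \<Phi> \<rho> = fermat_angle 1 0 \<rho> + a" if r: "\<rho> \<in> {0..1 / sqrt pi}" for \<rho>
  proof -
    have "\<rho>\<^sup>2 = \<Phi> \<rho> / (2 * pi\<^sup>2)"
      using linear_square[OF \<Phi>c perf, of "\<Phi> \<rho>"] A \<Phi>_range[OF r] unfolding \<beta> by simp
    then show ?thesis by (simp add: fermat_angle_def)
  qed
  then have \<beta>': "\<beta> = twist_curve (\<lambda>\<rho>. fermat_angle 1 0 \<rho> + a)" unfolding \<beta> by (rule twist_curve_cong)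
  have "(\<lambda>z. cis (- a) * z) ` \<beta> = fermat_spiral"
    unfolding \<beta>' fermat_spiral_twist rotate_twist_curve by simp
  moreover have "plane_isometry (\<lambda>z. cis (- a) * z)"
    unfolding plane_isometry_def by (simp add: dist_norm norm_mult flip: right_diff_distrib)
  ultimately show "congruent_sets \<beta> fermat_spiral" unfolding congruent_sets_def by blast
next
  assume "congruent_sets \<beta> fermat_spiral"
  then obtain s where s: "plane_isometry s" "s ` \<beta> = fermat_spiral" unfolding congruent_sets_def by blast
  let ?p = "complex_of_real (1 / sqrt pi) * cis (pi * l)"
  \<comment> \<open>Nothing is known yet about the inner part of \<beta>, but its two outer ends are
    antipodal points of the rim, and their images in the disk force s to fix the center.\<close>
  have "?p \<in> \<beta>" "- ?p \<in> \<beta>"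
  proof -
    have "\<exists>r \<phi>. ?p = complex_of_real r * cis \<phi> \<and> 0 \<le> \<phi> \<and> \<phi> \<le> pi * l \<and> \<bar>r\<bar> = f \<phi>"
      using assms by (intro exI[of _ "1 / sqrt pi"] exI[of _ "pi * l"]) auto
    moreover have "\<exists>r \<phi>. - ?p = complex_of_real r * cis \<phi> \<and> 0 \<le> \<phi> \<and> \<phi> \<le> pi * l \<and> \<bar>r\<bar> = f \<phi>"
      using assms by (intro exI[of _ "- 1 / sqrt pi"] exI[of _ "pi * l"]) auto
    ultimately show "?p \<in> \<beta>" "- ?p \<in> \<beta>" unfolding assms(4) spiral_eq by blast+
  qed
  then have "s ?p \<in> disk" "s (- ?p) \<in> disk" using s(2) unfolding fermat_spiral_twist twist_curve_def by blast+
  then have "s 0 = 0" by (intro isometry_fixes_center[OF s(1), of ?p]) (auto simp: disk_def norm_mult norm_divide)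
  \<comment> \<open>\<beta> is recovered from Fermat's spiral by the inverse of s: a rotation gives
    e = 1, and a reflection, being its own inverse, gives e = -1.\<close>
  with s(1) have "\<exists>e c. (e = 1 \<or> e = -1) \<and> \<beta> = twist_curve (fermat_angle e c)"
  proof (rule isometry_fixing_0_cases)
    fix c assume sc: "\<And>z. s z = cis c * z"
    have "(\<lambda>z. cis (- c) * z) ` s ` \<beta> = \<beta>" by (simp add: sc image_image cis_mult flip: mult.assoc)
    then have "\<beta> = twist_curve (\<lambda>\<rho>. fermat_angle 1 0 \<rho> + - c)"
      unfolding s(2) fermat_spiral_twist rotate_twist_curve by simp
    also have "(\<lambda>\<rho>. fermat_angle 1 0 \<rho> + - c) = fermat_angle 1 (- c)" by (auto simp: fermat_angle_def)
    finally show ?thesis by blast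
  next
    fix c assume sc: "\<And>z. s z = cis c * cnj z"
    have "(\<lambda>z. cis c * cnj z) ` s ` \<beta> = \<beta>" by (simp add: sc image_image cis_cnj cis_mult flip: mult.assoc)
    then have "\<beta> = twist_curve (\<lambda>\<rho>. c - fermat_angle 1 0 \<rho>)"
      unfolding s(2) fermat_spiral_twist mirror_twist_curve by simp
    also have "(\<lambda>\<rho>. c - fermat_angle 1 0 \<rho>) = fermat_angle (-1) c" by (auto simp: fermat_angle_def)
    finally show ?thesis by blast
  qed
  then obtain e c where e: "e = 1 \<or> e = -1" and \<beta>: "\<beta> = twist_curve (fermat_angle e c)" by blast
  show "cond_cong \<beta> \<and> cond_conc \<beta> \<and> cond_rad' \<beta> \<and> cond_perf \<beta> \<and> cond_smooth \<beta> \<and> algebraic_in_polar \<beta>"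
    unfolding \<beta>
    using twist_cong[OF continuous_fermat_angle] twist_conc fermat_rad'[OF e] fermat_perf[OF e] fermat_smooth
      fermat_algebraic by blast
qed

end
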